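(* Let $(G,\{U_\alpha\}_{\alpha\in\Phi},T)$ be an RGD system of type $(W,S)$ with associated twin building $\Delta$, $\Delta_\pm=G/B_\pm$. Let $c_+=gB_+\in\Delta_+$ and $c_-=hB_-\in\Delta_-$, let $\delta^*(c_+,c_-)=w\in W$, and let $s\in S$ be such that $l(ws)>l(w)$. Then $$\mathrm{proj}^*_{P_s(c_-)}(c_+)=h\,\rho_w(g^{-1}h)^{-1}\,sB_-.$$
   Context: **RGD systems.** Let $\Phi$ be the root system of the Coxeter system $(W,S)$ (finite rank), $\Phi^+$ the positive roots, $\alpha_s$ the simple root of $s\in S$. An RGD system of type $(W,S)$ is a triple $(G,\{U_\alpha\}_{\alpha\in\Phi},T)$ with $G$ a group and $U_\alpha,T$ subgroups such that: (RGD0) $U_\alpha\ne\{1\}$; (RGD1) $[U_\alpha,U_\beta]\subseteq\langle U_\gamma\mid\gamma\in{]\alpha,\beta[}\rangle$ for every prenilpotent pair of distinct roots; (RGD2) for each $s\in S$ there is $\mu_s:U_{\alpha_s}\setminus\{1\}\to G$ with $\mu_s(u)\in U_{-\alpha_s}uU_{-\alpha_s}$ and $\mu_s(u)U_\alpha\mu_s(u)^{-1}=U_{s(\alpha)}$ for all $\alpha\in\Phi$; (RGD3) $U_{-\alpha_s}\not\subseteq U_+:=\langle U_\alpha\mid\alpha\in\Phi^+\rangle$; (RGD4) $G=T\langle U_\alpha\mid\alpha\in\Phi\rangle$; (RGD5) $T$ normalizes every $U_\alpha$. (Viewing roots as half-spaces, $\{\alpha,\beta\}$ is prenilpotent if $\alpha\cap\beta$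 and $(-\alpha)\cap(-\beta)$ are non-empty; $]\alpha,\beta[$ is the set of roots $\gamma\ne\alpha,\beta$ with $\alpha\cap\beta\subseteq\gamma$ and $(-\alpha)\cap(-\beta)\subseteq-\gamma$.) Put $U_-=\langle U_{-\alpha}\mid\alpha\in\Phi^+\rangle$, $B_\pm=TU_\pm$, $N=T\langle\mu_s(u)\mid s\in S,\ u\in U_{\alpha_s}\setminus\{1\}\rangle$. Then $(B_+,B_-,N)$ is a twin $BN$-pair with $N/T\cong W$. Elements of $W$ occurring in products denote (any fixed) representatives in $N$. **Associated twin building.** $\Delta_\pm=G/B_\pm$, $\delta_\pm(gB_\pm,hB_\pm)=w\iff B_\pm g^{-1}hB_\pm=B_\pm wB_\pm$, $\delta^*(gB_\pm,hB_\mp)=w\iff B_\pm g^{-1}hB_\mp=B_\pm wB_\mp$. The $s$-panel of $c\in\Delta_\pm$ is $P_s(c)=\{d\mid\delta_\pm(c,d)\in\{1,s\}\}$. For $c\in\Delta_+$ and a panel $P\subseteq\Delta_-$, $\mathrm{proj}^*_P(c)$ is the unique $d\in P$ such that $\delta^*(c,d)$ is maximal in $\delta^*(c,P)$ with respect to the Bruhat order. **The map $\rho_w$.** The product map $U_+\times T\times U_-\to B_+B_-$ is bijective; so for $x\in B_+B_-$ there is a unique $\pi(x)\in B_-$ with $U_+x=U_+\pi(x)$. For $w\in W$ one has $w^{-1}B_+wB_-\subseteq B_+B_-$, and $\rho_w:B_+wB_-\to B_-$ is defined by $\rho_w(x)=\pi(w^{-1}x)$. *)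

theory Defs
  imports "HOL-Algebra.Algebra"
begin

section \<open>Coxeter systems\<close>

definition word_prod :: "('w, 'x) monoid_scheme \<Rightarrow> 'w list \<Rightarrow> 'w" where
  "word_prod W ws = foldr (\<lambda>a b. a \<otimes>\<^bsub>W\<^esub> b) ws \<one>\<^bsub>W\<^esub>"

text \<open>
  The congruence on words over \<open>S\<close> generated by the relations \<open>(st)\<^sup>m = 1\<close>, where \<open>m\<close> is the
  order of \<open>st\<close> in \<open>W\<close> (\<open>group.ord\<close> is \<open>0\<close> for elements of infinite order). The case \<open>s = t\<close>
  gives the relations \<open>ss = 1\<close>, so formal inverses of generators are not needed.
\<close>

inductive coxeter_cong :: "('w, 'x) monoid_scheme \<Rightarrow> 'w set \<Rightarrow> 'w list \<Rightarrow> 'w list \<Rightarrow> bool"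
  for W S where
  refl: "us \<in> lists S \<Longrightarrow> coxeter_cong W S us us"
| sym: "coxeter_cong W S us vs \<Longrightarrow> coxeter_cong W S vs us"
| trans: "coxeter_cong W S us vs \<Longrightarrow> coxeter_cong W S vs ws \<Longrightarrow> coxeter_cong W S us ws"
| relation: "us \<in> lists S \<Longrightarrow> vs \<in> lists S \<Longrightarrow> s \<in> S \<Longrightarrow> t \<in> S \<Longrightarrow>
    group.ord W (s \<otimes>\<^bsub>W\<^esub> t) \<noteq> 0 \<Longrightarrow>
    coxeter_cong W S (us @ concat (replicate (group.ord W (s \<otimes>\<^bsub>W\<^esub> t)) [s, t]) @ vs) (us @ vs)"

locale coxeter_system = group W for W (structure) and S +
  assumes finite_S: "finite S"
    and S_subset: "S \<subseteq> carrier W"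
    and S_involution: "s \<in> S \<Longrightarrow> s \<noteq> \<one>\<^bsub>W\<^esub> \<and> s \<otimes>\<^bsub>W\<^esub> s = \<one>\<^bsub>W\<^esub>"
    and S_generates: "generate W S = carrier W"
    and presentation: "us \<in> lists S \<Longrightarrow> vs \<in> lists S \<Longrightarrow>
      word_prod W us = word_prod W vs \<Longrightarrow> coxeter_cong W S us vs"
begin

definition len :: "'a \<Rightarrow> nat" where
  "len w = (LEAST k. \<exists>us \<in> lists S. length us = k \<and> word_prod W us = w)"

definition reflections :: "'a set" where
  "reflections = {w \<otimes>\<^bsub>W\<^esub> s \<otimes>\<^bsub>W\<^esub> inv\<^bsub>W\<^esub> w | w s. w \<in> carrier W \<and> s \<in> S}"

definition bruhat_step :: "'a \<Rightarrow> 'a \<Rightarrow> bool" where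
  "bruhat_step v w \<longleftrightarrow> v \<in> carrier W \<and> (\<exists>r \<in> reflections. w = v \<otimes>\<^bsub>W\<^esub> r) \<and> len v < len w"

definition bruhat_le :: "'a \<Rightarrow> 'a \<Rightarrow> bool" where
  "bruhat_le = bruhat_step\<^sup>*\<^sup>*"

definition bruhat_less :: "'a \<Rightarrow> 'a \<Rightarrow> bool" where
  "bruhat_less v w \<longleftrightarrow> bruhat_le v w \<and> v \<noteq> w"

text \<open>
  Roots are half-spaces in \<open>W\<close>, the chambers of the Coxeter complex; \<open>W\<close> acts by left
  translation and the positive roots are those containing \<open>1\<close>.
\<close>

definition simple_root :: "'a \<Rightarrow> 'a set" where
  "simple_root s = {w \<in> carrier W. len (s \<otimes>\<^bsub>W\<^esub> w) > len w}"

definition roots :: "'a set set" where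
  "roots = {w <#\<^bsub>W\<^esub> simple_root s | w s. w \<in> carrier W \<and> s \<in> S}"

definition pos_roots :: "'a set set" where
  "pos_roots = {\<alpha> \<in> roots. \<one>\<^bsub>W\<^esub> \<in> \<alpha>}"

definition neg :: "'a set \<Rightarrow> 'a set" where
  "neg \<alpha> = carrier W - \<alpha>"

definition prenilpotent :: "'a set \<Rightarrow> 'a set \<Rightarrow> bool" where
  "prenilpotent \<alpha> \<beta> \<longleftrightarrow> \<alpha> \<inter> \<beta> \<noteq> {} \<and> neg \<alpha> \<inter> neg \<beta> \<noteq> {}"

definition open_interval :: "'a set \<Rightarrow> 'a set \<Rightarrow> 'a set set" where
  "open_interval \<alpha> \<beta> = {\<gamma> \<in> roots. \<gamma> \<noteq> \<alpha> \<and> \<gamma> \<noteq> \<beta> \<and> \<alpha> \<inter> \<beta> \<subseteq> \<gamma> \<and> neg \<alpha> \<inter> neg \<beta> \<subseteq> neg \<gamma>}"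

end

section \<open>RGD systems\<close>

definition conj_set :: "('g, 'y) monoid_scheme \<Rightarrow> 'g \<Rightarrow> 'g set \<Rightarrow> 'g set" where
  "conj_set G g H = (g <#\<^bsub>G\<^esub> H) #>\<^bsub>G\<^esub> inv\<^bsub>G\<^esub> g"

definition double_coset :: "('g, 'y) monoid_scheme \<Rightarrow> 'g set \<Rightarrow> 'g \<Rightarrow> 'g set \<Rightarrow> 'g set" where
  "double_coset G H g K = (H #>\<^bsub>G\<^esub> g) <#>\<^bsub>G\<^esub> K"

definition commutator_subgroup :: "('g, 'y) monoid_scheme \<Rightarrow> 'g set \<Rightarrow> 'g set \<Rightarrow> 'g set" where
  "commutator_subgroup G H K = generate G
     {h \<otimes>\<^bsub>G\<^esub> k \<otimes>\<^bsub>G\<^esub> inv\<^bsub>G\<^esub> h \<otimes>\<^bsub>G\<^esub> inv\<^bsub>G\<^esub> k | h k. h \<in> H \<and> k \<in> K}"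

locale root_group_data = coxeter_system W S + G: group G
  for W :: "('w, 'x) monoid_scheme" (structure) and S
    and G :: "('g, 'y) monoid_scheme" (structure) +
  fixes U :: "'w set \<Rightarrow> 'g set" and T :: "'g set"
  assumes U_subgroup: "\<alpha> \<in> roots \<Longrightarrow> subgroup (U \<alpha>) G"
    and T_subgroup: "subgroup T G"
begin

definition U_plus :: "'g set" where
  "U_plus = generate G (\<Union>\<alpha> \<in> pos_roots. U \<alpha>)"

definition U_minus :: "'g set" where
  "U_minus = generate G (\<Union>\<alpha> \<in> pos_roots. U (neg \<alpha>))"

text \<open>The property of \<open>\<mu>\<^sub>s\<close> in (RGD2); only the values on \<open>U\<^bsub>\<alpha>\<^sub>s\<^esub> - {1}\<close> matter.\<close>

definition mu_map :: "'w \<Rightarrow> ('g \<Rightarrow> 'g) \<Rightarrow> bool" where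
  "mu_map s m \<longleftrightarrow> (\<forall>u \<in> U (simple_root s) - {\<one>\<^bsub>G\<^esub>}.
     m u \<in> double_coset G (U (neg (simple_root s))) u (U (neg (simple_root s))) \<and>
     (\<forall>\<alpha> \<in> roots. conj_set G (m u) (U \<alpha>) = U (s <#\<^bsub>W\<^esub> \<alpha>)))"

definition mu_family :: "('w \<Rightarrow> 'g \<Rightarrow> 'g) \<Rightarrow> bool" where
  "mu_family \<mu> \<longleftrightarrow> (\<forall>s \<in> S. mu_map s (\<mu> s))"

end

locale rgd_system = root_group_data W S G U T
  for W :: "('w, 'x) monoid_scheme" (structure) and S
    and G :: "('g, 'y) monoid_scheme" (structure) and U T +
  assumes RGD0: "\<alpha> \<in> roots \<Longrightarrow> U \<alpha> \<noteq> {\<one>\<^bsub>G\<^esub>}"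
    and RGD1: "\<alpha> \<in> roots \<Longrightarrow> \<beta> \<in> roots \<Longrightarrow> \<alpha> \<noteq> \<beta> \<Longrightarrow> prenilpotent \<alpha> \<beta> \<Longrightarrow>
      commutator_subgroup G (U \<alpha>) (U \<beta>) \<subseteq> generate G (\<Union>\<gamma> \<in> open_interval \<alpha> \<beta>. U \<gamma>)"
    and RGD2: "s \<in> S \<Longrightarrow> \<exists>m. mu_map s m"
    and RGD3: "s \<in> S \<Longrightarrow> \<not> U (neg (simple_root s)) \<subseteq> U_plus"
    and RGD4: "carrier G = T <#>\<^bsub>G\<^esub> generate G (\<Union>\<alpha> \<in> roots. U \<alpha>)"
    and RGD5: "t \<in> T \<Longrightarrow> \<alpha> \<in> roots \<Longrightarrow> conj_set G t (U \<alpha>) = U \<alpha>"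
begin

definition B_plus :: "'g set" where
  "B_plus = T <#>\<^bsub>G\<^esub> U_plus"

definition B_minus :: "'g set" where
  "B_minus = T <#>\<^bsub>G\<^esub> U_minus"

definition N_group :: "('w \<Rightarrow> 'g \<Rightarrow> 'g) \<Rightarrow> 'g set" where
  "N_group \<mu> = T <#>\<^bsub>G\<^esub>
     generate G {\<mu> s u | s u. s \<in> S \<and> u \<in> U (simple_root s) - {\<one>\<^bsub>G\<^esub>}}"

text \<open>
  The representatives in \<open>N\<close> of \<open>w\<close> under the canonical isomorphism \<open>N/T \<cong> W\<close>, the one sending
  each \<open>\<mu>\<^sub>s(u)T\<close> to \<open>s\<close>. It is unique, since the cosets \<open>\<mu>\<^sub>s(u)T\<close> generate \<open>N/T\<close>.
\<close>

definition representatives :: "('w \<Rightarrow> 'g \<Rightarrow> 'g) \<Rightarrow> 'w \<Rightarrow> 'g set" where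
  "representatives \<mu> w = {n \<in> N_group \<mu>.
     \<exists>\<phi> \<in> iso (G\<lparr>carrier := N_group \<mu>\<rparr> Mod T) W.
       (\<forall>s \<in> S. \<forall>u \<in> U (simple_root s) - {\<one>\<^bsub>G\<^esub>}. \<phi> (T #>\<^bsub>G\<^esub> \<mu> s u) = s) \<and>
       \<phi> (T #>\<^bsub>G\<^esub> n) = w}"

subsection \<open>The associated twin building\<close>

definition chambers_minus :: "'g set set" where
  "chambers_minus = {g <#\<^bsub>G\<^esub> B_minus | g. g \<in> carrier G}"

text \<open>
  The common form of \<open>\<delta>\<^sub>-\<close> and \<open>\<delta>\<^sup>*\<close>: the \<open>w\<close> assigned to cosets \<open>c = gB\<close> and \<open>d = hB'\<close> is
  determined by \<open>B g\<^sup>-\<^sup>1h B' = B w B'\<close>. The double cosets do not depend on the choice of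
  \<open>g\<close>, \<open>h\<close> and of the representative of \<open>w\<close>.
\<close>

definition coset_dist ::
  "('w \<Rightarrow> 'g \<Rightarrow> 'g) \<Rightarrow> 'g set \<Rightarrow> 'g set \<Rightarrow> 'g set \<Rightarrow> 'g set \<Rightarrow> 'w" where
  "coset_dist \<mu> B B' c d = (THE w. w \<in> carrier W \<and>
     (\<exists>g \<in> carrier G. \<exists>h \<in> carrier G. \<exists>n \<in> representatives \<mu> w.
        c = g <#\<^bsub>G\<^esub> B \<and> d = h <#\<^bsub>G\<^esub> B' \<and>
        double_coset G B (inv\<^bsub>G\<^esub> g \<otimes>\<^bsub>G\<^esub> h) B' = double_coset G B n B'))"

definition dist_minus :: "('w \<Rightarrow> 'g \<Rightarrow> 'g) \<Rightarrow> 'g set \<Rightarrow> 'g set \<Rightarrow> 'w" where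
  "dist_minus \<mu> = coset_dist \<mu> B_minus B_minus"

text \<open>The restriction of \<open>\<delta>\<^sup>*\<close> to \<open>\<Delta>\<^sub>+ \<times> \<Delta>\<^sub>-\<close>.\<close>

definition codist :: "('w \<Rightarrow> 'g \<Rightarrow> 'g) \<Rightarrow> 'g set \<Rightarrow> 'g set \<Rightarrow> 'w" where
  "codist \<mu> = coset_dist \<mu> B_plus B_minus"

definition panel_minus :: "('w \<Rightarrow> 'g \<Rightarrow> 'g) \<Rightarrow> 'w \<Rightarrow> 'g set \<Rightarrow> 'g set set" where
  "panel_minus \<mu> s c = {d \<in> chambers_minus. dist_minus \<mu> c d \<in> {\<one>\<^bsub>W\<^esub>, s}}"

definition proj :: "('w \<Rightarrow> 'g \<Rightarrow> 'g) \<Rightarrow> 'g set set \<Rightarrow> 'g set \<Rightarrow> 'g set" where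
  "proj \<mu> P c = (THE d. d \<in> P \<and> \<not> (\<exists>e \<in> P. bruhat_less (codist \<mu> c d) (codist \<mu> c e)))"

subsection \<open>The map \<open>\<rho>\<^sub>w\<close>\<close>

definition pi_minus :: "'g \<Rightarrow> 'g" where
  "pi_minus x = (THE y. y \<in> B_minus \<and> U_plus #>\<^bsub>G\<^esub> x = U_plus #>\<^bsub>G\<^esub> y)"

text \<open>
  \<open>\<rho>\<^sub>w\<close> depends on the representative \<open>n\<close> chosen for \<open>w\<close>, which is therefore the argument here.
  It is meaningful on \<open>B\<^sub>+ n B\<^sub>-\<close> only.
\<close>

definition rho :: "'g \<Rightarrow> 'g \<Rightarrow> 'g" where
  "rho n x = pi_minus (inv\<^bsub>G\<^esub> n \<otimes>\<^bsub>G\<^esub> x)"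

end

end

theory Submission
  imports Defs
begin

text \<open>
  Write \<open>g\<^sup>-\<^sup>1h = n\<^sub>w u \<rho>\<close> with \<open>\<rho> = \<rho>\<^sub>w(g\<^sup>-\<^sup>1h) \<in> B\<^sub>-\<close> and \<open>u \<in> U\<^sub>+\<close>; since \<open>U\<^sub>+\<close> is the product of
  \<open>U\<^sub>+ \<inter> w\<^sup>-\<^sup>1U\<^sub>+w\<close> and \<open>U\<^sub>+ \<inter> w\<^sup>-\<^sup>1U\<^sub>-w\<close>, one may take \<open>n\<^sub>w u n\<^sub>w\<^sup>-\<^sup>1 \<in> U\<^sub>+\<close>. The panel of \<open>hB\<^sub>-\<close> consists of
  \<open>h\<rho>\<^sup>-\<^sup>1sB\<^sub>-\<close>, at codistance \<open>ws\<close>, and of the \<open>h\<rho>\<^sup>-\<^sup>1yB\<^sub>-\<close> with \<open>y\<close> in the root group of \<open>\<alpha>\<^sub>s\<close>, at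
  codistance \<open>w\<close> because \<open>w\<alpha>\<^sub>s\<close> is positive.

  This needs the Bruhat and Birkhoff decompositions and \<open>U\<^sub>+ \<inter> B\<^sub>- = 1\<close>. With \<open>K\<^sub>s = U\<^sub>+ \<inter> sU\<^sub>+s\<close> one has
  \<open>U\<^sub>+ = U\<^bsub>\<alpha>\<^sub>s\<^esub>K\<^sub>s\<close>, so that \<open>B\<^sub>+ \<union> B\<^sub>+sB\<^sub>+\<close> is a group; (RGD3) then gives the Bruhat decomposition for
  \<open>B\<^sub>+\<close>. The uniqueness in the Birkhoff decomposition is obtained from a covering: the cosets
  \<open>x(U\<^sub>- \<inter> wU\<^sub>+w\<^sup>-\<^sup>1)\<close>, with the inner group replaced by the group generated by its root groups,
  form a connected chamber system mapping to \<open>G/B\<^sub>+\<close>. The map is bijective on panels and injective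
  on spherical rank 2 residues, so minimal galleries lift independently of the chosen reduced word,
  and the map is an isomorphism. In particular \<open>U\<^sub>- \<inter> B\<^sub>+ = 1\<close>, which is (RGD3) for the opposite
  system, and everything applies with the signs exchanged.
\<close>

section \<open>Groups\<close>

text \<open>(RGD3) concerns simple roots only, so \<open>U_plus \<inter> B_minus = {1}\<close>, on
  which uniqueness in the Birkhoff decomposition rests, is not visible from the axioms: generating
  sets of \<open>U_plus\<close> and \<open>U_minus\<close> may involve infinitely many roots. The
  covering localizes the problem. It is glued from groups \<open>Usep w 1\<close> belonging to the
  finitely many walls between 1 and \<open>w\<close>, and for these the Bruhat decomposition of
  \<open>B\<close> alone decides when two cosets lie over the same chamber. The generated groups are
  used because their equality with the intersections is itself a consequence of injectivity of the
  covering.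

  Independence of the reduced word goes by induction on length. If two minimal galleries to a
  chamber of type \<open>u\<close> end in different letters s and t, then \<open>u\<close> is
  \<open>w1\<close> times the longest element of a finite dihedral group, and both galleries can be
  replaced by galleries through one chamber of type \<open>w1\<close>. Inside the rank 2 residue a
  single farthest element controls all displacements, so its local structure never has to be
  described further.

  The abstract setting keeps (RGD3) separate from its sign-symmetric axioms, so that it can be
  instantiated a second time once the opposite of (RGD3) is known.\<close>

context group begin

lemma inv_mult_cancel: "x \<in> carrier G \<Longrightarrow> y \<in> carrier G \<Longrightarrow> inv x \<otimes> (x \<otimes> y) = y"
  by (simp add: m_assoc [symmetric])

lemma mult_inv_cancel: "x \<in> carrier G \<Longrightarrow> y \<in> carrier G \<Longrightarrow> x \<otimes> (inv x \<otimes> y) = y"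
  by (simp add: m_assoc [symmetric])

lemmas group_normalize = m_assoc inv_mult_group inv_mult_cancel mult_inv_cancel

lemma conj_generate:
  assumes "x \<in> carrier G" "H \<subseteq> carrier G" "subgroup K G"
    and "\<And>h. h \<in> H \<Longrightarrow> x \<otimes> h \<otimes> inv x \<in> K" and "g \<in> generate G H"
  shows "x \<otimes> g \<otimes> inv x \<in> K"
  using assms(5)
proof (induction rule: generate.induct)
  case one
  then show ?case using assms(1,3) by (simp add: subgroup.one_closed)
next
  case (incl h)
  then show ?case using assms by auto
next
  case (inv h)
  then have "inv (x \<otimes> h \<otimes> inv x) \<in> K" using assms subgroup.m_inv_closed by metis
  moreover have "inv (x \<otimes> h \<otimes> inv x) = x \<otimes> inv h \<otimes> inv x"
    using inv assms(1,2) by (simp add: group_normalize subset_iff)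
  ultimately show ?case by simp
next
  case (eng h1 h2)
  then have "(x \<otimes> h1 \<otimes> inv x) \<otimes> (x \<otimes> h2 \<otimes> inv x) \<in> K" using assms subgroup.m_closed by metis
  moreover have "h1 \<in> carrier G" "h2 \<in> carrier G"
    using eng generate_in_carrier [OF assms(2)] by auto
  then have "(x \<otimes> h1 \<otimes> inv x) \<otimes> (x \<otimes> h2 \<otimes> inv x) = x \<otimes> (h1 \<otimes> h2) \<otimes> inv x"
    using assms(1) by (simp add: group_normalize)
  ultimately show ?case by simp
qed

text \<open>Applied with \<open>x\<close> the identity: a set containing 1 and stable under left
  multiplication by the generators contains the generated group. Product decompositions, existence
  in the Bruhat decomposition and connectedness of the covering are proved this way.\<close>

lemma generate_left_closed:
  assumes "H \<subseteq> carrier G" "\<And>h. h \<in> H \<Longrightarrow> inv h \<in> H" "Y \<subseteq> carrier G"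
    and "\<And>h x. h \<in> H \<Longrightarrow> x \<in> Y \<Longrightarrow> h \<otimes> x \<in> Y" and "g \<in> generate G H" "x \<in> Y"
  shows "g \<otimes> x \<in> Y"
  using assms(5,6)
proof (induction arbitrary: x rule: generate.induct)
  case one
  then show ?case using assms by auto
next
  case (eng h1 h2)
  then have "h1 \<otimes> (h2 \<otimes> x) \<in> Y" by auto
  moreover have "h1 \<in> carrier G" "h2 \<in> carrier G" "x \<in> carrier G"
    using eng assms generate_in_carrier [OF assms(1)] by auto
  ultimately show ?case by (simp add: m_assoc)
qed (use assms in auto)

lemma conj_set_eq: "H \<subseteq> carrier G \<Longrightarrow> g \<in> carrier G \<Longrightarrow> conj_set G g H = (\<lambda>h. g \<otimes> h \<otimes> inv g) ` H"
  by (auto simp: conj_set_def l_coset_def r_coset_def)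

lemma conj_set_mult:
  assumes "H \<subseteq> carrier G" "g \<in> carrier G" "h \<in> carrier G"
  shows "conj_set G (g \<otimes> h) H = conj_set G g (conj_set G h H)"
proof -
  have "conj_set G h H \<subseteq> carrier G" using assms by (auto simp: conj_set_eq)
  then have "conj_set G g (conj_set G h H) = (\<lambda>x. g \<otimes> (h \<otimes> x \<otimes> inv h) \<otimes> inv g) ` H"
    using assms by (simp add: conj_set_eq image_image)
  also have "\<dots> = conj_set G (g \<otimes> h) H"
    using assms by (auto simp: conj_set_eq group_normalize subset_iff intro!: image_cong)
  finally show ?thesis ..
qed

lemma conj_set_self:
  assumes "subgroup H G" "g \<in> H"
  shows "conj_set G g H = H"
proof -
  have H: "H \<subseteq> carrier G" "g \<in> carrier G" using assms subgroup.subset subgroup.mem_carrier by auto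
  show ?thesis
  proof (intro equalityI subsetI)
    fix x assume "x \<in> conj_set G g H"
    then obtain h where "h \<in> H" "x = g \<otimes> h \<otimes> inv g" using H by (auto simp: conj_set_eq)
    then show "x \<in> H" using assms by (metis subgroup.m_closed subgroup.m_inv_closed)
  next
    fix x assume x: "x \<in> H"
    then have "inv g \<otimes> x \<otimes> g \<in> H" using assms subgroup.m_closed subgroup.m_inv_closed by metis
    moreover have "x = g \<otimes> (inv g \<otimes> x \<otimes> g) \<otimes> inv g" using x H by (auto simp: group_normalize subset_iff)
    ultimately show "x \<in> conj_set G g H" using H by (simp add: conj_set_eq)
  qed
qed

lemma conj_set_inv_eq:
  assumes "H \<subseteq> carrier G" "g \<in> carrier G" "conj_set G g H = K"
  shows "conj_set G (inv g) K = H"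
proof -
  have "conj_set G (inv g) K = conj_set G (inv g \<otimes> g) H"
    using conj_set_mult [of H "inv g" g] assms by (simp del: l_inv)
  also have "\<dots> = H" using assms by (auto simp: conj_set_eq subset_iff intro!: image_eqI)
  finally show ?thesis .
qed

end

section \<open>Reflections, lengths and roots of Coxeter systems\<close>

lemma sum_lessThan_add:
  fixes f :: "nat \<Rightarrow> 'a :: comm_monoid_add"
  shows "(\<Sum>i<m + n. f i) = (\<Sum>i<m. f i) + (\<Sum>i<n. f (m + i))"
  by (induction n) (simp_all add: add.assoc)

context coxeter_system begin

section \<open>Words in the generators and the reflection cocycle\<close>

declare in_lists_conv_set [simp] inv_mult_cancel [simp] mult_inv_cancel [simp]

lemma S_carrier: "s \<in> S \<Longrightarrow> s \<in> carrier W"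
  using S_subset by auto

lemma S_sq: "s \<in> S \<Longrightarrow> s \<otimes> s = \<one>"
  using S_involution by auto

lemma S_inv: "s \<in> S \<Longrightarrow> inv s = s"
  using S_sq S_carrier inv_equality by auto

lemma mult_S_mult_S [simp]: "s \<in> S \<Longrightarrow> x \<in> carrier W \<Longrightarrow> x \<otimes> s \<otimes> s = x"
  by (simp add: S_carrier S_sq m_assoc)

lemma S_mult_S_mult: "s \<in> S \<Longrightarrow> x \<in> carrier W \<Longrightarrow> s \<otimes> (s \<otimes> x) = x"
  by (simp add: S_carrier S_sq m_assoc [symmetric])

lemma word_prod_simps [simp]:
  "word_prod W [] = \<one>" "word_prod W (s # us) = s \<otimes> word_prod W us"
  by (simp_all add: word_prod_def)

lemma word_prod_closed [simp]: "us \<in> lists S \<Longrightarrow> word_prod W us \<in> carrier W"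
  by (induction us) (auto simp: S_carrier)

lemma word_prod_append [simp]:
  "us \<in> lists S \<Longrightarrow> vs \<in> lists S \<Longrightarrow> word_prod W (us @ vs) = word_prod W us \<otimes> word_prod W vs"
  by (induction us) (auto simp: S_carrier m_assoc)

lemma ex_word:
  assumes "w \<in> carrier W"
  obtains us where "us \<in> lists S" "word_prod W us = w"
proof -
  have "w \<in> generate W S \<Longrightarrow> \<exists>us\<in>lists S. word_prod W us = w" for w
  proof (induction rule: generate.induct)
    case one
    then show ?case by (intro bexI [of _ "[]"]) auto
  next
    case (incl h)
    then show ?case by (intro bexI [of _ "[h]"]) (auto simp: S_carrier)
  next
    case (inv h)
    then show ?case by (intro bexI [of _ "[h]"]) (auto simp: S_carrier S_inv)
  next
    case (eng h1 h2)
    then obtain us vs where "us \<in> lists S" "word_prod W us = h1" "vs \<in> lists S" "word_prod W vs = h2"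
      by auto
    then show ?case by (intro bexI [of _ "us @ vs"]) auto
  qed
  with assms S_generates that show thesis by auto
qed

text \<open>
  \<open>par us r\<close> is the parity of the number of \<open>i\<close> with
  \<open>r = s\<^sub>1 \<cdots> s\<^sub>i\<^sub>-\<^sub>1 s\<^sub>i s\<^sub>i\<^sub>-\<^sub>1 \<cdots> s\<^sub>1\<close>, that is, of the walls of type \<open>r\<close> crossed by the gallery \<open>us\<close>.
\<close>

fun par :: "'a list \<Rightarrow> 'a \<Rightarrow> bool" where
  "par [] r \<longleftrightarrow> False"
| "par (s # us) r \<longleftrightarrow> (r = s) \<noteq> par us (s \<otimes> r \<otimes> s)"

lemma par_append:
  assumes "us \<in> lists S" "r \<in> carrier W"
  shows "par (us @ vs) r \<longleftrightarrow> par us r \<noteq> par vs (inv (word_prod W us) \<otimes> r \<otimes> word_prod W us)"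
  using assms
proof (induction us arbitrary: r)
  case (Cons s us)
  then show ?case
    by (auto simp: S_carrier S_inv inv_mult_group m_assoc)
qed auto

text \<open>The gallery s, t, s, t, ... crosses in turn the walls of the reflections (st)^i s.
  Peeling off two letters conjugates by st, which raises the exponent by two.\<close>

lemma par_replicate:
  assumes "s \<in> S" "t \<in> S" "r \<in> carrier W"
  shows "par (concat (replicate k [s, t])) r \<longleftrightarrow>
    odd (\<Sum>i<2 * k. of_bool (r = (s \<otimes> t) [^] i \<otimes> s) :: nat)"
  using assms(3)
proof (induction k arbitrary: r)
  case (Suc k)
  define x where "x = s \<otimes> t"
  have [simp]: "s \<in> carrier W" "t \<in> carrier W" "x \<in> carrier W"
    using assms by (auto simp: S_carrier x_def)
  have inv_x: "inv x = t \<otimes> s"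
    using assms by (simp add: x_def inv_mult_group S_inv)
  have shift: "t \<otimes> (s \<otimes> r \<otimes> s) \<otimes> t = x [^] i \<otimes> s \<longleftrightarrow> r = x [^] Suc (Suc i) \<otimes> s" for i
  proof -
    have "x \<otimes> (t \<otimes> (s \<otimes> r \<otimes> s) \<otimes> t) \<otimes> inv x = r"
      using Suc.prems assms by (simp add: inv_x) (simp add: x_def m_assoc S_mult_S_mult S_sq)
    moreover have "x \<otimes> (x [^] i \<otimes> s) \<otimes> inv x = x [^] Suc (Suc i) \<otimes> s"
    proof -
      have "x \<otimes> x [^] i = x [^] Suc i" by (metis nat_pow_Suc2 \<open>x \<in> carrier W\<close>)
      moreover have "s \<otimes> inv x = x \<otimes> s" by (simp add: inv_x) (simp add: x_def m_assoc)
      ultimately show ?thesis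
        using assms by (simp add: m_assoc [symmetric]) (simp add: m_assoc)
    qed
    moreover have "x \<otimes> a \<otimes> inv x = x \<otimes> b \<otimes> inv x \<longleftrightarrow> a = b" if "a \<in> carrier W" "b \<in> carrier W" for a b
      using that by simp
    ultimately show ?thesis
      using Suc.prems by (metis (no_types) \<open>s \<in> carrier W\<close> \<open>t \<in> carrier W\<close> \<open>x \<in> carrier W\<close> m_closed nat_pow_closed)
  qed
  have first: "s \<otimes> r \<otimes> s = t \<longleftrightarrow> r = x [^] (1::nat) \<otimes> s"
  proof -
    have "s \<otimes> (s \<otimes> r \<otimes> s) \<otimes> s = r"
      using Suc.prems assms by (simp add: m_assoc S_mult_S_mult S_sq)
    moreover have "s \<otimes> t \<otimes> s = x [^] (1::nat) \<otimes> s"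
      by (simp add: x_def)
    moreover have "s \<otimes> (x [^] (1::nat) \<otimes> s) \<otimes> s = t"
      using assms by (simp add: x_def m_assoc S_mult_S_mult S_sq)
    ultimately show ?thesis by metis
  qed
  have "(\<Sum>i<2 * Suc k. of_bool (r = x [^] i \<otimes> s) :: nat) =
      of_bool (r = s) + (of_bool (r = x [^] (1::nat) \<otimes> s)
        + (\<Sum>i<2 * k. of_bool (r = x [^] Suc (Suc i) \<otimes> s)))"
    by (simp add: sum.lessThan_Suc_shift del: nat_pow_Suc sum.lessThan_Suc)
  also have "\<dots> = of_bool (r = s) + (of_bool (s \<otimes> r \<otimes> s = t)
        + (\<Sum>i<2 * k. of_bool (t \<otimes> (s \<otimes> r \<otimes> s) \<otimes> t = x [^] i \<otimes> s)))"
    by (simp only: shift first)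
  finally show ?case
    using Suc.IH [of "t \<otimes> (s \<otimes> r \<otimes> s) \<otimes> t"] Suc.prems by (auto simp: x_def [symmetric])
qed auto

text \<open>Once (st)^m = 1, the exponents \<open>i\<close> and \<open>m + i\<close> give the same
  reflection, so a gallery of length \<open>2 * m\<close> meets every wall an even number of
  times.\<close>

lemma par_relation:
  assumes "s \<in> S" "t \<in> S" "r \<in> carrier W" "(s \<otimes> t) [^] (m::nat) = \<one>"
  shows "\<not> par (concat (replicate m [s, t])) r"
proof -
  have [simp]: "s \<in> carrier W" "t \<in> carrier W" using assms by (auto simp: S_carrier)
  have "(\<Sum>i<2 * m. of_bool (r = (s \<otimes> t) [^] i \<otimes> s) :: nat) =
    (\<Sum>i<m. of_bool (r = (s \<otimes> t) [^] i \<otimes> s)) + (\<Sum>i<m. of_bool (r = (s \<otimes> t) [^] (m + i) \<otimes> s))"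
    unfolding mult_2 by (rule sum_lessThan_add)
  also have "\<dots> = 2 * (\<Sum>i<m. of_bool (r = (s \<otimes> t) [^] i \<otimes> s))"
    using assms by (simp add: nat_pow_mult [symmetric])
  finally show ?thesis
    using par_replicate [of s t r m] assms by auto
qed

lemma word_prod_relation:
  assumes "s \<in> S" "t \<in> S"
  shows "word_prod W (concat (replicate m [s, t])) = (s \<otimes> t) [^] m"
proof (induction m)
  case (Suc m)
  have [simp]: "s \<in> carrier W" "t \<in> carrier W" using assms by (auto simp: S_carrier)
  have "(s \<otimes> t) \<otimes> (s \<otimes> t) [^] m = (s \<otimes> t) [^] Suc m"
    by (metis nat_pow_Suc2 m_closed \<open>s \<in> carrier W\<close> \<open>t \<in> carrier W\<close>)
  with Suc show ?case by (simp add: m_assoc)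
qed auto

lemma cong_par:
  assumes "coxeter_cong W S us vs"
  shows "word_prod W us = word_prod W vs \<and> (\<forall>r \<in> carrier W. par us r = par vs r)"
  using assms
proof (induction rule: coxeter_cong.induct)
  case (relation us vs s t)
  let ?rel = "concat (replicate (group.ord W (s \<otimes> t)) [s, t])"
  have [simp]: "s \<in> carrier W" "t \<in> carrier W" using relation by (auto simp: S_carrier)
  have one: "(s \<otimes> t) [^] ord (s \<otimes> t) = \<one>"
    by (simp add: pow_ord_eq_1)
  have rel: "?rel \<in> lists S"
    using relation by auto
  have wp: "word_prod W ?rel = \<one>" 
    using word_prod_relation one relation by auto
  have np: "\<not> par ?rel r" if "r \<in> carrier W" for r
    using par_relation that one relation by auto
  have "par (us @ ?rel @ vs) r = par (us @ vs) r" if "r \<in> carrier W" for r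
    using that relation rel wp np
    by (simp add: par_append del: append_assoc)
  then show ?case using relation rel wp by auto
qed auto

text \<open>\<open>presentation\<close> makes any two words for \<open>w\<close> congruent and
  \<open>cong_par\<close> makes \<open>par\<close> a congruence invariant, so the choice of the word
  is immaterial. For a reflection \<open>r\<close> this says that the wall of \<open>r\<close>
  separates 1 from \<open>w\<close>.\<close>

definition eta :: "'a \<Rightarrow> 'a \<Rightarrow> bool" where
  "eta w r \<longleftrightarrow> (\<exists>us \<in> lists S. word_prod W us = w \<and> par us r)"

lemma eta_word_prod: "us \<in> lists S \<Longrightarrow> r \<in> carrier W \<Longrightarrow> eta (word_prod W us) r = par us r"
  unfolding eta_def using presentation cong_par by metis

lemma eta_one [simp]: "r \<in> carrier W \<Longrightarrow> \<not> eta \<one> r"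
  using eta_word_prod [of "[]" r] by auto

lemma eta_S: "s \<in> S \<Longrightarrow> r \<in> carrier W \<Longrightarrow> eta s r \<longleftrightarrow> r = s"
  using eta_word_prod [of "[s]" r] by (auto simp: S_carrier)

text \<open>A gallery for \<open>x \<otimes> y\<close> is one for \<open>x\<close> followed by the
  \<open>x\<close>-translate of one for \<open>y\<close>; the walls of the second part are counted
  after moving them back by \<open>x\<close>.\<close>

lemma eta_mult:
  assumes "x \<in> carrier W" "y \<in> carrier W" "r \<in> carrier W"
  shows "eta (x \<otimes> y) r \<longleftrightarrow> eta x r \<noteq> eta y (inv x \<otimes> r \<otimes> x)"
proof -
  obtain us vs where us: "us \<in> lists S" "word_prod W us = x" and vs: "vs \<in> lists S" "word_prod W vs = y"
    using assms by (metis ex_word)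
  have "x \<otimes> y = word_prod W (us @ vs)" using us vs by simp
  then have "eta (x \<otimes> y) r = par (us @ vs) r"
    using us(1) vs(1) assms by (simp only: eta_word_prod append_in_lists_conv)
  also have "\<dots> \<longleftrightarrow> par us r \<noteq> par vs (inv x \<otimes> r \<otimes> x)"
    using par_append us assms by blast
  also have "par us r = eta x r"
    using eta_word_prod [OF us(1), of r] us(2) assms by simp
  also have "par vs (inv x \<otimes> r \<otimes> x) = eta y (inv x \<otimes> r \<otimes> x)"
    using eta_word_prod [OF vs(1), of "inv x \<otimes> r \<otimes> x"] vs(2) assms by simp
  finally show ?thesis .
qed

text \<open>Deletion condition: striking out a letter at which the gallery crosses the wall of
  \<open>r\<close> reflects the remaining part and so multiplies the product by \<open>r\<close>.
  The alphabet \<open>A\<close> is a parameter so that the shortened word stays inside a dihedral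
  subgroup when that matters.\<close>

lemma par_deletion:
  assumes "us \<in> lists A" "A \<subseteq> S" "r \<in> carrier W" "par us r"
  shows "\<exists>vs \<in> lists A. Suc (length vs) = length us \<and> word_prod W vs = r \<otimes> word_prod W us"
  using assms(1,3,4)
proof (induction us arbitrary: r)
  case (Cons s us)
  then have s: "s \<in> S" "us \<in> lists S" using assms(2) by auto
  then have [simp]: "s \<in> carrier W" "word_prod W us \<in> carrier W" by (auto simp: S_carrier)
  show ?case
  proof (cases "r = s")
    case True
    then show ?thesis using Cons s by (intro bexI [of _ us]) (auto simp: S_mult_S_mult)
  next
    case False
    then have "par us (s \<otimes> r \<otimes> s)" using Cons by auto
    then obtain vs where "vs \<in> lists A" "Suc (length vs) = length us"
        "word_prod W vs = (s \<otimes> r \<otimes> s) \<otimes> word_prod W us"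
      using Cons.IH [of "s \<otimes> r \<otimes> s"] Cons.prems s by auto
    then show ?thesis
      using Cons s by (intro bexI [of _ "s # vs"]) (auto simp: m_assoc S_mult_S_mult)
  qed
qed auto

section \<open>Length and the exchange condition\<close>

lemma len_le: "us \<in> lists S \<Longrightarrow> len (word_prod W us) \<le> length us"
  unfolding len_def by (rule Least_le) auto

lemma len_word:
  assumes "w \<in> carrier W"
  obtains us where "us \<in> lists S" "word_prod W us = w" "length us = len w"
proof -
  have "\<exists>k. \<exists>us \<in> lists S. length us = k \<and> word_prod W us = w"
    using ex_word [OF assms] by metis
  from LeastI_ex [OF this] that show thesis unfolding len_def by auto
qed

lemma len_one [simp]: "len \<one> = 0"
  using len_le [of "[]"] by auto

lemma len_eq_0: "w \<in> carrier W \<Longrightarrow> len w = 0 \<Longrightarrow> w = \<one>"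
  by (erule len_word) auto

lemma len_mult_word: "w \<in> carrier W \<Longrightarrow> us \<in> lists S \<Longrightarrow> len (w \<otimes> word_prod W us) \<le> len w + length us"
  using len_word [of w] len_le word_prod_append by (metis append_in_lists_conv length_append)

lemma len_mult_S: "w \<in> carrier W \<Longrightarrow> s \<in> S \<Longrightarrow> len (w \<otimes> s) \<le> Suc (len w)"
  using len_mult_word [of w "[s]"] by (simp add: S_carrier)

lemma len_mult_S': "w \<in> carrier W \<Longrightarrow> s \<in> S \<Longrightarrow> len w \<le> Suc (len (w \<otimes> s))"
  using len_mult_S [of "w \<otimes> s" s] by (simp add: S_carrier)

lemma reflections_carrier: "r \<in> reflections \<Longrightarrow> r \<in> carrier W"
  by (auto simp: reflections_def S_carrier)

lemma reflection_sq: "r \<in> reflections \<Longrightarrow> r \<otimes> r = \<one>"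
  by (auto simp: reflections_def S_carrier m_assoc S_mult_S_mult S_sq)

lemma reflection_inv: "r \<in> reflections \<Longrightarrow> inv r = r"
  by (simp add: inv_equality reflection_sq reflections_carrier)

lemma eta_inv:
  assumes "x \<in> carrier W" "r \<in> carrier W"
  shows "eta (inv x) (inv x \<otimes> r \<otimes> x) = eta x r"
  using eta_mult [of x "inv x" r] assms by auto

text \<open>Write \<open>r\<close> as a conjugate of \<open>s\<close> by \<open>x\<close>. A gallery
  along \<open>x\<close>, through \<open>s\<close> and back along the inverse of \<open>x\<close>
  meets the wall of \<open>r\<close> equally often on both legs, and once more in the
  middle.\<close>

lemma eta_reflection:
  assumes "r \<in> reflections"
  shows "eta r r"
proof -
  obtain x s where xs: "x \<in> carrier W" "s \<in> S" "r = x \<otimes> s \<otimes> inv x"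
    using assms by (auto simp: reflections_def)
  then have [simp]: "s \<in> carrier W" "r \<in> carrier W" by (auto simp: S_carrier)
  have 1: "inv x \<otimes> r \<otimes> x = s" using xs by (simp add: m_assoc)
  have 2: "eta (inv x) s = eta x r"
    using eta_inv [of x r] xs 1 by auto
  have "eta (s \<otimes> inv x) s = (eta s s \<noteq> eta (inv x) s)"
    using xs by (subst eta_mult) (auto simp: S_sq S_inv m_assoc)
  moreover have "eta r r = (eta x r \<noteq> eta (s \<otimes> inv x) s)"
    using xs 1 eta_mult [of x "s \<otimes> inv x" r] by (simp add: m_assoc)
  ultimately show ?thesis using 2 xs by (simp add: eta_S)
qed

lemma eta_len_less:
  assumes "w \<in> carrier W" "r \<in> carrier W" "eta w r"
  shows "len (r \<otimes> w) < len w"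
proof -
  obtain us where us: "us \<in> lists S" "word_prod W us = w" "length us = len w"
    using len_word assms by blast
  then obtain vs where "vs \<in> lists S" "Suc (length vs) = length us" "word_prod W vs = r \<otimes> w"
    using par_deletion [of us S r] eta_word_prod [of us r] assms by auto
  then show ?thesis using len_le [of vs] us by auto
qed

text \<open>Multiplication by \<open>r\<close> changes the side of its own wall, so
  \<open>eta_len_less\<close> applies to \<open>r \<otimes> w\<close>.\<close>

lemma not_eta_len_less:
  assumes "w \<in> carrier W" "r \<in> reflections" "\<not> eta w r"
  shows "len w < len (r \<otimes> w)"
proof -
  have [simp]: "r \<in> carrier W" using assms reflections_carrier by auto
  have "eta (r \<otimes> w) r"
    using eta_mult [of r w r] assms eta_reflection [of r] by (simp add: reflection_inv reflection_sq)
  then have "len (r \<otimes> (r \<otimes> w)) < len (r \<otimes> w)"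
    using assms by (intro eta_len_less) auto
  then show ?thesis
    using assms by (simp add: m_assoc [symmetric] reflection_sq)
qed

lemma S_reflection: "s \<in> S \<Longrightarrow> s \<in> reflections"
  unfolding reflections_def by (intro CollectI exI [of _ "\<one>"] exI [of _ s]) (auto simp: S_carrier)

lemma conj_reflection:
  assumes "w \<in> carrier W" "r \<in> reflections"
  shows "w \<otimes> r \<otimes> inv w \<in> reflections"
proof -
  obtain x s where "x \<in> carrier W" "s \<in> S" "r = x \<otimes> s \<otimes> inv x"
    using assms by (auto simp: reflections_def)
  then show ?thesis
    using assms unfolding reflections_def
    by (intro CollectI exI [of _ "w \<otimes> x"] exI [of _ s]) (auto simp: m_assoc inv_mult_group S_carrier)
qed

section \<open>Roots as sides of walls\<close>

lemma len_less_iff': "w \<in> carrier W \<Longrightarrow> s \<in> S \<Longrightarrow> len w < len (s \<otimes> w) \<longleftrightarrow> \<not> eta w s"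
  using eta_len_less not_eta_len_less S_reflection S_carrier by (meson less_asym)

lemma len_right_less_iff:
  assumes "w \<in> carrier W" "s \<in> S"
  shows "len (w \<otimes> s) < len w \<longleftrightarrow> eta w (w \<otimes> s \<otimes> inv w)"
    and "len w < len (w \<otimes> s) \<longleftrightarrow> \<not> eta w (w \<otimes> s \<otimes> inv w)"
proof -
  have "w \<otimes> s \<otimes> inv w \<in> reflections"
    using assms S_reflection conj_reflection by auto
  moreover have "w \<otimes> s = (w \<otimes> s \<otimes> inv w) \<otimes> w"
    using assms by (simp add: m_assoc S_carrier)
  ultimately show "len (w \<otimes> s) < len w \<longleftrightarrow> eta w (w \<otimes> s \<otimes> inv w)"
    and "len w < len (w \<otimes> s) \<longleftrightarrow> \<not> eta w (w \<otimes> s \<otimes> inv w)"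
    using assms eta_len_less not_eta_len_less reflections_carrier by (metis less_asym)+
qed

text \<open>With \<open>e = False\<close> this is the side of the wall of \<open>r\<close> that
  contains 1. Roots are handled in this form because translation then only conjugates
  \<open>r\<close> and possibly flips \<open>e\<close>.\<close>

definition half :: "'a \<Rightarrow> bool \<Rightarrow> 'a set" where
  "half r e = {y \<in> carrier W. eta y r = e}"

lemma neg_half: "neg (half r e) = half r (\<not> e)"
  by (auto simp: neg_def half_def)

lemma simple_root_half: "s \<in> S \<Longrightarrow> simple_root s = half s False"
  by (auto simp: simple_root_def half_def len_less_iff')

lemma l_coset_half:
  assumes "x \<in> carrier W" "r \<in> carrier W"
  shows "x <#\<^bsub>W\<^esub> half r e = half (x \<otimes> r \<otimes> inv x) (e \<noteq> eta x (x \<otimes> r \<otimes> inv x))"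
proof -
  let ?r = "x \<otimes> r \<otimes> inv x"
  have eq: "eta (x \<otimes> y) ?r \<longleftrightarrow> eta x ?r \<noteq> eta y r" if "y \<in> carrier W" for y
    using that assms by (simp add: eta_mult m_assoc)
  show ?thesis
  proof (intro equalityI subsetI)
    fix z assume "z \<in> x <#\<^bsub>W\<^esub> half r e"
    then obtain y where "y \<in> carrier W" "eta y r = e" "z = x \<otimes> y" by (auto simp: l_coset_def half_def)
    then show "z \<in> half ?r (e \<noteq> eta x ?r)"
      using eq assms by (auto simp: half_def)
  next
    fix z assume z: "z \<in> half ?r (e \<noteq> eta x ?r)"
    then have "z = x \<otimes> (inv x \<otimes> z)" "inv x \<otimes> z \<in> half r e"
      using eq [of "inv x \<otimes> z"] assms by (auto simp: half_def)
    then show "z \<in> x <#\<^bsub>W\<^esub> half r e" by (auto simp: l_coset_def)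
  qed
qed

text \<open>The two sides of the wall of a reflection conjugate to \<open>s\<close> by
  \<open>x\<close> are the translates of the simple root by \<open>x\<close> and by
  \<open>x \<otimes> s\<close>; the cocycle decides which side is which.\<close>

lemma roots_eq: "roots = {half r e | r e. r \<in> reflections}"
proof (intro equalityI subsetI)
  fix \<alpha> assume "\<alpha> \<in> roots"
  then obtain w s where "w \<in> carrier W" "s \<in> S" "\<alpha> = w <#\<^bsub>W\<^esub> simple_root s" by (auto simp: roots_def)
  then show "\<alpha> \<in> {half r e | r e. r \<in> reflections}"
    using conj_reflection S_reflection by (auto simp: simple_root_half l_coset_half S_carrier)
next
  fix \<alpha> assume "\<alpha> \<in> {half r e | r e. r \<in> reflections}"
  then obtain x s e where xs: "x \<in> carrier W" "s \<in> S" and \<alpha>: "\<alpha> = half (x \<otimes> s \<otimes> inv x) e"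
    by (auto simp: reflections_def)
  have [simp]: "s \<in> carrier W" using xs S_carrier by auto
  show "\<alpha> \<in> roots"
  proof (cases "e = eta x (x \<otimes> s \<otimes> inv x)")
    case True
    then have "\<alpha> = x <#\<^bsub>W\<^esub> simple_root s"
      using xs \<alpha> by (simp add: simple_root_half l_coset_half)
    then show ?thesis using xs by (auto simp: roots_def)
  next
    case False
    have 1: "x \<otimes> s \<otimes> s \<otimes> inv (x \<otimes> s) = x \<otimes> s \<otimes> inv x"
      using xs by (simp add: inv_mult_group S_inv m_assoc)
    have "eta (x \<otimes> s) (x \<otimes> s \<otimes> inv x) \<noteq> eta x (x \<otimes> s \<otimes> inv x)"
      using xs by (simp add: eta_mult eta_S m_assoc)
    with False have "\<alpha> = (x \<otimes> s) <#\<^bsub>W\<^esub> simple_root s"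
      using xs \<alpha> 1 by (auto simp: simple_root_half l_coset_half)
    moreover have "x \<otimes> s \<in> carrier W" using xs by simp
    ultimately show ?thesis using xs unfolding roots_def by blast
  qed
qed

lemma root_cases:
  assumes "\<alpha> \<in> roots"
  obtains r e where "r \<in> reflections" "r \<in> carrier W" "\<alpha> = half r e"
  using assms reflections_carrier by (auto simp: roots_eq)

lemma simple_root_in_roots: "s \<in> S \<Longrightarrow> simple_root s \<in> roots"
  using S_reflection by (auto simp: roots_eq simple_root_half)

lemma neg_in_roots: "\<alpha> \<in> roots \<Longrightarrow> neg \<alpha> \<in> roots"
  unfolding roots_eq using neg_half by blast

lemma root_subset: "\<alpha> \<in> roots \<Longrightarrow> \<alpha> \<subseteq> carrier W"
  by (auto simp: roots_eq half_def)

lemma neg_neg: "\<alpha> \<in> roots \<Longrightarrow> neg (neg \<alpha>) = \<alpha>"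
  using root_subset by (auto simp: neg_def)

lemma l_coset_in_roots: "w \<in> carrier W \<Longrightarrow> \<alpha> \<in> roots \<Longrightarrow> w <#\<^bsub>W\<^esub> \<alpha> \<in> roots"
  using conj_reflection reflections_carrier l_coset_half by (fastforce simp: roots_eq)

lemma mem_l_coset:
  assumes "w \<in> carrier W" "\<alpha> \<in> roots" "x \<in> carrier W"
  shows "x \<in> w <#\<^bsub>W\<^esub> \<alpha> \<longleftrightarrow> inv w \<otimes> x \<in> \<alpha>"
proof
  assume "x \<in> w <#\<^bsub>W\<^esub> \<alpha>"
  then show "inv w \<otimes> x \<in> \<alpha>" using assms root_subset [of \<alpha>] by (auto simp: l_coset_def)
next
  assume "inv w \<otimes> x \<in> \<alpha>"
  moreover have "x = w \<otimes> (inv w \<otimes> x)" using assms by simp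
  ultimately show "x \<in> w <#\<^bsub>W\<^esub> \<alpha>" by (auto simp: l_coset_def)
qed

lemma l_coset_neg:
  assumes "w \<in> carrier W" "\<alpha> \<in> roots"
  shows "w <#\<^bsub>W\<^esub> neg \<alpha> = neg (w <#\<^bsub>W\<^esub> \<alpha>)"
proof -
  have "x \<in> w <#\<^bsub>W\<^esub> neg \<alpha> \<longleftrightarrow> x \<in> neg (w <#\<^bsub>W\<^esub> \<alpha>)" if "x \<in> carrier W" for x
    using mem_l_coset [OF assms(1) neg_in_roots [OF assms(2)] that] mem_l_coset [OF assms that] that assms(1)
    by (auto simp: neg_def)
  then show ?thesis
    using root_subset neg_in_roots l_coset_in_roots assms by blast
qed

lemma l_coset_comp:
  assumes "w \<in> carrier W" "v \<in> carrier W" "\<alpha> \<in> roots"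
  shows "w <#\<^bsub>W\<^esub> (v <#\<^bsub>W\<^esub> \<alpha>) = (w \<otimes> v) <#\<^bsub>W\<^esub> \<alpha>"
  using lcos_m_assoc [of \<alpha> w v] root_subset assms by auto

lemma l_coset_inv_cancel:
  assumes "w \<in> carrier W" "\<alpha> \<in> roots"
  shows "w <#\<^bsub>W\<^esub> (inv w <#\<^bsub>W\<^esub> \<alpha>) = \<alpha>" "inv w <#\<^bsub>W\<^esub> (w <#\<^bsub>W\<^esub> \<alpha>) = \<alpha>"
  using assms root_subset lcos_mult_one by (simp_all add: l_coset_comp)

lemma S_l_coset_simple_root:
  assumes "s \<in> S"
  shows "s <#\<^bsub>W\<^esub> simple_root s = neg (simple_root s)" "s <#\<^bsub>W\<^esub> neg (simple_root s) = simple_root s"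
  using assms by (simp_all add: simple_root_half neg_half l_coset_half S_carrier S_inv S_sq eta_S)

lemma one_in_simple_root: "s \<in> S \<Longrightarrow> \<one> \<in> simple_root s"
  by (simp add: simple_root_half half_def S_carrier)

lemma S_notin_simple_root: "s \<in> S \<Longrightarrow> s \<notin> simple_root s"
  by (simp add: simple_root_half half_def S_carrier eta_S)

lemma root_nonempty:
  assumes "\<alpha> \<in> roots"
  shows "\<exists>w \<in> carrier W. w \<in> \<alpha>"
proof -
  obtain w s where "w \<in> carrier W" "s \<in> S" "\<alpha> = w <#\<^bsub>W\<^esub> simple_root s" using assms by (auto simp: roots_def)
  then have "w \<otimes> \<one> \<in> \<alpha>" using one_in_simple_root unfolding l_coset_def by blast
  then show ?thesis using \<open>w \<in> carrier W\<close> by auto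
qed

lemma root_proper: "\<alpha> \<in> roots \<Longrightarrow> \<exists>w \<in> carrier W. w \<notin> \<alpha>"
  using root_nonempty [of "neg \<alpha>"] neg_in_roots by (auto simp: neg_def)

text \<open>Adjacent chambers are separated by one wall only. Mostly used in contraposition: a root
  that contains \<open>c\<close> and is not the translate of the simple root by \<open>c\<close>
  also contains \<open>c \<otimes> s\<close>.\<close>

lemma root_separating:
  assumes "\<gamma> \<in> roots" "s \<in> S" "c \<in> \<gamma>" "c \<otimes> s \<notin> \<gamma>"
  shows "\<gamma> = c <#\<^bsub>W\<^esub> simple_root s"
proof -
  obtain r e where r: "r \<in> carrier W" "\<gamma> = half r e" using root_cases assms by metis
  have c: "c \<in> carrier W" using assms root_subset by auto
  have [simp]: "s \<in> carrier W" using assms S_carrier by auto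
  have "eta s (inv c \<otimes> r \<otimes> c)"
    using assms r c by (auto simp: half_def eta_mult)
  then have "inv c \<otimes> r \<otimes> c = s"
    using assms r c by (simp add: eta_S)
  then have "r = c \<otimes> s \<otimes> inv c"
    using r c by (auto simp: m_assoc)
  then show ?thesis
    using assms c r by (auto simp: simple_root_half l_coset_half) (auto simp: half_def)
qed

text \<open>The dictionary between lengths and signs of roots: the wall between \<open>w\<close> and
  \<open>w \<otimes> s\<close> is crossed away from 1 exactly when the length grows.\<close>

lemma one_mem_l_coset_simple_root:
  assumes "w \<in> carrier W" "s \<in> S"
  shows "\<one> \<in> w <#\<^bsub>W\<^esub> simple_root s \<longleftrightarrow> len w < len (w \<otimes> s)"
  using assms len_right_less_iff(2) [OF assms] 
  by (auto simp: simple_root_half l_coset_half S_carrier) (auto simp: half_def S_carrier)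

section \<open>Descents, minimal galleries and dihedral subgroups\<close>

lemma len_mult_S_cases:
  assumes "w \<in> carrier W" "s \<in> S"
  shows "len (w \<otimes> s) = Suc (len w) \<or> len w = Suc (len (w \<otimes> s))"
  using len_right_less_iff [OF assms] len_mult_S [OF assms] len_mult_S' [OF assms] by linarith

lemma len_inv:
  assumes "w \<in> carrier W"
  shows "len (inv w) = len w"
proof -
  have le: "len (inv w) \<le> len w" if w: "w \<in> carrier W" for w
  proof -
    obtain us where us: "us \<in> lists S" "word_prod W us = w" "length us = len w" by (rule len_word [OF w])
    have "us \<in> lists S \<Longrightarrow> word_prod W (rev us) = inv (word_prod W us)" for us
      by (induction us) (auto simp: S_carrier S_inv inv_mult_group)
    then show ?thesis using us len_le [of "rev us"] by auto
  qed
  show ?thesis using le [of w] le [of "inv w"] assms by auto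
qed

lemma len_S_mult_cases:
  assumes "w \<in> carrier W" "s \<in> S"
  shows "len (s \<otimes> w) = Suc (len w) \<or> len w = Suc (len (s \<otimes> w))"
  using len_mult_S_cases [of "inv w" s] len_inv [of w] len_inv [of "s \<otimes> w"] assms
  by (simp add: inv_mult_group S_inv S_carrier)

lemma ex_left_descent:
  assumes "w \<in> carrier W" "w \<noteq> \<one>"
  obtains s where "s \<in> S" "len w = Suc (len (s \<otimes> w))"
proof -
  obtain us where us: "us \<in> lists S" "word_prod W us = w" "length us = len w" using len_word assms by blast
  then obtain s vs where "us = s # vs" using assms by (cases us) auto
  moreover from this have "s \<in> S" "vs \<in> lists S" using us by auto
  ultimately have "s \<in> S" "len (s \<otimes> w) \<le> length vs"
    using us len_le [of vs] S_mult_S_mult [of s "word_prod W vs"] by auto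
  then show thesis using that us \<open>us = s # vs\<close> len_S_mult_cases [of w s] assms by auto
qed

lemma ex_right_descent:
  assumes "w \<in> carrier W" "w \<noteq> \<one>"
  obtains s where "s \<in> S" "len w = Suc (len (w \<otimes> s))"
proof -
  obtain s where s: "s \<in> S" "len (inv w) = Suc (len (s \<otimes> inv w))"
    using ex_left_descent [of "inv w"] assms by auto
  have "len (w \<otimes> s) = len (s \<otimes> inv w)"
    using len_inv [of "w \<otimes> s"] s assms by (simp add: inv_mult_group S_inv S_carrier)
  then show thesis using that s assms by (simp add: len_inv)
qed

text \<open>By convexity of half-spaces, \<open>between v w\<close> says that \<open>v\<close> lies on a minimal gallery from \<open>1\<close> to \<open>w\<close>.\<close>

definition between :: "'a \<Rightarrow> 'a \<Rightarrow> bool" where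
  "between v w \<longleftrightarrow> (\<forall>\<gamma> \<in> roots. \<one> \<in> \<gamma> \<longrightarrow> w \<in> \<gamma> \<longrightarrow> v \<in> \<gamma>)"

lemma between_refl: "between w w"
  by (auto simp: between_def)

lemma between_S:
  assumes "c \<in> carrier W" "s \<in> S" "len c < len (c \<otimes> s)"
  shows "between c (c \<otimes> s)"
  unfolding between_def
proof (intro ballI impI)
  fix \<gamma> assume \<gamma>: "\<gamma> \<in> roots" "\<one> \<in> \<gamma>" "c \<otimes> s \<in> \<gamma>"
  show "c \<in> \<gamma>"
  proof (rule ccontr)
    assume "c \<notin> \<gamma>"
    then have "\<gamma> = (c \<otimes> s) <#\<^bsub>W\<^esub> simple_root s"
      using \<gamma> assms by (intro root_separating) auto
    then show False
      using one_mem_l_coset_simple_root [of "c \<otimes> s" s] \<gamma> assms by (auto simp: S_carrier)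
  qed
qed

lemma between_word:
  assumes "x \<in> carrier W" "us \<in> lists S" "len (x \<otimes> word_prod W us) = len x + length us"
  shows "between x (x \<otimes> word_prod W us)"
  using assms(2,3)
proof (induction us rule: rev_induct)
  case Nil
  then show ?case using assms by (simp add: between_refl)
next
  case (snoc s us)
  let ?y = "x \<otimes> word_prod W us"
  have us: "us \<in> lists S" "s \<in> S" and [simp]: "s \<in> carrier W" "?y \<in> carrier W"
    using snoc.prems assms by (auto simp: S_carrier)
  have eq: "x \<otimes> word_prod W (us @ [s]) = ?y \<otimes> s" using us assms by (simp add: m_assoc)
  have "len (?y \<otimes> s) = Suc (len x + length us)"
    using snoc.prems(2) unfolding eq by simp
  then have "len ?y = len x + length us" and "len ?y < len (?y \<otimes> s)"
    using len_mult_word [of x us] len_mult_S [of ?y s] us assms by auto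
  then show ?case
    using snoc.IH us between_S [of ?y s] unfolding eq by (auto simp: between_def)
qed

text \<open>Length is measured among words over \<open>A\<close> only, that is, inside the subgroup
  generated by \<open>A\<close>; \<open>len_coset_minimal_mult\<close> links it to
  \<open>len\<close>.\<close>

definition reduced_in :: "'a set \<Rightarrow> 'a list \<Rightarrow> bool" where
  "reduced_in A us \<longleftrightarrow> us \<in> lists A \<and>
    (\<forall>vs \<in> lists A. word_prod W vs = word_prod W us \<longrightarrow> length us \<le> length vs)"

definition coset_minimal :: "'a set \<Rightarrow> 'a \<Rightarrow> bool" where
  "coset_minimal A w \<longleftrightarrow> w \<in> carrier W \<and> (\<forall>us \<in> lists A. len w \<le> len (w \<otimes> word_prod W us))"

lemma reduced_in_infix:
  assumes "A \<subseteq> S" "reduced_in A (us @ vs @ ws)"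
  shows "reduced_in A vs"
proof -
  have sub: "lists A \<subseteq> lists S" using assms by (simp add: lists_mono)
  have lists: "us \<in> lists A" "vs \<in> lists A" "ws \<in> lists A" using assms by (auto simp: reduced_in_def)
  have "length vs \<le> length vs'" if "vs' \<in> lists A" "word_prod W vs' = word_prod W vs" for vs'
  proof -
    have "us \<in> lists S" "vs \<in> lists S" "ws \<in> lists S" "vs' \<in> lists S" using lists that sub by auto
    then have "word_prod W (us @ vs' @ ws) = word_prod W (us @ vs @ ws)"
      using that(2) by (simp only: word_prod_append append_in_lists_conv simp_thms)
    then have "length (us @ vs @ ws) \<le> length (us @ vs' @ ws)"
      using assms that lists unfolding reduced_in_def by (metis append_in_lists_conv)
    then show ?thesis by simp
  qed
  then show ?thesis using lists by (auto simp: reduced_in_def)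
qed

lemma ex_reduced_in:
  assumes "us \<in> lists A"
  obtains vs where "reduced_in A vs" "word_prod W vs = word_prod W us"
proof -
  define P where "P vs \<longleftrightarrow> vs \<in> lists A \<and> word_prod W vs = word_prod W us" for vs
  obtain vs where "P vs" "\<forall>vs'. P vs' \<longrightarrow> length vs \<le> length vs'"
    using assms ex_has_least_nat [of P us length] by (auto simp: P_def)
  then show thesis using that [of vs] by (auto simp: reduced_in_def P_def)
qed

lemma word_prod_rev: "us \<in> lists S \<Longrightarrow> word_prod W (rev us) = inv (word_prod W us)"
  by (induction us) (auto simp: S_carrier S_inv inv_mult_group)

lemma ex_coset_minimal:
  assumes "w \<in> carrier W" "A \<subseteq> S"
  obtains w1 us where "coset_minimal A w1" "reduced_in A us" "w = w1 \<otimes> word_prod W us"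
proof -
  have sub: "us \<in> lists A \<Longrightarrow> us \<in> lists S" for us using assms by auto
  obtain vs where vs: "vs \<in> lists A" "\<forall>vs'. vs' \<in> lists A \<longrightarrow> len (w \<otimes> word_prod W vs) \<le> len (w \<otimes> word_prod W vs')"
    using ex_has_least_nat [of "\<lambda>vs. vs \<in> lists A" "[]" "\<lambda>vs. len (w \<otimes> word_prod W vs)"] by auto
  have "len (w \<otimes> word_prod W vs) \<le> len (w \<otimes> word_prod W vs \<otimes> word_prod W us)" if "us \<in> lists A" for us
  proof -
    have "w \<otimes> word_prod W vs \<otimes> word_prod W us = w \<otimes> word_prod W (vs @ us)"
      using sub [OF vs(1)] sub [OF that] assms by (simp add: m_assoc)
    moreover have "vs @ us \<in> lists A" using vs that by auto
    ultimately show ?thesis using vs(2) by metis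
  qed
  then have "coset_minimal A (w \<otimes> word_prod W vs)"
    using sub [OF vs(1)] assms by (simp add: coset_minimal_def)
  moreover obtain us where "reduced_in A us" "word_prod W us = word_prod W (rev vs)"
    using ex_reduced_in [of "rev vs" A] vs by auto
  moreover have "w = w \<otimes> word_prod W vs \<otimes> word_prod W (rev vs)"
    using sub [OF vs(1)] assms by (simp add: word_prod_rev m_assoc)
  ultimately show thesis using that by metis
qed

text \<open>Suppose that the last letter \<open>s\<close> shortens the product, and let
  \<open>r\<close> be the reflection of the wall it crosses. If this wall separates 1 from
  \<open>w\<close>, then \<open>r \<otimes> w\<close> is a shorter element of the same coset. If it
  separates \<open>w\<close> from \<open>w \<otimes> u\<close>, deletion inside \<open>us\<close>
  yields a shorter word over \<open>A\<close> for \<open>us @ [s]\<close>. Both are excluded by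
  minimality.\<close>

lemma len_coset_minimal_mult:
  assumes "A \<subseteq> S" "coset_minimal A w" "reduced_in A us"
  shows "len (w \<otimes> word_prod W us) = len w + length us"
  using assms(3)
proof (induction us rule: rev_induct)
  case Nil
  then show ?case using assms by (simp add: coset_minimal_def)
next
  case (snoc s us)
  have red: "reduced_in A us" using reduced_in_infix [of A "[]" us "[s]"] snoc assms by simp
  have usA: "us \<in> lists A" "s \<in> A" using snoc.prems by (auto simp: reduced_in_def)
  then have us: "us \<in> lists S" and s: "s \<in> S" and [simp]: "s \<in> carrier W" "w \<in> carrier W"
    using assms by (auto simp: S_carrier coset_minimal_def)
  define u where "u = word_prod W us"
  have [simp]: "u \<in> carrier W" using us by (simp add: u_def)
  have eq: "w \<otimes> word_prod W (us @ [s]) = w \<otimes> u \<otimes> s" using us s by (simp add: m_assoc u_def)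
  have IH: "len (w \<otimes> u) = len w + length us" using snoc.IH red by (simp add: u_def)
  have "\<not> len (w \<otimes> u \<otimes> s) < len (w \<otimes> u)"
  proof
    define r where "r = w \<otimes> u \<otimes> s \<otimes> inv (w \<otimes> u)"
    have [simp]: "r \<in> carrier W" by (simp add: r_def)
    assume "len (w \<otimes> u \<otimes> s) < len (w \<otimes> u)"
    then have "eta (w \<otimes> u) r"
      using len_right_less_iff s by (simp add: r_def)
    then consider "eta w r" | "eta u (inv w \<otimes> r \<otimes> w)" by (auto simp: eta_mult)
    then show False
    proof cases
      case 1
      then have "len (r \<otimes> w) < len w" by (simp add: eta_len_less)
      moreover have "r \<otimes> w = w \<otimes> word_prod W (us @ [s] @ rev us)"
        using us s by (simp add: r_def inv_mult_group word_prod_rev m_assoc flip: u_def)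
      moreover have "us @ [s] @ rev us \<in> lists A" using usA by auto
      ultimately show False using assms(2) unfolding coset_minimal_def by (metis leD)
    next
      case 2
      then have "par us (inv w \<otimes> r \<otimes> w)" using us by (simp add: eta_word_prod u_def)
      then obtain vs where vs: "vs \<in> lists A" "Suc (length vs) = length us" "word_prod W vs = inv w \<otimes> r \<otimes> w \<otimes> u"
        using par_deletion [OF usA(1) assms(1), of "inv w \<otimes> r \<otimes> w"] by (auto simp: u_def)
      moreover have "inv w \<otimes> r \<otimes> w \<otimes> u = word_prod W (us @ [s])"
        using us s by (simp add: r_def inv_mult_group m_assoc flip: u_def)
      ultimately have "length (us @ [s]) \<le> length vs"
        using snoc.prems by (auto simp: reduced_in_def)
      then show False using vs by simp
    qed
  qed
  then have "len (w \<otimes> u \<otimes> s) = Suc (len (w \<otimes> u))"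
    using len_mult_S_cases [of "w \<otimes> u" s] s by auto
  then show ?case using IH by (simp add: eq del: word_prod_append)
qed

fun alt :: "'a \<Rightarrow> 'a \<Rightarrow> nat \<Rightarrow> 'a list" where
  "alt s t 0 = []"
| "alt s t (Suc n) = s # alt t s n"

lemma length_alt [simp]: "length (alt s t n) = n"
  by (induction n arbitrary: s t) auto

lemma set_alt: "set (alt s t n) \<subseteq> {s, t}"
  by (induction n arbitrary: s t) auto

lemma alt_snoc: "alt s t (Suc n) = alt s t n @ [if even n then s else t]"
  by (induction n arbitrary: s t) auto

lemma alt_add: "alt s t (m + n) = alt s t m @ (if even m then alt s t n else alt t s n)"
  by (induction m arbitrary: s t) auto

lemma reduced_in_alt:
  assumes "s \<in> S" "t \<in> S" "reduced_in {s, t} us"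
  shows "us = alt s t (length us) \<or> us = alt t s (length us)"
  using assms(3)
proof (induction us)
  case (Cons a us)
  have A: "{s, t} \<subseteq> S" using assms by auto
  have "reduced_in {s, t} us"
    using reduced_in_infix [OF A, of "[a]" us "[]"] Cons by simp
  with Cons have us: "us = alt s t (length us) \<or> us = alt t s (length us)" by auto
  have a: "a \<in> {s, t}" using Cons by (auto simp: reduced_in_def)
  have "us \<noteq> a # vs" for vs
  proof
    assume "us = a # vs"
    then have "reduced_in {s, t} [a, a]"
      using reduced_in_infix [OF A, of "[]" "[a, a]" vs] Cons by simp
    moreover have "word_prod W [a, a] = word_prod W []"
      using a assms by (auto simp: S_sq S_carrier)
    moreover have "[] \<in> lists {s, t}" by simp
    ultimately have "length [a, a] \<le> length ([] :: 'a list)" unfolding reduced_in_def by metis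
    then show False by simp
  qed
  then show ?case
    using us a by (cases "length us") (auto)
qed auto

text \<open>\<open>p\<close> is the longest element of the finite dihedral group generated by \<open>s\<close> and \<open>t\<close>.\<close>

definition dihedral_longest :: "'a \<Rightarrow> 'a \<Rightarrow> nat \<Rightarrow> 'a \<Rightarrow> bool" where
  "dihedral_longest s t k p \<longleftrightarrow> k \<noteq> 0 \<and> word_prod W (alt s t k) = p \<and> word_prod W (alt t s k) = p \<and>
    reduced_in {s, t} (alt s t k) \<and> reduced_in {s, t} (alt t s k)"

text \<open>Split \<open>w\<close> into a coset-minimal part and a word over s and t. By additivity
  of lengths, s and t both shorten the second part, which therefore has reduced words of equal
  length ending in s and in t. Reduced words over two letters alternate, so these are the two
  alternating words of that length.\<close>

lemma two_descents:
  assumes "w \<in> carrier W" "s \<in> S" "t \<in> S" "s \<noteq> t" "len (w \<otimes> s) < len w" "len (w \<otimes> t) < len w"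
  obtains w1 k p where "coset_minimal {s, t} w1" "dihedral_longest s t k p" "w = w1 \<otimes> p"
proof -
  have A: "{s, t} \<subseteq> S" using assms by auto
  then have sub: "us \<in> lists {s, t} \<Longrightarrow> us \<in> lists S" for us by auto
  obtain w1 us where w1: "coset_minimal {s, t} w1" and us: "reduced_in {s, t} us" and w: "w = w1 \<otimes> word_prod W us"
    using ex_coset_minimal [OF assms(1) A] by metis
  have [simp]: "w1 \<in> carrier W" using w1 by (simp add: coset_minimal_def)
  have usA: "us \<in> lists {s, t}" using us by (simp add: reduced_in_def)
  have *: "\<exists>vs. reduced_in {s, t} (vs @ [a]) \<and> Suc (length vs) = length us \<and> word_prod W (vs @ [a]) = word_prod W us"
    if a: "a \<in> {s, t}" "len (w \<otimes> a) < len w" for a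
  proof -
    have aS: "a \<in> S" using a A by auto
    obtain vs where vs: "reduced_in {s, t} vs" "word_prod W vs = word_prod W (us @ [a])"
      using ex_reduced_in [of "us @ [a]" "{s, t}"] usA a by auto
    have vsA: "vs \<in> lists {s, t}" using vs by (simp add: reduced_in_def)
    have "w1 \<otimes> word_prod W vs = w \<otimes> a"
      using vs sub [OF usA] aS by (simp add: w m_assoc S_carrier)
    then have "len (w \<otimes> a) = len w1 + length vs"
      using len_coset_minimal_mult [OF A w1 vs(1)] by simp
    moreover have "len w = len w1 + length us"
      using len_coset_minimal_mult [OF A w1 us] w by simp
    ultimately have l: "Suc (length vs) = length us"
      using a len_mult_S' [of w a] assms(1) aS by auto
    have "word_prod W (vs @ [a]) = word_prod W us"
      using vs(2) sub [OF vsA] sub [OF usA] aS by (simp add: S_carrier)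
    moreover from this have "reduced_in {s, t} (vs @ [a])"
      using us vsA a l by (auto simp: reduced_in_def)
    ultimately show ?thesis using l by blast
  qed
  obtain us1 where us1: "reduced_in {s, t} (us1 @ [s])" "Suc (length us1) = length us" "word_prod W (us1 @ [s]) = word_prod W us"
    using * [of s] assms by auto
  obtain us2 where us2: "reduced_in {s, t} (us2 @ [t])" "Suc (length us2) = length us" "word_prod W (us2 @ [t]) = word_prod W us"
    using * [of t] assms by auto
  define k where "k = length us"
  have k: "k = Suc (length us1)" "k = Suc (length us2)" using us1 us2 by (auto simp: k_def)
  have 1: "us1 @ [s] = alt s t k \<or> us1 @ [s] = alt t s k"
    using reduced_in_alt [OF assms(2,3) us1(1)] k by simp
  have 2: "us2 @ [t] = alt s t k \<or> us2 @ [t] = alt t s k"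
    using reduced_in_alt [OF assms(2,3) us2(1)] k by simp
  have "(alt s t k = us1 @ [s] \<and> alt t s k = us2 @ [t]) \<or> (alt t s k = us1 @ [s] \<and> alt s t k = us2 @ [t])"
    using 1 2 assms(4) by (metis last_snoc)
  then have "dihedral_longest s t k (word_prod W us)"
    using us1 us2 k unfolding dihedral_longest_def by (metis nat.distinct(1))
  then show thesis using that w1 w by blast
qed

lemma dihedral_longest_last:
  assumes "dihedral_longest s t k p" "a \<in> {s, t}"
  obtains us where "reduced_in {s, t} (us @ [a])" "word_prod W (us @ [a]) = p"
proof -
  obtain n where n: "k = Suc n" using assms by (cases k) (auto simp: dihedral_longest_def)
  show thesis
    using assms that [of "alt s t n"] that [of "alt t s n"]
    unfolding dihedral_longest_def n alt_snoc by (cases "even n") auto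
qed

text \<open>A reduced word over s and t alternates and cannot be longer than \<open>k\<close>; hence
  it is an initial segment of one of the two alternating words for \<open>p\<close>.\<close>

lemma dihedral_prefix:
  assumes "s \<in> S" "t \<in> S" "dihedral_longest s t k p" "us \<in> lists {s, t}"
  obtains vs ws where "vs \<in> lists {s, t}" "ws \<in> lists {s, t}" "word_prod W us = word_prod W vs"
    "reduced_in {s, t} vs" "reduced_in {s, t} (vs @ ws)" "word_prod W (vs @ ws) = p"
proof -
  have A: "{s, t} \<subseteq> S" using assms by auto
  then have sub: "us \<in> lists {s, t} \<Longrightarrow> us \<in> lists S" for us by auto
  obtain vs where vs: "reduced_in {s, t} vs" "word_prod W vs = word_prod W us"
    using ex_reduced_in assms(4) by metis
  have alt_lists: "alt a b n \<in> lists {s, t}" if "{a, b} = {s, t}" for a b n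
    using set_alt [of a b n] that by auto
  obtain a b where ab: "{a, b} = {s, t}" "vs = alt a b (length vs)"
    using reduced_in_alt [OF assms(1,2) vs(1)] by (metis insert_commute)
  have dl: "k \<noteq> 0" "word_prod W (alt a b k) = p" "word_prod W (alt b a k) = p" "reduced_in {s, t} (alt a b k)"
    using assms(3) ab(1) by (auto simp: dihedral_longest_def doubleton_eq_iff)
  have "length vs \<le> k"
  proof (rule ccontr)
    assume "\<not> length vs \<le> k"
    then obtain j where j: "length vs = Suc k + j" by (metis less_imp_Suc_add not_le add_Suc)
    then have red: "reduced_in {s, t} (alt a b (Suc k))"
      using reduced_in_infix [OF A, of "[]" "alt a b (Suc k)"] vs(1) ab(2) alt_add [of a b "Suc k" j] by (metis append_Nil)
    obtain n where n: "k = Suc n" using dl by (cases k) auto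
    \<comment> \<open>\<open>c\<close> is the last letter of \<open>alt b a k\<close> and also the
      letter that extends \<open>alt a b k\<close> to length \<open>Suc k\<close>. As both words of
      length \<open>k\<close> have product \<open>p\<close>, the two occurrences cancel and leave a
      word of length \<open>n\<close>.\<close>
    define c where "c = (if even k then a else b)"
    have c: "c \<in> S" using ab(1) A by (auto simp: c_def)
    have "alt b a k = alt b a n @ [c]" using alt_snoc [of b a n] n by (auto simp: c_def)
    moreover have "alt a b (Suc k) = alt a b k @ [c]" using alt_snoc [of a b k] by (simp add: c_def)
    moreover have "alt a b k \<in> lists S" "alt b a n \<in> lists S" "[c] \<in> lists S"
      using sub alt_lists ab(1) c by (auto simp: insert_commute simp del: in_lists_conv_set)
    ultimately have "word_prod W (alt b a k) = word_prod W (alt b a n) \<otimes> word_prod W [c]"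
      and "word_prod W (alt a b (Suc k)) = word_prod W (alt a b k) \<otimes> word_prod W [c]"
      and [simp]: "word_prod W (alt b a n) \<in> carrier W"
      by (simp_all only: word_prod_append word_prod_closed)
    then have "word_prod W (alt a b (Suc k)) = word_prod W (alt b a n)"
      using dl(2,3) c by (simp add: S_carrier flip: alt.simps) 
    then have "length (alt a b (Suc k)) \<le> length (alt b a n)"
      using red alt_lists [of b a n] ab(1) unfolding reduced_in_def by (metis insert_commute)
    then show False using n by simp
  qed
  then obtain j where "k = length vs + j" using le_Suc_ex by blast
  then obtain ws where ws: "alt a b k = vs @ ws" using alt_add [of a b "length vs" j] ab(2) by metis
  then have "ws \<in> lists {s, t}" using alt_lists [OF ab(1), of k] by simp
  moreover have "vs \<in> lists {s, t}" using vs by (simp add: reduced_in_def)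
  ultimately show thesis using that vs ws dl by metis
qed

text \<open>Every element of the coset is completed to \<open>w \<otimes> p\<close> by a word that
  adds its full length. This makes \<open>w \<otimes> p\<close> an admissible far end for
  \<open>local_injectivity\<close> on a whole rank 2 residue.\<close>

lemma between_dihedral:
  assumes "s \<in> S" "t \<in> S" "dihedral_longest s t k p" "us \<in> lists {s, t}" "coset_minimal {s, t} w"
  shows "between (w \<otimes> word_prod W us) (w \<otimes> p)"
proof -
  have A: "{s, t} \<subseteq> S" using assms by auto
  then have sub: "us \<in> lists {s, t} \<Longrightarrow> us \<in> lists S" for us by auto
  obtain vs ws where vw: "vs \<in> lists {s, t}" "ws \<in> lists {s, t}" "word_prod W us = word_prod W vs"
    "reduced_in {s, t} vs" "reduced_in {s, t} (vs @ ws)" "word_prod W (vs @ ws) = p"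
    using dihedral_prefix [OF assms(1-4)] by metis
  have [simp]: "w \<in> carrier W" using assms by (simp add: coset_minimal_def)
  have eq: "w \<otimes> p = w \<otimes> word_prod W vs \<otimes> word_prod W ws"
    using vw(6) sub [OF vw(1)] sub [OF vw(2)] by (auto simp: m_assoc)
  have "len (w \<otimes> word_prod W vs \<otimes> word_prod W ws) = len (w \<otimes> word_prod W vs) + length ws"
    using len_coset_minimal_mult [OF A assms(5) vw(4)] len_coset_minimal_mult [OF A assms(5) vw(5)] vw(6) eq by simp
  then show ?thesis
    using between_word [of "w \<otimes> word_prod W vs" ws] sub [OF vw(1)] sub [OF vw(2)] vw(3) eq by auto
qed

section \<open>Bruhat order and length\<close>

lemma bruhat_less_len:
  assumes "bruhat_less v w"
  shows "len v < len w"
proof -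
  have "v = w \<or> len v < len w" if "bruhat_step\<^sup>*\<^sup>* v w"
    using that by (induction rule: rtranclp_induct) (auto simp: bruhat_step_def)
  then show ?thesis using assms by (auto simp: bruhat_less_def bruhat_le_def)
qed

lemma bruhat_less_mult_S:
  assumes "w \<in> carrier W" "s \<in> S" "len w < len (w \<otimes> s)"
  shows "bruhat_less w (w \<otimes> s)"
proof -
  have "bruhat_step w (w \<otimes> s)" using assms S_reflection by (auto simp: bruhat_step_def)
  then show ?thesis using assms by (auto simp: bruhat_less_def bruhat_le_def)
qed

end

section \<open>Root groups and the Bruhat decomposition\<close>

text \<open>All axioms here are stable under replacing \<open>U \<alpha>\<close> by the root group
  of the opposite root; this is why \<open>mu_pos\<close> and \<open>mu_neg\<close> are both listed
  and (RGD3) is left out. The map \<open>\<psi>\<close> with kernel \<open>T\<close> encodes the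
  isomorphism between N/T and W.\<close>

locale rgd_core = cox: coxeter_system W S + group G
  for W :: "('w, 'x) monoid_scheme" and S and G :: "('g, 'y) monoid_scheme" (structure) +
  fixes U :: "'w set \<Rightarrow> 'g set" and T N :: "'g set" and \<psi> :: "'g \<Rightarrow> 'w"
  assumes U_subgroup: "\<alpha> \<in> cox.roots \<Longrightarrow> subgroup (U \<alpha>) G"
    and U_nontrivial: "\<alpha> \<in> cox.roots \<Longrightarrow> U \<alpha> \<noteq> {\<one>}"
    and N_subgroup: "subgroup N G"
    and \<psi>_closed: "n \<in> N \<Longrightarrow> \<psi> n \<in> carrier W"
    and \<psi>_mult: "n \<in> N \<Longrightarrow> n' \<in> N \<Longrightarrow> \<psi> (n \<otimes> n') = \<psi> n \<otimes>\<^bsub>W\<^esub> \<psi> n'"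
    and \<psi>_surj: "w \<in> carrier W \<Longrightarrow> \<exists>n \<in> N. \<psi> n = w"
    and T_eq: "T = {n \<in> N. \<psi> n = \<one>\<^bsub>W\<^esub>}"
    and U_conj: "n \<in> N \<Longrightarrow> \<alpha> \<in> cox.roots \<Longrightarrow> u \<in> U \<alpha> \<Longrightarrow> n \<otimes> u \<otimes> inv n \<in> U (\<psi> n <#\<^bsub>W\<^esub> \<alpha>)"
    and U_commutator: "\<alpha> \<in> cox.roots \<Longrightarrow> \<beta> \<in> cox.roots \<Longrightarrow> \<alpha> \<noteq> \<beta> \<Longrightarrow> cox.prenilpotent \<alpha> \<beta> \<Longrightarrow>
      x \<in> U \<alpha> \<Longrightarrow> y \<in> U \<beta> \<Longrightarrow> x \<otimes> y \<otimes> inv x \<otimes> inv y \<in> generate G (\<Union>\<gamma> \<in> cox.open_interval \<alpha> \<beta>. U \<gamma>)"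
    and mu_pos: "s \<in> S \<Longrightarrow> u \<in> U (cox.simple_root s) \<Longrightarrow> u \<noteq> \<one> \<Longrightarrow>
      \<exists>a \<in> U (cox.neg (cox.simple_root s)). \<exists>b \<in> U (cox.neg (cox.simple_root s)). a \<otimes> u \<otimes> b \<in> N \<and> \<psi> (a \<otimes> u \<otimes> b) = s"
    and mu_neg: "s \<in> S \<Longrightarrow> u \<in> U (cox.neg (cox.simple_root s)) \<Longrightarrow> u \<noteq> \<one> \<Longrightarrow>
      \<exists>a \<in> U (cox.simple_root s). \<exists>b \<in> U (cox.simple_root s). a \<otimes> u \<otimes> b \<in> N \<and> \<psi> (a \<otimes> u \<otimes> b) = s"
    and generated: "carrier G \<subseteq> generate G (N \<union> (\<Union>\<alpha> \<in> cox.roots. U \<alpha>))"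
begin

section \<open>The groups N and T, and groups generated by root groups\<close>

lemma N_carrier [simp]: "n \<in> N \<Longrightarrow> n \<in> carrier G"
  using N_subgroup subgroup.mem_carrier by metis

lemma N_closed [simp]:
  "\<one> \<in> N" "n \<in> N \<Longrightarrow> n' \<in> N \<Longrightarrow> n \<otimes> n' \<in> N" "n \<in> N \<Longrightarrow> inv n \<in> N"
  using N_subgroup by (auto simp: subgroup.one_closed subgroup.m_closed subgroup.m_inv_closed)

lemma \<psi>_one [simp]: "\<psi> \<one> = \<one>\<^bsub>W\<^esub>"
proof -
  have "\<psi> \<one> \<otimes>\<^bsub>W\<^esub> \<psi> \<one> = \<psi> \<one>" using \<psi>_mult [of \<one> \<one>] by simp
  then show ?thesis using \<psi>_closed [of \<one>] by simp
qed

lemma \<psi>_inv: "n \<in> N \<Longrightarrow> \<psi> (inv n) = inv\<^bsub>W\<^esub> \<psi> n"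
  using \<psi>_mult [of "inv n" n] \<psi>_closed by (simp add: cox.inv_equality)

lemma T_N: "t \<in> T \<Longrightarrow> t \<in> N" and T_\<psi>: "t \<in> T \<Longrightarrow> \<psi> t = \<one>\<^bsub>W\<^esub>"
  by (auto simp: T_eq)

lemma T_I: "n \<in> N \<Longrightarrow> \<psi> n = \<one>\<^bsub>W\<^esub> \<Longrightarrow> n \<in> T"
  by (simp add: T_eq)

lemma T_carrier [simp]: "t \<in> T \<Longrightarrow> t \<in> carrier G"
  by (simp add: T_N)

lemma T_closed [simp]:
  "\<one> \<in> T" "t \<in> T \<Longrightarrow> t' \<in> T \<Longrightarrow> t \<otimes> t' \<in> T" "t \<in> T \<Longrightarrow> inv t \<in> T"
  by (auto simp: T_eq \<psi>_mult \<psi>_inv)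

lemma T_conj: "n \<in> N \<Longrightarrow> t \<in> T \<Longrightarrow> n \<otimes> t \<otimes> inv n \<in> T"
  by (simp add: T_eq \<psi>_mult \<psi>_inv \<psi>_closed)

lemma T_conj': "n \<in> N \<Longrightarrow> t \<in> T \<Longrightarrow> inv n \<otimes> t \<otimes> n \<in> T"
  by (simp add: T_eq \<psi>_mult \<psi>_inv \<psi>_closed)

lemma \<psi>_eq_T:
  assumes "n \<in> N" "n' \<in> N" "\<psi> n = \<psi> n'"
  shows "inv n \<otimes> n' \<in> T" "n \<otimes> inv n' \<in> T"
  using assms \<psi>_closed [of n'] by (auto simp: T_eq \<psi>_mult \<psi>_inv)

lemma U_carrier: "\<alpha> \<in> cox.roots \<Longrightarrow> u \<in> U \<alpha> \<Longrightarrow> u \<in> carrier G"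
  using U_subgroup subgroup.mem_carrier by metis

lemma U_inv: "\<alpha> \<in> cox.roots \<Longrightarrow> u \<in> U \<alpha> \<Longrightarrow> inv u \<in> U \<alpha>"
  using U_subgroup subgroup.m_inv_closed by metis

lemma U_mult: "\<alpha> \<in> cox.roots \<Longrightarrow> u \<in> U \<alpha> \<Longrightarrow> v \<in> U \<alpha> \<Longrightarrow> u \<otimes> v \<in> U \<alpha>"
  using U_subgroup subgroup.m_closed by metis

lemma U_one: "\<alpha> \<in> cox.roots \<Longrightarrow> \<one> \<in> U \<alpha>"
  using U_subgroup subgroup.one_closed by metis

lemma U_conj': "n \<in> N \<Longrightarrow> \<alpha> \<in> cox.roots \<Longrightarrow> u \<in> U \<alpha> \<Longrightarrow> inv n \<otimes> u \<otimes> n \<in> U (inv\<^bsub>W\<^esub> \<psi> n <#\<^bsub>W\<^esub> \<alpha>)"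
  using U_conj [of "inv n" \<alpha> u] by (simp add: \<psi>_inv)

definition root_gen :: "('w set \<Rightarrow> bool) \<Rightarrow> 'g set" where
  "root_gen P = generate G (\<Union>\<gamma> \<in> {\<gamma> \<in> cox.roots. P \<gamma>}. U \<gamma>)"

lemma root_gen_base: "(\<Union>\<gamma> \<in> {\<gamma> \<in> cox.roots. P \<gamma>}. U \<gamma>) \<subseteq> carrier G"
  using U_carrier by auto

lemma root_gen_subgroup: "subgroup (root_gen P) G"
  unfolding root_gen_def by (rule generate_is_subgroup [OF root_gen_base])

lemma root_gen_carrier: "g \<in> root_gen P \<Longrightarrow> g \<in> carrier G"
  using root_gen_subgroup subgroup.mem_carrier by metis

lemma root_gen_closed:
  "\<one> \<in> root_gen P" "g \<in> root_gen P \<Longrightarrow> h \<in> root_gen P \<Longrightarrow> g \<otimes> h \<in> root_gen P"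
  "g \<in> root_gen P \<Longrightarrow> inv g \<in> root_gen P"
  using root_gen_subgroup by (auto simp: subgroup.one_closed subgroup.m_closed subgroup.m_inv_closed)

lemma U_root_gen: "\<gamma> \<in> cox.roots \<Longrightarrow> P \<gamma> \<Longrightarrow> u \<in> U \<gamma> \<Longrightarrow> u \<in> root_gen P"
  unfolding root_gen_def by (rule generate.incl) auto

lemma root_gen_subset:
  assumes "subgroup K G" "\<And>\<gamma> u. \<gamma> \<in> cox.roots \<Longrightarrow> P \<gamma> \<Longrightarrow> u \<in> U \<gamma> \<Longrightarrow> u \<in> K"
  shows "root_gen P \<subseteq> K"
  unfolding root_gen_def by (rule generate_subgroup_incl) (use assms in auto)

lemma root_gen_mono: "(\<And>\<gamma>. \<gamma> \<in> cox.roots \<Longrightarrow> P \<gamma> \<Longrightarrow> Q \<gamma>) \<Longrightarrow> root_gen P \<subseteq> root_gen Q"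
  by (rule root_gen_subset [OF root_gen_subgroup]) (auto intro: U_root_gen)

lemma conj_root_gen:
  assumes "x \<in> carrier G" "subgroup K G"
    and "\<And>\<gamma> u. \<gamma> \<in> cox.roots \<Longrightarrow> P \<gamma> \<Longrightarrow> u \<in> U \<gamma> \<Longrightarrow> x \<otimes> u \<otimes> inv x \<in> K" and "g \<in> root_gen P"
  shows "x \<otimes> g \<otimes> inv x \<in> K"
  by (rule conj_generate [OF assms(1) root_gen_base [of P] assms(2) _ assms(4) [unfolded root_gen_def]])
    (use assms(3) in auto)

lemma N_conj_root_gen:
  assumes "n \<in> N" "\<And>\<gamma>. \<gamma> \<in> cox.roots \<Longrightarrow> P \<gamma> \<Longrightarrow> Q (\<psi> n <#\<^bsub>W\<^esub> \<gamma>)" "g \<in> root_gen P"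
  shows "n \<otimes> g \<otimes> inv n \<in> root_gen Q"
proof (rule conj_root_gen [OF _ root_gen_subgroup _ assms(3)])
  fix \<gamma> u assume "\<gamma> \<in> cox.roots" "P \<gamma>" "u \<in> U \<gamma>"
  then show "n \<otimes> u \<otimes> inv n \<in> root_gen Q"
    using U_root_gen [of "\<psi> n <#\<^bsub>W\<^esub> \<gamma>" Q] U_conj assms cox.l_coset_in_roots \<psi>_closed by blast
qed (use assms in auto)

text \<open>\<open>c\<close> and \<open>d\<close> witness prenilpotency: the former lies in both
  roots, the latter in neither. The conjugate of \<open>y\<close> is the commutator times
  \<open>y\<close>, so it stays in any group that contains the root groups of the open interval and
  of \<beta>.\<close>

lemma commutator_root_gen:
  assumes "\<alpha> \<in> cox.roots" "\<beta> \<in> cox.roots" "\<alpha> \<noteq> \<beta>" "x \<in> U \<alpha>" "y \<in> U \<beta>"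
    and "c \<in> \<alpha>" "c \<in> \<beta>" "d \<in> carrier W" "d \<notin> \<alpha>" "d \<notin> \<beta>"
    and "\<And>\<gamma>. \<gamma> \<in> cox.open_interval \<alpha> \<beta> \<Longrightarrow> P \<gamma>" "P \<beta>"
  shows "x \<otimes> y \<otimes> inv x \<in> root_gen P"
proof -
  have [simp]: "x \<in> carrier G" "y \<in> carrier G" using assms U_carrier by auto
  have "cox.prenilpotent \<alpha> \<beta>"
    using assms by (auto simp: cox.prenilpotent_def cox.neg_def)
  then have "x \<otimes> y \<otimes> inv x \<otimes> inv y \<in> generate G (\<Union>\<gamma> \<in> cox.open_interval \<alpha> \<beta>. U \<gamma>)"
    using U_commutator assms by auto
  moreover have "generate G (\<Union>\<gamma> \<in> cox.open_interval \<alpha> \<beta>. U \<gamma>) \<subseteq> root_gen P"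
    unfolding root_gen_def
    by (rule mono_generate) (use assms(11) in \<open>auto simp: cox.open_interval_def\<close>)
  ultimately have "(x \<otimes> y \<otimes> inv x \<otimes> inv y) \<otimes> y \<in> root_gen P"
    using U_root_gen [of \<beta> P y] assms root_gen_closed by blast
  then show ?thesis by (simp add: group_normalize)
qed

section \<open>The unipotent groups and the group B\<close>

definition Upos :: "'g set" where
  "Upos = root_gen (\<lambda>\<gamma>. \<one>\<^bsub>W\<^esub> \<in> \<gamma>)"

definition Uneg :: "'g set" where
  "Uneg = root_gen (\<lambda>\<gamma>. \<one>\<^bsub>W\<^esub> \<notin> \<gamma>)"

definition B :: "'g set" where
  "B = {t \<otimes> u | t u. t \<in> T \<and> u \<in> Upos}"

lemma Upos_subgroup: "subgroup Upos G"
  unfolding Upos_def by (rule root_gen_subgroup)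

lemma Upos_carrier [simp]: "u \<in> Upos \<Longrightarrow> u \<in> carrier G"
  unfolding Upos_def by (rule root_gen_carrier)

lemma Upos_closed [simp]:
  "\<one> \<in> Upos" "g \<in> Upos \<Longrightarrow> h \<in> Upos \<Longrightarrow> g \<otimes> h \<in> Upos" "g \<in> Upos \<Longrightarrow> inv g \<in> Upos"
  unfolding Upos_def by (auto simp: root_gen_closed)

lemma U_Upos: "\<gamma> \<in> cox.roots \<Longrightarrow> \<one>\<^bsub>W\<^esub> \<in> \<gamma> \<Longrightarrow> u \<in> U \<gamma> \<Longrightarrow> u \<in> Upos"
  unfolding Upos_def by (rule U_root_gen)

lemma T_conj_root_gen:
  assumes "t \<in> T" "u \<in> root_gen P"
  shows "t \<otimes> u \<otimes> inv t \<in> root_gen P"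
proof (rule N_conj_root_gen [OF _ _ assms(2)])
  show "t \<in> N" using assms by (simp add: T_N)
  show "P (\<psi> t <#\<^bsub>W\<^esub> \<gamma>)" if "\<gamma> \<in> cox.roots" "P \<gamma>" for \<gamma>
    using that assms cox.root_subset cox.lcos_mult_one by (simp add: T_\<psi>)
qed

lemma T_conj_Upos: "t \<in> T \<Longrightarrow> u \<in> Upos \<Longrightarrow> t \<otimes> u \<otimes> inv t \<in> Upos"
  unfolding Upos_def by (rule T_conj_root_gen)

lemma T_conj_Upos': "t \<in> T \<Longrightarrow> u \<in> Upos \<Longrightarrow> inv t \<otimes> u \<otimes> t \<in> Upos"
  using T_conj_Upos [of "inv t" u] by simp

lemma T_B [simp]: "t \<in> T \<Longrightarrow> t \<in> B"
  unfolding B_def by (rule CollectI, intro exI [of _ t] exI [of _ \<one>]) simp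

lemma Upos_B [simp]: "u \<in> Upos \<Longrightarrow> u \<in> B"
  unfolding B_def by (rule CollectI, intro exI [of _ \<one>] exI [of _ u]) simp

lemma B_carrier [simp]: "b \<in> B \<Longrightarrow> b \<in> carrier G"
  by (auto simp: B_def)

lemma B_mult [simp]: "b \<in> B \<Longrightarrow> b' \<in> B \<Longrightarrow> b \<otimes> b' \<in> B"
proof -
  assume "b \<in> B" "b' \<in> B"
  then obtain t u t' u' where *: "t \<in> T" "u \<in> Upos" "t' \<in> T" "u' \<in> Upos" "b = t \<otimes> u" "b' = t' \<otimes> u'"
    by (auto simp: B_def)
  then have "b \<otimes> b' = (t \<otimes> t') \<otimes> ((inv t' \<otimes> u \<otimes> t') \<otimes> u')" by (simp add: group_normalize)
  moreover have "t \<otimes> t' \<in> T" "(inv t' \<otimes> u \<otimes> t') \<otimes> u' \<in> Upos"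
    using * T_conj_Upos' by auto
  ultimately show ?thesis unfolding B_def by blast
qed

lemma B_one [simp]: "\<one> \<in> B"
  by simp

lemma B_inv [simp]: "b \<in> B \<Longrightarrow> inv b \<in> B"
proof -
  assume "b \<in> B"
  then obtain t u where *: "t \<in> T" "u \<in> Upos" "b = t \<otimes> u" by (auto simp: B_def)
  then have "inv b = inv u \<otimes> inv t" by (simp add: group_normalize)
  then show ?thesis using * by simp
qed

lemma B_subgroup: "subgroup B G"
proof (rule subgroupI)
  show "B \<noteq> {}" using B_one by blast
qed auto

lemma B_cases':
  assumes "b \<in> B"
  obtains u t where "u \<in> Upos" "t \<in> T" "b = u \<otimes> t"
proof -
  obtain t u where *: "t \<in> T" "u \<in> Upos" "b = t \<otimes> u" using assms by (auto simp: B_def)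
  then have "b = (t \<otimes> u \<otimes> inv t) \<otimes> t" by (simp add: group_normalize)
  then show thesis using that * T_conj_Upos by blast
qed

section \<open>Splitting off a simple root group\<close>

lemma positive_root_S:
  assumes "\<beta> \<in> cox.roots" "\<one>\<^bsub>W\<^esub> \<in> \<beta>" "s \<in> S" "\<beta> \<noteq> cox.simple_root s"
  shows "s \<in> \<beta>"
proof (rule ccontr)
  assume "s \<notin> \<beta>"
  then have "\<beta> = \<one>\<^bsub>W\<^esub> <#\<^bsub>W\<^esub> cox.simple_root s"
    using assms cox.root_separating [of \<beta> s "\<one>\<^bsub>W\<^esub>"] cox.S_carrier by auto
  then show False
    using assms cox.lcos_mult_one cox.root_subset cox.simple_root_in_roots by auto
qed

lemma one_in_S_l_coset:
  assumes "\<beta> \<in> cox.roots" "s \<in> S"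
  shows "\<one>\<^bsub>W\<^esub> \<in> s <#\<^bsub>W\<^esub> \<beta> \<longleftrightarrow> s \<in> \<beta>"
  using assms cox.mem_l_coset [of s \<beta> "\<one>\<^bsub>W\<^esub>"] by (simp add: cox.S_carrier cox.S_inv)

text \<open>If \<alpha> is not contained in \<beta>, the negative of \<alpha> and \<beta> are
  prenilpotent, and every root in their open interval is positive: one that contains s but not 1
  would be the negative of \<alpha>. If \<alpha> is contained in \<beta>, the pair is not
  prenilpotent and no commutator relation is available; \<open>y\<close> is then expressed through
  an element of \<open>N\<close> over \<open>s\<close>.\<close>

lemma U_negative_conj:
  assumes s: "s \<in> S" and \<beta>: "\<beta> \<in> cox.roots" "\<one>\<^bsub>W\<^esub> \<in> \<beta>" "\<beta> \<noteq> cox.simple_root s"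
    and y: "y \<in> U (cox.neg (cox.simple_root s))" and u: "u \<in> U \<beta>"
  shows "y \<otimes> u \<otimes> inv y \<in> Upos"
proof -
  define \<alpha> where "\<alpha> = cox.simple_root s"
  have \<alpha>: "\<alpha> \<in> cox.roots" "\<one>\<^bsub>W\<^esub> \<in> \<alpha>" "s \<notin> \<alpha>" and n\<alpha>: "cox.neg \<alpha> \<in> cox.roots"
    using s by (auto simp: \<alpha>_def cox.simple_root_in_roots cox.one_in_simple_root cox.S_notin_simple_root cox.neg_in_roots)
  have sW [simp]: "s \<in> carrier W" using s cox.S_carrier by auto
  have s\<beta>: "s \<in> \<beta>" using positive_root_S assms by auto
  have sn: "s \<in> cox.neg \<alpha>" using \<alpha> by (simp add: cox.neg_def)
  have carr [simp]: "y \<in> carrier G" "u \<in> carrier G" using assms U_carrier n\<alpha> by (auto simp: \<alpha>_def)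
  show ?thesis
  proof (cases "\<alpha> \<subseteq> \<beta>")
    case False
    then obtain d where d: "d \<in> \<alpha>" "d \<notin> \<beta>" by auto
    then have dW: "d \<in> carrier W" using \<alpha> cox.root_subset by auto
    show ?thesis
      unfolding Upos_def
    proof (rule commutator_root_gen [OF n\<alpha> \<beta>(1) _ _ u sn s\<beta> dW])
      show "cox.neg \<alpha> \<noteq> \<beta>" using \<beta> \<alpha> by (auto simp: cox.neg_def)
      show "y \<in> U (cox.neg \<alpha>)" using y by (simp add: \<alpha>_def)
      show "d \<notin> cox.neg \<alpha>" using d by (simp add: cox.neg_def)
      show "d \<notin> \<beta>" "\<one>\<^bsub>W\<^esub> \<in> \<beta>" using d \<beta> by auto
      fix \<gamma> assume \<gamma>: "\<gamma> \<in> cox.open_interval (cox.neg \<alpha>) \<beta>"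
      show "\<one>\<^bsub>W\<^esub> \<in> \<gamma>"
      proof (rule ccontr)
        assume "\<one>\<^bsub>W\<^esub> \<notin> \<gamma>"
        moreover have \<gamma>r: "\<gamma> \<in> cox.roots" "s \<in> \<gamma>" "\<gamma> \<noteq> cox.neg \<alpha>"
          using \<gamma> sn s\<beta> by (auto simp: cox.open_interval_def)
        ultimately have "\<gamma> = s <#\<^bsub>W\<^esub> cox.simple_root s"
          using cox.root_separating [of \<gamma> s s] s by (simp add: cox.S_sq)
        then show False using \<gamma>r s by (simp add: cox.S_l_coset_simple_root \<alpha>_def)
      qed
    qed
  next
    case True
    show ?thesis
    proof (cases "y = \<one>")
      case True
      then show ?thesis using U_Upos \<beta> u by simp
    next
      case False
      then obtain a b where ab: "a \<in> U \<alpha>" "b \<in> U \<alpha>" "a \<otimes> y \<otimes> b \<in> N" "\<psi> (a \<otimes> y \<otimes> b) = s"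
        using mu_neg [of s y] s y by (auto simp: \<alpha>_def)
      define m where "m = a \<otimes> y \<otimes> b"
      have [simp]: "a \<in> carrier G" "b \<in> carrier G" "m \<in> carrier G" using ab \<alpha> U_carrier by (auto simp: m_def)
      have m: "m \<in> N" "\<psi> m = s" using ab by (auto simp: m_def)
      obtain d where d: "d \<in> carrier W" "d \<notin> \<beta>" using \<beta> cox.root_proper by auto
      \<comment> \<open>With \<open>y\<close> equal to the inverse of \<open>a\<close>, times
        \<open>m\<close>, times the inverse of \<open>b\<close>, conjugation is done factor by
        factor: \<open>inv b\<close> stays within positive roots other than \<alpha>,
        \<open>m\<close> permutes these, and \<open>inv a\<close> lies in
        \<open>Upos\<close>.\<close>
      have "inv b \<otimes> u \<otimes> inv (inv b) \<in> root_gen (\<lambda>\<gamma>. \<one>\<^bsub>W\<^esub> \<in> \<gamma> \<and> \<gamma> \<noteq> \<alpha>)"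
      proof (rule commutator_root_gen [OF \<alpha>(1) \<beta>(1) _ _ u \<alpha>(2) \<beta>(2) d(1)])
        show "\<alpha> \<noteq> \<beta>" "d \<notin> \<alpha>" "d \<notin> \<beta>" "\<one>\<^bsub>W\<^esub> \<in> \<beta> \<and> \<beta> \<noteq> \<alpha>" using \<beta> d True \<alpha>_def by auto
        show "inv b \<in> U \<alpha>" using ab \<alpha> U_inv by auto
      qed (use \<alpha> \<beta> in \<open>auto simp: cox.open_interval_def\<close>)
      then have "m \<otimes> (inv b \<otimes> u \<otimes> inv (inv b)) \<otimes> inv m \<in> Upos"
        unfolding Upos_def
        by (rule N_conj_root_gen [OF m(1), rotated])
          (use m s in \<open>auto simp: one_in_S_l_coset positive_root_S \<alpha>_def\<close>)
      moreover have "a \<in> Upos" using ab \<alpha> U_Upos by auto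
      ultimately have "inv a \<otimes> (m \<otimes> (inv b \<otimes> u \<otimes> inv (inv b)) \<otimes> inv m) \<otimes> a \<in> Upos" by simp
      moreover have "inv a \<otimes> (m \<otimes> (inv b \<otimes> u \<otimes> inv (inv b)) \<otimes> inv m) \<otimes> a = y \<otimes> u \<otimes> inv y"
        by (simp add: m_def group_normalize)
      ultimately show ?thesis by simp
    qed
  qed
qed

definition K :: "'w \<Rightarrow> 'g set" where
  "K s = {g \<in> Upos. \<forall>n \<in> N. \<psi> n = s \<longrightarrow> inv n \<otimes> g \<otimes> n \<in> Upos}"

lemma K_Upos: "g \<in> K s \<Longrightarrow> g \<in> Upos"
  by (simp add: K_def)

text \<open>One representative suffices: two of them differ by an element of \<open>T\<close>, which
  normalizes \<open>Upos\<close>.\<close>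

lemma K_I:
  assumes "g \<in> Upos" "n \<in> N" "\<psi> n = s" "inv n \<otimes> g \<otimes> n \<in> Upos"
  shows "g \<in> K s"
proof -
  have "inv m \<otimes> g \<otimes> m \<in> Upos" if "m \<in> N" "\<psi> m = s" for m
  proof -
    have "inv n \<otimes> m \<in> T" using assms that by (intro \<psi>_eq_T) auto
    then have "inv (inv n \<otimes> m) \<otimes> (inv n \<otimes> g \<otimes> n) \<otimes> (inv n \<otimes> m) \<in> Upos"
      using assms T_conj_Upos' by blast
    then show ?thesis using assms that by (simp add: group_normalize)
  qed
  then show ?thesis using assms by (simp add: K_def)
qed

lemma K_closed:
  assumes "s \<in> carrier W"
  shows "\<one> \<in> K s" "g \<in> K s \<Longrightarrow> h \<in> K s \<Longrightarrow> g \<otimes> h \<in> K s" "g \<in> K s \<Longrightarrow> inv g \<in> K s"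
proof -
  obtain n where n: "n \<in> N" "\<psi> n = s" using \<psi>_surj assms by auto
  show "\<one> \<in> K s" using n by (simp add: K_def)
  show "g \<otimes> h \<in> K s" if "g \<in> K s" "h \<in> K s"
  proof -
    have "(inv n \<otimes> g \<otimes> n) \<otimes> (inv n \<otimes> h \<otimes> n) \<in> Upos" using that n by (simp add: K_def)
    then show ?thesis using that n K_I [of "g \<otimes> h" n s] by (simp add: group_normalize K_Upos)
  qed
  show "inv g \<in> K s" if "g \<in> K s"
  proof -
    have "inv (inv n \<otimes> g \<otimes> n) \<in> Upos" using that n by (simp add: K_def)
    then show ?thesis using that n K_I [of "inv g" n s] by (simp add: group_normalize K_Upos)
  qed
qed

lemma K_conj:
  assumes "s \<in> S" "n \<in> N" "\<psi> n = s" "g \<in> K s"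
  shows "n \<otimes> g \<otimes> inv n \<in> K s" "inv n \<otimes> g \<otimes> n \<in> K s"
proof -
  have g: "g \<in> Upos" using assms K_Upos by auto
  have "\<psi> (inv n) = s" using assms by (simp add: \<psi>_inv cox.S_inv)
  then have 1: "inv (inv n) \<otimes> g \<otimes> inv n \<in> Upos" and 2: "inv n \<otimes> g \<otimes> n \<in> Upos"
    using assms unfolding K_def by auto
  show "n \<otimes> g \<otimes> inv n \<in> K s"
    using 1 g assms by (intro K_I [of _ n]) (auto simp: group_normalize)
  show "inv n \<otimes> g \<otimes> n \<in> K s"
    using 2 g assms \<open>\<psi> (inv n) = s\<close> by (intro K_I [of _ "inv n"]) (auto simp: group_normalize)
qed

lemma U_K:
  assumes "s \<in> S" "\<beta> \<in> cox.roots" "\<one>\<^bsub>W\<^esub> \<in> \<beta>" "\<beta> \<noteq> cox.simple_root s" "u \<in> U \<beta>"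
  shows "u \<in> K s"
proof -
  obtain n where n: "n \<in> N" "\<psi> n = s" using \<psi>_surj assms cox.S_carrier by blast
  have "inv n \<otimes> u \<otimes> n \<in> U (s <#\<^bsub>W\<^esub> \<beta>)" using U_conj' [of n \<beta> u] assms n by (simp add: cox.S_inv)
  moreover have "\<one>\<^bsub>W\<^esub> \<in> s <#\<^bsub>W\<^esub> \<beta>" using assms by (simp add: one_in_S_l_coset positive_root_S)
  ultimately show ?thesis
    using assms n cox.l_coset_in_roots cox.S_carrier by (intro K_I [of u n]) (blast intro: U_Upos)+
qed

text \<open>Transport by a representative of \<open>s\<close> sends \<open>x\<close> into the
  negative simple root group and \<beta> to another positive root different from the simple one, so
  that \<open>U_negative_conj\<close> applies.\<close>

lemma simple_conj_K:
  assumes "s \<in> S" "\<beta> \<in> cox.roots" "\<one>\<^bsub>W\<^esub> \<in> \<beta>" "\<beta> \<noteq> cox.simple_root s" "u \<in> U \<beta>" "x \<in> U (cox.simple_root s)"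
  shows "x \<otimes> u \<otimes> inv x \<in> K s"
proof -
  obtain n where n: "n \<in> N" "\<psi> n = s" using \<psi>_surj assms cox.S_carrier by blast
  have r: "cox.simple_root s \<in> cox.roots" using assms cox.simple_root_in_roots by auto
  have x: "x \<in> Upos" using assms r U_Upos cox.one_in_simple_root by blast
  have u: "u \<in> Upos" using assms U_Upos by blast
  have s\<beta>: "s <#\<^bsub>W\<^esub> \<beta> \<in> cox.roots" using assms cox.l_coset_in_roots cox.S_carrier by blast
  have "inv n \<otimes> u \<otimes> n \<in> U (s <#\<^bsub>W\<^esub> \<beta>)" using U_conj' [of n \<beta> u] assms n by (simp add: cox.S_inv)
  moreover have "inv n \<otimes> x \<otimes> n \<in> U (cox.neg (cox.simple_root s))"
    using U_conj' [of n _ x] assms n r by (metis cox.S_inv cox.S_l_coset_simple_root(1))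
  moreover have "\<one>\<^bsub>W\<^esub> \<in> s <#\<^bsub>W\<^esub> \<beta>" using assms by (simp add: one_in_S_l_coset positive_root_S)
  moreover have "s <#\<^bsub>W\<^esub> \<beta> \<noteq> cox.simple_root s"
    using one_in_S_l_coset [of "s <#\<^bsub>W\<^esub> \<beta>" s] assms s\<beta> cox.S_notin_simple_root
      cox.mem_l_coset [of s \<beta> s] by (auto simp: cox.S_carrier cox.S_inv cox.S_sq)
  ultimately have "(inv n \<otimes> x \<otimes> n) \<otimes> (inv n \<otimes> u \<otimes> n) \<otimes> inv (inv n \<otimes> x \<otimes> n) \<in> Upos"
    using U_negative_conj assms s\<beta> by blast
  then show ?thesis
    using x u n by (intro K_I [of _ n]) (auto simp: group_normalize)
qed

lemma Upos_decomp:
  assumes "s \<in> S" "g \<in> Upos"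
  obtains x k where "x \<in> U (cox.simple_root s)" "k \<in> K s" "g = x \<otimes> k"
proof -
  have sW: "s \<in> carrier W" using assms cox.S_carrier by auto
  have r: "cox.simple_root s \<in> cox.roots" using assms cox.simple_root_in_roots by auto
  define Y where "Y = {x \<otimes> k | x k. x \<in> U (cox.simple_root s) \<and> k \<in> K s}"
  have Yc: "Y \<subseteq> carrier G" using r U_carrier K_Upos by (auto simp: Y_def)
  have "\<one> \<in> Y" unfolding Y_def
    by (rule CollectI, intro exI [of _ \<one>]) (use r U_one K_closed sW in auto)
  have "g \<otimes> \<one> \<in> Y"
  proof (rule generate_left_closed [OF root_gen_base [of "\<lambda>\<gamma>. \<one>\<^bsub>W\<^esub> \<in> \<gamma>"] _ Yc _ _ \<open>\<one> \<in> Y\<close>])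
    show "g \<in> generate G (\<Union> (U ` {\<gamma> \<in> cox.roots. \<one>\<^bsub>W\<^esub> \<in> \<gamma>}))"
      using assms by (simp add: Upos_def root_gen_def)
    show "inv h \<in> \<Union> (U ` {\<gamma> \<in> cox.roots. \<one>\<^bsub>W\<^esub> \<in> \<gamma>})" if "h \<in> \<Union> (U ` {\<gamma> \<in> cox.roots. \<one>\<^bsub>W\<^esub> \<in> \<gamma>})" for h
      using that U_inv by auto
    fix h y assume "h \<in> \<Union> (U ` {\<gamma> \<in> cox.roots. \<one>\<^bsub>W\<^esub> \<in> \<gamma>})" and "y \<in> Y"
    then obtain \<gamma> x k where *: "\<gamma> \<in> cox.roots" "\<one>\<^bsub>W\<^esub> \<in> \<gamma>" "h \<in> U \<gamma>" "x \<in> U (cox.simple_root s)" "k \<in> K s" "y = x \<otimes> k"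
      by (auto simp: Y_def)
    then have [simp]: "h \<in> carrier G" "x \<in> carrier G" "k \<in> carrier G" using U_carrier r K_Upos by auto
    show "h \<otimes> y \<in> Y"
    proof (cases "\<gamma> = cox.simple_root s")
      case True
      then have "h \<otimes> x \<in> U (cox.simple_root s)" using * U_mult by auto
      then show ?thesis using * unfolding Y_def
        by (intro CollectI exI [of _ "h \<otimes> x"] exI [of _ k]) (auto simp: group_normalize)
    next
      case False
      then have "inv x \<otimes> h \<otimes> inv (inv x) \<in> K s"
        using * simple_conj_K [OF assms(1)] U_inv r by blast
      then have "inv x \<otimes> h \<otimes> inv (inv x) \<otimes> k \<in> K s" using * K_closed sW by blast
      then show ?thesis using * unfolding Y_def
        by (intro CollectI exI [of _ x] exI [of _ "inv x \<otimes> h \<otimes> inv (inv x) \<otimes> k"]) (auto simp: group_normalize)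
    qed
  qed
  then show thesis using that assms by (auto simp: Y_def)
qed

lemma B_decomp:
  assumes "s \<in> S" "b \<in> B"
  obtains x k t where "x \<in> U (cox.simple_root s)" "k \<in> K s" "t \<in> T" "b = x \<otimes> k \<otimes> t"
  using B_cases' [OF assms(2)] Upos_decomp [OF assms(1)] by metis

lemma B_decomp':
  assumes "s \<in> S" "b \<in> B"
  obtains x k t where "x \<in> U (cox.simple_root s)" "k \<in> K s" "t \<in> T" "b = t \<otimes> k \<otimes> x"
proof -
  obtain x k t where *: "x \<in> U (cox.simple_root s)" "k \<in> K s" "t \<in> T" "inv b = x \<otimes> k \<otimes> t"
    using B_decomp [of s "inv b"] assms by auto
  have r: "cox.simple_root s \<in> cox.roots" using assms cox.simple_root_in_roots by auto
  have [simp]: "x \<in> carrier G" "k \<in> carrier G" "t \<in> carrier G" using * U_carrier r K_Upos by auto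
  have "b = inv (x \<otimes> k \<otimes> t)" using *(4) assms by (metis B_carrier inv_inv)
  then have "b = inv t \<otimes> inv k \<otimes> inv x" by (simp add: group_normalize)
  then show thesis using that * U_inv r K_closed assms cox.S_carrier by (metis T_closed(3))
qed

section \<open>Double cosets of B and their products\<close>

definition cell :: "'w \<Rightarrow> 'g set" where
  "cell w = {b \<otimes> n \<otimes> b' | b n b'. b \<in> B \<and> n \<in> N \<and> b' \<in> B \<and> \<psi> n = w}"

lemma cellI: "b \<in> B \<Longrightarrow> n \<in> N \<Longrightarrow> b' \<in> B \<Longrightarrow> \<psi> n = w \<Longrightarrow> b \<otimes> n \<otimes> b' \<in> cell w"
  unfolding cell_def by blast

lemma cellE:
  assumes "g \<in> cell w"
  obtains b n b' where "b \<in> B" "n \<in> N" "b' \<in> B" "\<psi> n = w" "g = b \<otimes> n \<otimes> b'"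
  using assms unfolding cell_def by blast

lemma cell_carrier: "g \<in> cell w \<Longrightarrow> g \<in> carrier G"
  by (elim cellE) simp

lemma N_cell: "n \<in> N \<Longrightarrow> \<psi> n = w \<Longrightarrow> n \<in> cell w"
  using cellI [of \<one> n \<one> w] by simp

lemma cell_one: "cell \<one>\<^bsub>W\<^esub> = B"
proof
  show "cell \<one>\<^bsub>W\<^esub> \<subseteq> B"
  proof
    fix g assume "g \<in> cell \<one>\<^bsub>W\<^esub>"
    then obtain b n b' where *: "b \<in> B" "n \<in> N" "b' \<in> B" "\<psi> n = \<one>\<^bsub>W\<^esub>" "g = b \<otimes> n \<otimes> b'" by (rule cellE)
    then have "n \<in> B" by (simp add: T_I)
    then show "g \<in> B" using * by simp
  qed
  show "B \<subseteq> cell \<one>\<^bsub>W\<^esub>" using cellI [of _ \<one> \<one> "\<one>\<^bsub>W\<^esub>"] by fastforce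
qed

lemma B_mult_cell:
  assumes "b \<in> B" "g \<in> cell w"
  shows "b \<otimes> g \<in> cell w"
proof -
  obtain c n c' where *: "c \<in> B" "n \<in> N" "c' \<in> B" "\<psi> n = w" "g = c \<otimes> n \<otimes> c'" using assms(2) by (rule cellE)
  then have "b \<otimes> g = (b \<otimes> c) \<otimes> n \<otimes> c'" using assms by (simp add: group_normalize)
  then show ?thesis using * assms cellI [of "b \<otimes> c"] by simp
qed

lemma cell_mult_B:
  assumes "b \<in> B" "g \<in> cell w"
  shows "g \<otimes> b \<in> cell w"
proof -
  obtain c n c' where *: "c \<in> B" "n \<in> N" "c' \<in> B" "\<psi> n = w" "g = c \<otimes> n \<otimes> c'" using assms(2) by (rule cellE)
  then have "g \<otimes> b = c \<otimes> n \<otimes> (c' \<otimes> b)" using assms by (simp add: group_normalize)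
  then show ?thesis using * assms cellI [of c n "c' \<otimes> b"] by simp
qed

lemma cell_inv:
  assumes "g \<in> cell w"
  shows "inv g \<in> cell (inv\<^bsub>W\<^esub> w)"
proof -
  obtain c n c' where *: "c \<in> B" "n \<in> N" "c' \<in> B" "\<psi> n = w" "g = c \<otimes> n \<otimes> c'" using assms by (rule cellE)
  then have "inv g = inv c' \<otimes> inv n \<otimes> inv c" by (simp add: group_normalize)
  then show ?thesis using * cellI [of "inv c'" "inv n" "inv c"] by (simp add: \<psi>_inv)
qed

lemma cell_eq_B_mult:
  assumes "g \<in> cell w" "n \<in> N" "\<psi> n = w"
  obtains b b' where "b \<in> B" "b' \<in> B" "g = b \<otimes> n \<otimes> b'"
proof -
  obtain c m c' where *: "c \<in> B" "m \<in> N" "c' \<in> B" "\<psi> m = w" "g = c \<otimes> m \<otimes> c'" using assms(1) by (rule cellE)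
  then have "m \<otimes> inv n \<in> T" using \<psi>_eq_T assms by auto
  then have "c \<otimes> (m \<otimes> inv n) \<in> B" using * by simp
  moreover have "g = (c \<otimes> (m \<otimes> inv n)) \<otimes> n \<otimes> c'" using * assms by (simp add: group_normalize)
  ultimately show thesis using that * by blast
qed

lemma \<psi>_S_sq: "n \<in> N \<Longrightarrow> n' \<in> N \<Longrightarrow> \<psi> n \<in> S \<Longrightarrow> \<psi> n' = \<psi> n \<Longrightarrow> n \<otimes> n' \<in> T"
  by (simp add: T_eq \<psi>_mult cox.S_sq)

text \<open>The factor between the two representatives splits as
  \<open>t \<otimes> k \<otimes> x\<close>. The parts \<open>t\<close> and \<open>k\<close> pass to
  the left through \<open>n\<close>; \<open>x\<close> passes to the right through \<open>m\<close>,
  because the length condition makes the translate of the simple root by the inverse of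
  \<open>w\<close> positive.\<close>

lemma cell_S_mult_less:
  assumes "s \<in> S" "w \<in> carrier W" "cox.len w < cox.len (s \<otimes>\<^bsub>W\<^esub> w)" "g \<in> cell s" "h \<in> cell w"
  shows "g \<otimes> h \<in> cell (s \<otimes>\<^bsub>W\<^esub> w)"
proof -
  obtain b1 n b2 where g: "b1 \<in> B" "n \<in> N" "b2 \<in> B" "\<psi> n = s" "g = b1 \<otimes> n \<otimes> b2" using assms(4) by (rule cellE)
  obtain b3 m b4 where h: "b3 \<in> B" "m \<in> N" "b4 \<in> B" "\<psi> m = w" "h = b3 \<otimes> m \<otimes> b4" using assms(5) by (rule cellE)
  have r: "cox.simple_root s \<in> cox.roots" using assms cox.simple_root_in_roots by auto
  obtain x k t where *: "x \<in> U (cox.simple_root s)" "k \<in> K s" "t \<in> T" "b2 \<otimes> b3 = t \<otimes> k \<otimes> x"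
    using B_decomp' [of s "b2 \<otimes> b3"] assms(1) g(3) h(1) by (metis B_mult)
  have [simp]: "x \<in> carrier G" "k \<in> carrier G" "t \<in> carrier G" using * U_carrier r K_Upos by auto
  have "inv m \<otimes> x \<otimes> m \<in> U (inv\<^bsub>W\<^esub> w <#\<^bsub>W\<^esub> cox.simple_root s)" using U_conj' h * r by blast
  moreover have "\<one>\<^bsub>W\<^esub> \<in> inv\<^bsub>W\<^esub> w <#\<^bsub>W\<^esub> cox.simple_root s"
    using assms r by (simp add: cox.mem_l_coset) (simp add: cox.simple_root_def)
  ultimately have 1: "inv m \<otimes> x \<otimes> m \<in> B"
    using U_Upos cox.l_coset_in_roots [of "inv\<^bsub>W\<^esub> w" "cox.simple_root s"] r assms by auto
  have 2: "n \<otimes> k \<otimes> inv n \<in> B" using K_conj [of s n k] K_Upos assms g * by auto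
  have 3: "n \<otimes> t \<otimes> inv n \<in> B" using T_conj g * by auto
  have "g \<otimes> h = b1 \<otimes> n \<otimes> (b2 \<otimes> b3) \<otimes> m \<otimes> b4" using g h by (simp add: group_normalize)
  also have "\<dots> = (b1 \<otimes> (n \<otimes> t \<otimes> inv n) \<otimes> (n \<otimes> k \<otimes> inv n)) \<otimes> (n \<otimes> m) \<otimes> ((inv m \<otimes> x \<otimes> m) \<otimes> b4)"
    using g h by (simp add: * group_normalize)
  finally show ?thesis
    using 1 2 3 g h cellI [of "b1 \<otimes> (n \<otimes> t \<otimes> inv n) \<otimes> (n \<otimes> k \<otimes> inv n)" "n \<otimes> m" "inv m \<otimes> x \<otimes> m \<otimes> b4"] by (simp add: \<psi>_mult)
qed

lemma cell_mult_S_less: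
  assumes "s \<in> S" "w \<in> carrier W" "cox.len w < cox.len (w \<otimes>\<^bsub>W\<^esub> s)" "g \<in> cell w" "h \<in> cell s"
  shows "g \<otimes> h \<in> cell (w \<otimes>\<^bsub>W\<^esub> s)"
proof -
  have [simp]: "s \<in> carrier W" using assms cox.S_carrier by auto
  have eq: "s \<otimes>\<^bsub>W\<^esub> inv\<^bsub>W\<^esub> w = inv\<^bsub>W\<^esub> (w \<otimes>\<^bsub>W\<^esub> s)" using assms by (simp add: cox.inv_mult_group cox.S_inv)
  have "inv h \<otimes> inv g \<in> cell (s \<otimes>\<^bsub>W\<^esub> inv\<^bsub>W\<^esub> w)"
    using assms cell_inv [of h s] cell_inv [of g w]
    by (intro cell_S_mult_less) (auto simp: eq cox.len_inv cox.S_inv)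
  then have "inv (inv h \<otimes> inv g) \<in> cell (w \<otimes>\<^bsub>W\<^esub> s)"
    using cell_inv [of "inv h \<otimes> inv g" "inv\<^bsub>W\<^esub> (w \<otimes>\<^bsub>W\<^esub> s)"] assms by (simp add: eq)
  then show ?thesis using assms cell_carrier by (simp add: inv_mult_group)
qed

lemma simple_nontrivial_cell:
  assumes "s \<in> S" "y \<in> U (cox.neg (cox.simple_root s))" "y \<noteq> \<one>"
  shows "y \<in> cell s"
proof -
  obtain a b where ab: "a \<in> U (cox.simple_root s)" "b \<in> U (cox.simple_root s)" "a \<otimes> y \<otimes> b \<in> N" "\<psi> (a \<otimes> y \<otimes> b) = s"
    using mu_neg assms by blast
  have r: "cox.simple_root s \<in> cox.roots" using assms cox.simple_root_in_roots by auto
  then have y: "y \<in> carrier G" using U_carrier cox.neg_in_roots assms by blast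
  have "a \<in> B" "b \<in> B" using ab r U_Upos assms cox.one_in_simple_root by (blast intro: Upos_B)+
  then have "inv a \<otimes> (a \<otimes> y \<otimes> b) \<otimes> inv b \<in> cell s" using ab by (intro cellI) auto
  then show ?thesis using y \<open>a \<in> B\<close> \<open>b \<in> B\<close> by (simp add: group_normalize)
qed

lemma cell_S_mult_S:
  assumes "s \<in> S" "g \<in> cell s" "h \<in> cell s"
  shows "g \<otimes> h \<in> B \<union> cell s"
proof -
  obtain b1 n b2 where g: "b1 \<in> B" "n \<in> N" "b2 \<in> B" "\<psi> n = s" "g = b1 \<otimes> n \<otimes> b2" using assms(2) by (rule cellE)
  obtain b3 m b4 where h: "b3 \<in> B" "m \<in> N" "b4 \<in> B" "\<psi> m = s" "h = b3 \<otimes> m \<otimes> b4" using assms(3) by (rule cellE)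
  have r: "cox.simple_root s \<in> cox.roots" using assms cox.simple_root_in_roots by auto
  obtain x k t where *: "x \<in> U (cox.simple_root s)" "k \<in> K s" "t \<in> T" "b2 \<otimes> b3 = t \<otimes> k \<otimes> x"
    using B_decomp' [of s "b2 \<otimes> b3"] assms(1) g(3) h(1) by (metis B_mult)
  have [simp]: "x \<in> carrier G" "k \<in> carrier G" "t \<in> carrier G" using * U_carrier r K_Upos by auto
  have 2: "n \<otimes> k \<otimes> inv n \<in> B" using K_conj [of s n k] K_Upos assms g * by auto
  have 3: "n \<otimes> t \<otimes> inv n \<in> B" using T_conj g * by auto
  have 4: "n \<otimes> m \<in> B" using g h \<psi>_S_sq assms by auto
  \<comment> \<open>All factors but \<open>x\<close> are absorbed into \<open>B\<close>. Conjugated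
    by \<open>n\<close>, it lands in the negative simple root group, whose nontrivial elements
    belong to \<open>cell s\<close>.\<close>
  define y where "y = n \<otimes> x \<otimes> inv n"
  have y: "y \<in> U (cox.neg (cox.simple_root s))"
    using U_conj [of n _ x] g r * assms cox.S_l_coset_simple_root(1) unfolding y_def by metis
  then have "y \<in> B \<union> cell s" using simple_nontrivial_cell assms by (cases "y = \<one>") auto
  then have "(b1 \<otimes> (n \<otimes> t \<otimes> inv n) \<otimes> (n \<otimes> k \<otimes> inv n)) \<otimes> y \<otimes> ((n \<otimes> m) \<otimes> b4) \<in> B \<union> cell s"
    using 2 3 4 g(1) h(3) B_mult_cell cell_mult_B by (metis B_mult Un_iff)
  moreover have "g \<otimes> h = b1 \<otimes> n \<otimes> (b2 \<otimes> b3) \<otimes> m \<otimes> b4" using g h by (simp add: group_normalize)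
  then have "g \<otimes> h = (b1 \<otimes> (n \<otimes> t \<otimes> inv n) \<otimes> (n \<otimes> k \<otimes> inv n)) \<otimes> y \<otimes> ((n \<otimes> m) \<otimes> b4)"
    using g h unfolding * y_def by (simp add: group_normalize)
  ultimately show ?thesis by simp
qed

lemma cell_S_mult:
  assumes "s \<in> S" "w \<in> carrier W" "g \<in> cell s" "h \<in> cell w"
  shows "g \<otimes> h \<in> cell (s \<otimes>\<^bsub>W\<^esub> w) \<union> cell w"
proof (cases "cox.len w < cox.len (s \<otimes>\<^bsub>W\<^esub> w)")
  case True
  then show ?thesis using cell_S_mult_less assms by blast
next
  case False
  have [simp]: "s \<in> carrier W" using assms cox.S_carrier by auto
  define v where "v = s \<otimes>\<^bsub>W\<^esub> w"
  have v: "v \<in> carrier W" "s \<otimes>\<^bsub>W\<^esub> v = w" using assms by (auto simp: v_def cox.S_mult_S_mult)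
  have less: "cox.len v < cox.len (s \<otimes>\<^bsub>W\<^esub> v)" using False cox.len_S_mult_cases [of w s] assms v by (auto simp: v_def)
  obtain m where m: "m \<in> N" "\<psi> m = s" using \<psi>_surj [of s] by auto
  obtain n where n: "n \<in> N" "\<psi> n = v" using \<psi>_surj [of v] v by auto
  have "m \<otimes> n \<in> N" "\<psi> (m \<otimes> n) = w" using m n v by (auto simp: \<psi>_mult)
  then obtain b b' where b: "b \<in> B" "b' \<in> B" "h = b \<otimes> (m \<otimes> n) \<otimes> b'" using cell_eq_B_mult [OF assms(4)] by metis
  have gc: "g \<in> carrier G" using assms cell_carrier by auto
  have "g \<otimes> b \<otimes> m \<in> B \<union> cell s"
    using cell_S_mult_S [OF assms(1), of "g \<otimes> b" m] cell_mult_B assms b m N_cell by blast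
  then have "g \<otimes> b \<otimes> m \<otimes> n \<in> cell v \<union> cell w"
    using B_mult_cell N_cell n cell_S_mult_less [OF assms(1) v(1) less, of "g \<otimes> b \<otimes> m" n] v by auto
  then have "g \<otimes> b \<otimes> m \<otimes> n \<otimes> b' \<in> cell v \<union> cell w" using cell_mult_B b by auto
  moreover have "g \<otimes> b \<otimes> m \<otimes> n \<otimes> b' = g \<otimes> h" using gc b m n by (simp add: group_normalize)
  ultimately show ?thesis by (simp add: v_def)
qed

lemma N_mult_cells:
  assumes "n \<in> N" "g \<in> \<Union> (cell ` carrier W)"
  shows "n \<otimes> g \<in> \<Union> (cell ` carrier W)"
proof -
  have "n \<in> N \<Longrightarrow> \<psi> n = word_prod W us \<Longrightarrow> us \<in> lists S \<Longrightarrow> n \<otimes> g \<in> \<Union> (cell ` carrier W)" for us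
  proof (induction us arbitrary: n)
    case Nil
    then have "n \<in> B" by (simp add: T_I)
    then show ?case using assms(2) B_mult_cell by auto
  next
    case (Cons s us)
    then have s: "s \<in> S" "us \<in> lists S" and [simp]: "s \<in> carrier W" "word_prod W us \<in> carrier W"
      by (auto simp: cox.S_carrier)
    obtain m where m: "m \<in> N" "\<psi> m = s" using \<psi>_surj [of s] by auto
    have "\<psi> (inv m \<otimes> n) = word_prod W us"
      using m Cons s by (simp add: \<psi>_mult \<psi>_inv cox.S_inv cox.S_mult_S_mult)
    then have "inv m \<otimes> n \<otimes> g \<in> \<Union> (cell ` carrier W)" using Cons m s by simp
    then obtain w where w: "w \<in> carrier W" "inv m \<otimes> n \<otimes> g \<in> cell w" by auto
    then have "m \<otimes> (inv m \<otimes> n \<otimes> g) \<in> cell (s \<otimes>\<^bsub>W\<^esub> w) \<union> cell w"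
      using cell_S_mult [OF s(1) w(1) N_cell [OF m]] by blast
    moreover have "m \<otimes> (inv m \<otimes> n \<otimes> g) = n \<otimes> g"
      using m Cons(2) assms(2) cell_carrier by (auto simp: group_normalize)
    ultimately show ?case using w cox.m_closed [of s w] by auto
  qed
  moreover obtain us where "us \<in> lists S" "word_prod W us = \<psi> n" using cox.ex_word [OF \<psi>_closed] assms(1) by metis
  ultimately show ?thesis using assms(1) by metis
qed

lemma carrier_cells:
  assumes "g \<in> carrier G"
  obtains w where "w \<in> carrier W" "g \<in> cell w"
proof -
  have "g \<otimes> \<one> \<in> \<Union> (cell ` carrier W)"
  proof (rule generate_left_closed [of "N \<union> (\<Union>\<alpha> \<in> cox.roots. U \<alpha>)"])
    show "N \<union> \<Union> (U ` cox.roots) \<subseteq> carrier G" using U_carrier by auto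
    show "inv h \<in> N \<union> \<Union> (U ` cox.roots)" if "h \<in> N \<union> \<Union> (U ` cox.roots)" for h
      using that U_inv by auto
    show "\<Union> (cell ` carrier W) \<subseteq> carrier G" using cell_carrier by auto
    show "g \<in> generate G (N \<union> \<Union> (U ` cox.roots))" using generated assms by auto
    show "\<one> \<in> \<Union> (cell ` carrier W)" using cell_one B_one by blast
    fix h x assume h: "h \<in> N \<union> \<Union> (U ` cox.roots)" and x: "x \<in> \<Union> (cell ` carrier W)"
    then have xc: "x \<in> carrier G" using cell_carrier by auto
    show "h \<otimes> x \<in> \<Union> (cell ` carrier W)"
    proof (cases "h \<in> N")
      case True
      then show ?thesis using N_mult_cells x by auto
    next
      case False
      then obtain \<alpha> where \<alpha>: "\<alpha> \<in> cox.roots" "h \<in> U \<alpha>" using h by auto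
      then obtain w s where ws: "w \<in> carrier W" "s \<in> S" "\<alpha> = w <#\<^bsub>W\<^esub> cox.simple_root s"
        by (auto simp: cox.roots_def)
      obtain n where n: "n \<in> N" "\<psi> n = w" using \<psi>_surj ws by auto
      have hc: "h \<in> carrier G" using \<alpha> U_carrier by auto
      have r: "cox.simple_root s \<in> cox.roots" using ws cox.simple_root_in_roots by auto
      \<comment> \<open>Each root group is conjugate under \<open>N\<close> to a simple one, which
        lies in \<open>B\<close>; left multiplication by it reduces to the action of
        \<open>N\<close> and \<open>B\<close>.\<close>
      have "inv n \<otimes> h \<otimes> n \<in> U (cox.simple_root s)"
        using U_conj' [OF n(1) \<alpha>] n ws r by (simp add: cox.l_coset_inv_cancel)
      then have "inv n \<otimes> h \<otimes> n \<in> B" using U_Upos [OF r] cox.one_in_simple_root ws(2) Upos_B by blast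
      then have "n \<otimes> ((inv n \<otimes> h \<otimes> n) \<otimes> (inv n \<otimes> x)) \<in> \<Union> (cell ` carrier W)"
        using N_mult_cells [of "inv n" x] N_mult_cells [of n "(inv n \<otimes> h \<otimes> n) \<otimes> (inv n \<otimes> x)"] n x B_mult_cell by fastforce
      moreover have "n \<otimes> ((inv n \<otimes> h \<otimes> n) \<otimes> (inv n \<otimes> x)) = h \<otimes> x"
        using n hc xc by (simp add: group_normalize)
      ultimately show ?thesis by simp
    qed
  qed
  then show thesis using that assms by auto
qed

section \<open>Minimal parabolic subgroups and panels\<close>

definition para :: "'w \<Rightarrow> 'g set" where
  "para s = B \<union> cell s"

lemma para_carrier: "g \<in> para s \<Longrightarrow> g \<in> carrier G"
  using cell_carrier by (auto simp: para_def)

lemma para_inv: "s \<in> S \<Longrightarrow> g \<in> para s \<Longrightarrow> inv g \<in> para s"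
  using cell_inv [of g s] by (auto simp: para_def cox.S_inv)

lemma para_mult: "s \<in> S \<Longrightarrow> g \<in> para s \<Longrightarrow> h \<in> para s \<Longrightarrow> g \<otimes> h \<in> para s"
  using cell_S_mult_S B_mult_cell cell_mult_B by (auto simp: para_def)

lemma B_para: "b \<in> B \<Longrightarrow> b \<in> para s"
  by (simp add: para_def)

lemma N_para: "n \<in> N \<Longrightarrow> \<psi> n = s \<Longrightarrow> n \<in> para s"
  by (simp add: para_def N_cell)

lemma cell_S_decomp:
  assumes "s \<in> S" "g \<in> cell s" "n \<in> N" "\<psi> n = s"
  obtains x b where "x \<in> U (cox.simple_root s)" "b \<in> B" "g = x \<otimes> n \<otimes> b"
proof -
  obtain b1 b2 where b: "b1 \<in> B" "b2 \<in> B" "g = b1 \<otimes> n \<otimes> b2" using cell_eq_B_mult assms by metis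
  have r: "cox.simple_root s \<in> cox.roots" using assms cox.simple_root_in_roots by auto
  obtain x k t where *: "x \<in> U (cox.simple_root s)" "k \<in> K s" "t \<in> T" "b1 = x \<otimes> k \<otimes> t"
    using B_decomp [OF assms(1) b(1)] by metis
  have [simp]: "x \<in> carrier G" "k \<in> carrier G" "t \<in> carrier G" using * U_carrier r K_Upos by auto
  have "inv n \<otimes> k \<otimes> n \<in> B" using K_conj [of s n k] K_Upos assms * by auto
  moreover have "inv n \<otimes> t \<otimes> n \<in> B" using T_conj' assms * by auto
  ultimately have "(inv n \<otimes> k \<otimes> n) \<otimes> (inv n \<otimes> t \<otimes> n) \<otimes> b2 \<in> B" using b by simp
  moreover have "g = x \<otimes> n \<otimes> ((inv n \<otimes> k \<otimes> n) \<otimes> (inv n \<otimes> t \<otimes> n) \<otimes> b2)"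
    using b assms by (simp add: * group_normalize)
  ultimately show thesis using that * by blast
qed

text \<open>The panel of \<open>B\<close> parametrized from its other end: translating by
  \<open>n\<close> exchanges \<open>cell_S_decomp\<close>, which singles out \<open>B\<close>, with
  a version that singles out \<open>n B\<close> and uses the negative root group.\<close>

lemma para_decomp:
  assumes "s \<in> S" "g \<in> para s" "n \<in> N" "\<psi> n = s"
  obtains (upper) b where "b \<in> B" "g = n \<otimes> b"
  | (lower) y b where "y \<in> U (cox.neg (cox.simple_root s))" "b \<in> B" "g = y \<otimes> b"
proof -
  have r: "cox.simple_root s \<in> cox.roots" using assms cox.simple_root_in_roots by auto
  have gc: "g \<in> carrier G" using para_carrier assms by auto
  have "inv n \<otimes> g \<in> para s" using assms para_mult para_inv N_para by auto
  then consider "inv n \<otimes> g \<in> B" | "inv n \<otimes> g \<in> cell s" by (auto simp: para_def)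
  then show thesis
  proof cases
    case 1
    then show thesis using upper [of "inv n \<otimes> g"] assms gc by (simp add: group_normalize)
  next
    case 2
    then obtain x b where xb: "x \<in> U (cox.simple_root s)" "b \<in> B" "inv n \<otimes> g = x \<otimes> n \<otimes> b"
      using cell_S_decomp assms by metis
    then have xc: "x \<in> carrier G" using U_carrier r by auto
    have "n \<otimes> x \<otimes> inv n \<in> U (cox.neg (cox.simple_root s))"
      using U_conj [of n _ x] assms r xb by (metis cox.S_l_coset_simple_root(1))
    moreover have "(n \<otimes> n) \<otimes> b \<in> B" using \<psi>_S_sq [of n n] assms xb by auto
    moreover have "g = n \<otimes> (inv n \<otimes> g)" using assms gc by (simp add: group_normalize)
    then have "g = (n \<otimes> x \<otimes> inv n) \<otimes> ((n \<otimes> n) \<otimes> b)"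
      using xb assms xc by (simp add: group_normalize)
    ultimately show thesis using lower by blast
  qed
qed

text \<open>Only walls separating the chambers \<open>c\<close> and \<open>d\<close> occur.
  \<open>Usep w 1\<close> is the generated version of the intersection of the negative unipotent
  group with the \<open>w\<close>-conjugate of the positive one.\<close>

definition Usep :: "'w \<Rightarrow> 'w \<Rightarrow> 'g set" where
  "Usep c d = root_gen (\<lambda>\<gamma>. c \<in> \<gamma> \<and> d \<notin> \<gamma>)"

lemma Usep_carrier [simp]: "g \<in> Usep c d \<Longrightarrow> g \<in> carrier G"
  unfolding Usep_def by (rule root_gen_carrier)

lemma Usep_closed [simp]:
  "\<one> \<in> Usep c d" "g \<in> Usep c d \<Longrightarrow> h \<in> Usep c d \<Longrightarrow> g \<otimes> h \<in> Usep c d" "g \<in> Usep c d \<Longrightarrow> inv g \<in> Usep c d"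
  unfolding Usep_def by (auto simp: root_gen_closed)

lemma Usep_trivial: "Usep c c = {\<one>}"
proof -
  have "Usep c c \<subseteq> {\<one>}"
    unfolding Usep_def by (rule root_gen_subset) (auto intro: triv_subgroup)
  then show ?thesis using Usep_closed(1) by blast
qed

lemma Usep_conj:
  assumes "n \<in> N" "c \<in> carrier W" "d \<in> carrier W" "g \<in> Usep c d"
  shows "n \<otimes> g \<otimes> inv n \<in> Usep (\<psi> n \<otimes>\<^bsub>W\<^esub> c) (\<psi> n \<otimes>\<^bsub>W\<^esub> d)"
  unfolding Usep_def
  by (rule N_conj_root_gen [OF assms(1) _ assms(4) [unfolded Usep_def]])
    (use assms \<psi>_closed in \<open>auto simp: cox.mem_l_coset\<close>)

lemma Usep_conj':
  assumes "n \<in> N" "c \<in> carrier W" "d \<in> carrier W" "g \<in> Usep (\<psi> n \<otimes>\<^bsub>W\<^esub> c) (\<psi> n \<otimes>\<^bsub>W\<^esub> d)"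
  shows "inv n \<otimes> g \<otimes> n \<in> Usep c d"
  using Usep_conj [of "inv n" "\<psi> n \<otimes>\<^bsub>W\<^esub> c" "\<psi> n \<otimes>\<^bsub>W\<^esub> d" g] assms \<psi>_closed
  by (simp add: \<psi>_inv)

lemma Usep_Upos: "Usep \<one>\<^bsub>W\<^esub> d \<subseteq> Upos"
  unfolding Usep_def Upos_def by (rule root_gen_mono) auto

lemma Usep_B: "g \<in> Usep \<one>\<^bsub>W\<^esub> d \<Longrightarrow> g \<in> B"
  using Usep_Upos by (blast intro: Upos_B)

lemma U_Usep: "\<gamma> \<in> cox.roots \<Longrightarrow> c \<in> \<gamma> \<Longrightarrow> d \<notin> \<gamma> \<Longrightarrow> u \<in> U \<gamma> \<Longrightarrow> u \<in> Usep c d"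
  unfolding Usep_def by (rule U_root_gen) auto

lemma Usep_Uneg: "Usep c \<one>\<^bsub>W\<^esub> \<subseteq> Uneg"
  unfolding Usep_def Uneg_def by (rule root_gen_mono) auto

text \<open>Crossing the first wall of a gallery from \<open>c\<close> towards \<open>d\<close>
  removes exactly one root. Its root group normalizes the rest, since every root in the relevant
  open intervals still contains \<open>c\<close>, avoids \<open>d\<close> and differs from the
  removed root.\<close>

lemma Usep_step:
  assumes "c \<in> carrier W" "s \<in> S" "d \<in> carrier W" "d \<notin> c <#\<^bsub>W\<^esub> cox.simple_root s" "g \<in> Usep c d"
  obtains y z where "y \<in> U (c <#\<^bsub>W\<^esub> cox.simple_root s)" "z \<in> Usep (c \<otimes>\<^bsub>W\<^esub> s) d" "g = z \<otimes> y"
proof -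
  define \<alpha> where "\<alpha> = c <#\<^bsub>W\<^esub> cox.simple_root s"
  have [simp]: "s \<in> carrier W" using assms cox.S_carrier by auto
  have r: "cox.simple_root s \<in> cox.roots" and \<alpha>r: "\<alpha> \<in> cox.roots"
    using assms cox.simple_root_in_roots cox.l_coset_in_roots by (auto simp: \<alpha>_def)
  have c\<alpha>: "c \<in> \<alpha>" "c \<otimes>\<^bsub>W\<^esub> s \<notin> \<alpha>"
    using assms r by (auto simp: \<alpha>_def cox.mem_l_coset cox.one_in_simple_root cox.S_notin_simple_root)
  have sep: "\<gamma> \<noteq> \<alpha> \<and> c \<in> \<gamma>" if "\<gamma> \<in> cox.roots" "c \<otimes>\<^bsub>W\<^esub> s \<in> \<gamma>" "d \<notin> \<gamma>" for \<gamma>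
  proof (intro conjI notI)
    show "\<gamma> = \<alpha> \<Longrightarrow> False" using that c\<alpha> by simp
    show "c \<in> \<gamma>"
    proof (rule ccontr)
      assume "c \<notin> \<gamma>"
      then have "\<gamma> = (c \<otimes>\<^bsub>W\<^esub> s) <#\<^bsub>W\<^esub> cox.simple_root s"
        using that assms cox.root_separating [of \<gamma> s "c \<otimes>\<^bsub>W\<^esub> s"] by auto
      also have "\<dots> = c <#\<^bsub>W\<^esub> (s <#\<^bsub>W\<^esub> cox.simple_root s)"
        using assms r by (simp add: cox.l_coset_comp)
      also have "\<dots> = cox.neg \<alpha>"
        using assms r by (simp add: cox.S_l_coset_simple_root cox.l_coset_neg \<alpha>_def)
      finally show False using that assms by (simp add: cox.neg_def \<alpha>_def)
    qed
  qed
  have sep': "\<gamma> = \<alpha> \<or> c \<otimes>\<^bsub>W\<^esub> s \<in> \<gamma>" if "\<gamma> \<in> cox.roots" "c \<in> \<gamma>" for \<gamma>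
    using cox.root_separating [OF that(1) assms(2) that(2)] by (auto simp: \<alpha>_def)
  have normal: "y \<otimes> z \<otimes> inv y \<in> Usep (c \<otimes>\<^bsub>W\<^esub> s) d" if y: "y \<in> U \<alpha>" and z: "z \<in> Usep (c \<otimes>\<^bsub>W\<^esub> s) d" for y z
    unfolding Usep_def
  proof (rule conj_root_gen [OF _ root_gen_subgroup _ z [unfolded Usep_def]])
    show "y \<in> carrier G" using y \<alpha>r U_carrier by auto
    fix \<gamma> u assume \<gamma>: "\<gamma> \<in> cox.roots" "c \<otimes>\<^bsub>W\<^esub> s \<in> \<gamma> \<and> d \<notin> \<gamma>" "u \<in> U \<gamma>"
    show "y \<otimes> u \<otimes> inv y \<in> root_gen (\<lambda>\<gamma>. c \<otimes>\<^bsub>W\<^esub> s \<in> \<gamma> \<and> d \<notin> \<gamma>)"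
    proof (rule commutator_root_gen [OF \<alpha>r \<gamma>(1) _ y \<gamma>(3) c\<alpha>(1) _ assms(3)])
      show "\<alpha> \<noteq> \<gamma>" "c \<in> \<gamma>" using sep \<gamma> by auto
      show "d \<notin> \<alpha>" "d \<notin> \<gamma>" using assms \<gamma> by (auto simp: \<alpha>_def)
      show "c \<otimes>\<^bsub>W\<^esub> s \<in> \<gamma> \<and> d \<notin> \<gamma>" using \<gamma> by auto
      fix \<delta> assume "\<delta> \<in> cox.open_interval \<alpha> \<gamma>"
      then have "\<delta> \<in> cox.roots" "\<delta> \<noteq> \<alpha>" "c \<in> \<delta>" "d \<notin> \<delta>"
        using c\<alpha> \<gamma> sep assms by (auto simp: cox.open_interval_def cox.neg_def \<alpha>_def)
      then show "c \<otimes>\<^bsub>W\<^esub> s \<in> \<delta> \<and> d \<notin> \<delta>" using sep' by auto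
    qed
  qed
  define Y where "Y = {y \<otimes> z | y z. y \<in> U \<alpha> \<and> z \<in> Usep (c \<otimes>\<^bsub>W\<^esub> s) d}"
  have YI: "y \<otimes> z \<in> Y" if "y \<in> U \<alpha>" "z \<in> Usep (c \<otimes>\<^bsub>W\<^esub> s) d" for y z
    using that unfolding Y_def by blast
  have Yc: "Y \<subseteq> carrier G" using \<alpha>r U_carrier by (auto simp: Y_def)
  have one: "\<one> \<in> Y" using YI [of \<one> \<one>] U_one \<alpha>r by simp
  have "g \<otimes> \<one> \<in> Y"
  proof (rule generate_left_closed [OF root_gen_base [of "\<lambda>\<gamma>. c \<in> \<gamma> \<and> d \<notin> \<gamma>"] _ Yc _ _ one])
    show "g \<in> generate G (\<Union> (U ` {\<gamma> \<in> cox.roots. c \<in> \<gamma> \<and> d \<notin> \<gamma>}))"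
      using assms(5) by (simp add: Usep_def root_gen_def)
    show "inv h \<in> \<Union> (U ` {\<gamma> \<in> cox.roots. c \<in> \<gamma> \<and> d \<notin> \<gamma>})" if "h \<in> \<Union> (U ` {\<gamma> \<in> cox.roots. c \<in> \<gamma> \<and> d \<notin> \<gamma>})" for h
      using that U_inv by auto
    fix h x assume "h \<in> \<Union> (U ` {\<gamma> \<in> cox.roots. c \<in> \<gamma> \<and> d \<notin> \<gamma>})" and "x \<in> Y"
    then obtain \<gamma> y z where *: "\<gamma> \<in> cox.roots" "c \<in> \<gamma>" "d \<notin> \<gamma>" "h \<in> U \<gamma>" "y \<in> U \<alpha>" "z \<in> Usep (c \<otimes>\<^bsub>W\<^esub> s) d" "x = y \<otimes> z"
      by (auto simp: Y_def)
    then have [simp]: "h \<in> carrier G" "y \<in> carrier G" "z \<in> carrier G" using U_carrier \<alpha>r by auto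
    show "h \<otimes> x \<in> Y"
    proof (cases "\<gamma> = \<alpha>")
      case True
      then have "(h \<otimes> y) \<otimes> z \<in> Y" using * YI U_mult by auto
      then show ?thesis using * by (simp add: m_assoc)
    next
      case False
      then have "h \<in> Usep (c \<otimes>\<^bsub>W\<^esub> s) d" using * sep' unfolding Usep_def by (blast intro: U_root_gen)
      then have "inv y \<otimes> h \<otimes> inv (inv y) \<in> Usep (c \<otimes>\<^bsub>W\<^esub> s) d" using normal * U_inv \<alpha>r by blast
      then have "y \<otimes> (inv y \<otimes> h \<otimes> inv (inv y) \<otimes> z) \<in> Y" using * YI by simp
      then show ?thesis using * by (simp add: group_normalize)
    qed
  qed
  then obtain y z where *: "g = y \<otimes> z" "y \<in> U \<alpha>" "z \<in> Usep (c \<otimes>\<^bsub>W\<^esub> s) d" using assms by (auto simp: Y_def)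
  then have "g = (y \<otimes> z \<otimes> inv y) \<otimes> y" using U_carrier \<alpha>r by (auto simp: group_normalize)
  then show thesis using that normal * unfolding \<alpha>_def by blast
qed

lemma Upos_Usep_decomp:
  assumes "w \<in> carrier W" "n \<in> N" "\<psi> n = w" "g \<in> Upos"
  shows "\<exists>a z. a \<in> Upos \<and> inv n \<otimes> a \<otimes> n \<in> Upos \<and> z \<in> Usep \<one>\<^bsub>W\<^esub> w \<and> g = a \<otimes> z"
  using assms
proof (induction "cox.len w" arbitrary: w n g)
  case 0
  then have "w = \<one>\<^bsub>W\<^esub>" using cox.len_eq_0 by auto
  then have "n \<in> T" using 0 by (simp add: T_eq)
  then show ?case using 0 T_conj_Upos' by (intro exI [of _ g] exI [of _ \<one>]) auto
next
  case (Suc l)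
  then have "w \<noteq> \<one>\<^bsub>W\<^esub>" by auto
  then obtain s where s: "s \<in> S" "cox.len w = Suc (cox.len (s \<otimes>\<^bsub>W\<^esub> w))" using cox.ex_left_descent Suc by metis
  have sW [simp]: "s \<in> carrier W" using s cox.S_carrier by auto
  define v where "v = s \<otimes>\<^bsub>W\<^esub> w"
  have v: "v \<in> carrier W" "w = s \<otimes>\<^bsub>W\<^esub> v" "cox.len v < cox.len (s \<otimes>\<^bsub>W\<^esub> v)" using s Suc by (auto simp: v_def cox.S_mult_S_mult)
  have r: "cox.simple_root s \<in> cox.roots" using s cox.simple_root_in_roots by auto
  obtain m where m: "m \<in> N" "\<psi> m = s" using \<psi>_surj [of s] by auto
  define n' where "n' = inv m \<otimes> n"
  have n': "n' \<in> N" "\<psi> n' = v" "n = m \<otimes> n'"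
    using m Suc.prems(2,3) s(1) by (auto simp: n'_def \<psi>_mult \<psi>_inv cox.S_inv v_def group_normalize)
  \<comment> \<open>Splitting the inverse puts the simple root factor of \<open>g\<close> on the
    right, where it joins the \<open>Usep\<close> part of the result.\<close>
  have "inv g \<in> Upos" using Suc by simp
  then obtain x k where xk: "x \<in> U (cox.simple_root s)" "k \<in> K s" "inv g = x \<otimes> k"
    using Upos_decomp [OF s(1)] by metis
  have [simp]: "x \<in> carrier G" "k \<in> carrier G" "g \<in> carrier G" using xk U_carrier r K_Upos Suc by auto
  have g: "g = inv k \<otimes> inv x" using xk(3) by (metis \<open>g \<in> carrier G\<close> \<open>k \<in> carrier G\<close> \<open>x \<in> carrier G\<close> inv_inv inv_mult_group)
  have k': "inv m \<otimes> inv k \<otimes> m \<in> K s" using K_conj(2) [OF s(1) m] K_closed(3) xk sW by blast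
  have "l = cox.len v" using s(2) Suc.hyps(2) by (simp add: v_def)
  then obtain a z where az: "a \<in> Upos" "inv n' \<otimes> a \<otimes> n' \<in> Upos" "z \<in> Usep \<one>\<^bsub>W\<^esub> v" "inv m \<otimes> inv k \<otimes> m = a \<otimes> z"
    using Suc.hyps(1) [OF _ v(1) n'(1,2) K_Upos [OF k']] by blast
  have [simp]: "a \<in> carrier G" "z \<in> carrier G" using az by auto
  \<comment> \<open>Since \<open>v\<close> lies in the simple root of \<open>s\<close>, no root
    separating 1 from \<open>v\<close> is that simple root. So \<open>z\<close> stays in
    \<open>K s\<close>, hence \<open>a\<close> does as well and may be conjugated back by
    \<open>m\<close>.\<close>
  have "Usep \<one>\<^bsub>W\<^esub> v \<subseteq> K s"
    unfolding Usep_def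
  proof (rule root_gen_subset)
    show "subgroup (K s) G"
      using K_closed [OF sW] by (intro subgroupI) (auto dest: K_Upos)
    fix \<gamma> u assume \<gamma>: "\<gamma> \<in> cox.roots" "\<one>\<^bsub>W\<^esub> \<in> \<gamma> \<and> v \<notin> \<gamma>" "u \<in> U \<gamma>"
    moreover have "v \<in> cox.simple_root s" using v by (simp add: cox.simple_root_def)
    ultimately show "u \<in> K s" using U_K [OF s(1)] by blast
  qed
  then have zK: "z \<in> K s" using az by auto
  have "a = (inv m \<otimes> inv k \<otimes> m) \<otimes> inv z" using az m by (simp add: group_normalize)
  then have "a \<in> K s" using K_closed k' zK sW by metis
  then have 1: "m \<otimes> a \<otimes> inv m \<in> Upos" using K_conj(1) [OF s(1) m] K_Upos by auto
  have 2: "inv n \<otimes> (m \<otimes> a \<otimes> inv m) \<otimes> n \<in> Upos"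
    using az n' m by (simp add: group_normalize)
  have "m \<otimes> z \<otimes> inv m \<in> root_gen (\<lambda>\<gamma>. \<one>\<^bsub>W\<^esub> \<in> \<gamma> \<and> w \<notin> \<gamma>)"
  proof (rule N_conj_root_gen [OF m(1), of "\<lambda>\<gamma>. \<one>\<^bsub>W\<^esub> \<in> \<gamma> \<and> v \<notin> \<gamma>"])
    show "z \<in> root_gen (\<lambda>\<gamma>. \<one>\<^bsub>W\<^esub> \<in> \<gamma> \<and> v \<notin> \<gamma>)" using az by (simp add: Usep_def)
    fix \<gamma> assume \<gamma>: "\<gamma> \<in> cox.roots" "\<one>\<^bsub>W\<^esub> \<in> \<gamma> \<and> v \<notin> \<gamma>"
    moreover have "v \<in> cox.simple_root s" using v by (simp add: cox.simple_root_def)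
    ultimately have "s \<in> \<gamma>" using positive_root_S s by blast
    then show "\<one>\<^bsub>W\<^esub> \<in> \<psi> m <#\<^bsub>W\<^esub> \<gamma> \<and> w \<notin> \<psi> m <#\<^bsub>W\<^esub> \<gamma>"
      using \<gamma> m s v by (simp add: one_in_S_l_coset cox.mem_l_coset cox.S_inv cox.S_mult_S_mult)
  qed
  then have 3: "m \<otimes> z \<otimes> inv m \<in> Usep \<one>\<^bsub>W\<^esub> w" by (simp add: Usep_def)
  have "inv x \<in> Usep \<one>\<^bsub>W\<^esub> w"
    unfolding Usep_def
  proof (rule U_root_gen [OF r])
    show "\<one>\<^bsub>W\<^esub> \<in> cox.simple_root s \<and> w \<notin> cox.simple_root s"
    proof
      show "w \<notin> cox.simple_root s" using s by (simp add: cox.simple_root_def)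
    qed (use s cox.one_in_simple_root in blast)
    show "inv x \<in> U (cox.simple_root s)" using U_inv r xk by auto
  qed
  with 3 have "m \<otimes> z \<otimes> inv m \<otimes> inv x \<in> Usep \<one>\<^bsub>W\<^esub> w" by simp
  moreover have "inv k = m \<otimes> (inv m \<otimes> inv k \<otimes> m) \<otimes> inv m" using m by (simp add: group_normalize)
  then have "g = (m \<otimes> a \<otimes> inv m) \<otimes> (m \<otimes> z \<otimes> inv m \<otimes> inv x)"
    using m by (simp add: g az(4) group_normalize)
  ultimately show ?case using 1 2 by blast
qed

end

section \<open>The building as a union of cosets in the opposite unipotent group\<close>

locale rgd_bruhat = rgd_core W S G U T N \<psi>
  for W :: "('w, 'x) monoid_scheme" and S and G :: "('g, 'y) monoid_scheme" (structure) and U T N \<psi> +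
  assumes negative_not_in_Upos: "s \<in> S \<Longrightarrow> \<not> U (cox.neg (cox.simple_root s)) \<subseteq> Upos"
begin

section \<open>Uniqueness in the Bruhat decomposition of B\<close>

lemma B_conj_Upos:
  assumes "b \<in> B" "u \<in> Upos"
  shows "b \<otimes> u \<otimes> inv b \<in> Upos"
proof -
  obtain t v where *: "t \<in> T" "v \<in> Upos" "b = t \<otimes> v" using assms by (auto simp: B_def)
  have "t \<otimes> (v \<otimes> u \<otimes> inv v) \<otimes> inv t \<in> Upos" using * assms T_conj_Upos by simp
  then show ?thesis using * assms by (simp add: group_normalize)
qed

text \<open>For a left descent s of a nontrivial \<open>\<psi> n\<close>, conjugation by the inverse
  of \<open>n\<close> makes the negative simple root group positive. As \<open>n\<close> in
  \<open>B\<close> normalizes \<open>Upos\<close>, that root group would lie in \<open>Upos\<close>,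
  against (RGD3).\<close>

lemma N_inter_B:
  assumes "n \<in> N" "n \<in> B"
  shows "\<psi> n = \<one>\<^bsub>W\<^esub>"
proof (rule ccontr)
  assume "\<psi> n \<noteq> \<one>\<^bsub>W\<^esub>"
  moreover have W: "\<psi> n \<in> carrier W" using assms \<psi>_closed by auto
  ultimately obtain s where s: "s \<in> S" "cox.len (\<psi> n) = Suc (cox.len (s \<otimes>\<^bsub>W\<^esub> \<psi> n))"
    using cox.ex_left_descent by metis
  define \<alpha> where "\<alpha> = cox.neg (cox.simple_root s)"
  have r: "\<alpha> \<in> cox.roots" using s cox.neg_in_roots cox.simple_root_in_roots by (auto simp: \<alpha>_def)
  have pos: "\<one>\<^bsub>W\<^esub> \<in> inv\<^bsub>W\<^esub> \<psi> n <#\<^bsub>W\<^esub> \<alpha>"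
    using W s r by (simp add: cox.mem_l_coset) (simp add: \<alpha>_def cox.neg_def cox.simple_root_def)
  have "U \<alpha> \<subseteq> Upos"
  proof
    fix y assume y: "y \<in> U \<alpha>"
    then have "inv n \<otimes> y \<otimes> n \<in> Upos"
      using U_conj' [OF assms(1) r] pos U_Upos cox.l_coset_in_roots [of "inv\<^bsub>W\<^esub> \<psi> n" \<alpha>] r W by blast
    then have "n \<otimes> (inv n \<otimes> y \<otimes> n) \<otimes> inv n \<in> Upos" using B_conj_Upos assms by blast
    then show "y \<in> Upos" using y r U_carrier assms by (simp add: group_normalize)
  qed
  then show False using negative_not_in_Upos s by (auto simp: \<alpha>_def)
qed

text \<open>Multiply by a left descent s of \<open>\<psi> n\<close>; the new element lies in the
  cell of sw or of w, and induction identifies its image in both cases. The second case would make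
  \<open>w\<close> shorter than \<open>\<psi> n\<close>, against the length assumption.\<close>

lemma N_cell_unique:
  assumes "n \<in> N" "w \<in> carrier W" "n \<in> cell w" "cox.len (\<psi> n) \<le> cox.len w"
  shows "\<psi> n = w"
  using assms
proof (induction "cox.len (\<psi> n)" arbitrary: n w)
  case 0
  then have "\<psi> n = \<one>\<^bsub>W\<^esub>" using cox.len_eq_0 \<psi>_closed by metis
  then have "n \<in> B" using 0 by (simp add: T_I)
  obtain b m b' where *: "b \<in> B" "m \<in> N" "b' \<in> B" "\<psi> m = w" "n = b \<otimes> m \<otimes> b'" using 0 by (elim cellE)
  then have "m = inv b \<otimes> n \<otimes> inv b'" by (simp add: group_normalize)
  then have "m \<in> B" using *(1,3) \<open>n \<in> B\<close> by (metis B_mult B_inv)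
  then show ?case using N_inter_B * \<open>\<psi> n = _\<close> by auto
next
  case (Suc l)
  then have "\<psi> n \<noteq> \<one>\<^bsub>W\<^esub>" by auto
  moreover have W: "\<psi> n \<in> carrier W" using Suc \<psi>_closed by auto
  ultimately obtain s where s: "s \<in> S" "cox.len (\<psi> n) = Suc (cox.len (s \<otimes>\<^bsub>W\<^esub> \<psi> n))"
    using cox.ex_left_descent by metis
  have sW [simp]: "s \<in> carrier W" using s cox.S_carrier by auto
  obtain m where m: "m \<in> N" "\<psi> m = s" using \<psi>_surj [of s] by auto
  define n' where "n' = inv m \<otimes> n"
  have n': "n' \<in> N" "\<psi> n' = s \<otimes>\<^bsub>W\<^esub> \<psi> n"
    using m Suc.prems s by (auto simp: n'_def \<psi>_mult \<psi>_inv cox.S_inv)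
  have "inv m \<in> cell s" using m s by (intro N_cell) (auto simp: \<psi>_inv cox.S_inv)
  then have "n' \<in> cell (s \<otimes>\<^bsub>W\<^esub> w) \<union> cell w"
    unfolding n'_def using cell_S_mult s Suc.prems by blast
  then have "\<psi> n' = s \<otimes>\<^bsub>W\<^esub> w \<or> \<psi> n' = w"
  proof
    assume "n' \<in> cell (s \<otimes>\<^bsub>W\<^esub> w)"
    moreover have "cox.len (\<psi> n') \<le> cox.len (s \<otimes>\<^bsub>W\<^esub> w)"
      using cox.len_S_mult_cases [of w s] Suc.prems s n' by auto
    ultimately show ?thesis using Suc.hyps(1) [of n' "s \<otimes>\<^bsub>W\<^esub> w"] Suc.hyps(2) Suc.prems n' s by auto
  next
    assume "n' \<in> cell w"
    then show ?thesis using Suc.hyps(1) [of n' w] Suc.hyps(2) Suc.prems n' s by auto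
  qed
  then show ?case
  proof
    assume "\<psi> n' = s \<otimes>\<^bsub>W\<^esub> w"
    then have "s \<otimes>\<^bsub>W\<^esub> \<psi> n = s \<otimes>\<^bsub>W\<^esub> w" using n' by simp
    then show ?thesis using W Suc.prems by simp
  next
    assume "\<psi> n' = w"
    then show ?thesis using n' s Suc.prems by auto
  qed
qed

lemma cell_unique:
  assumes "v \<in> carrier W" "w \<in> carrier W" "g \<in> cell v" "g \<in> cell w"
  shows "v = w"
proof -
  have *: "v = w"
    if W: "v \<in> carrier W" "w \<in> carrier W" and g: "g \<in> cell v" "g \<in> cell w" and "cox.len v \<le> cox.len w" for v w
  proof -
    obtain b n b' where n: "b \<in> B" "n \<in> N" "b' \<in> B" "\<psi> n = v" "g = b \<otimes> n \<otimes> b'" using g(1) by (rule cellE)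
    then have "n = inv b \<otimes> g \<otimes> inv b'" by (simp add: group_normalize)
    then have "n \<in> cell w" using B_mult_cell cell_mult_B g(2) n(1,3) by (metis B_inv)
    then show ?thesis using N_cell_unique n that by blast
  qed
  show ?thesis using * [of v w] * [of w v] assms by (metis linear)
qed

lemma Usep_one_conj_B:
  assumes "n \<in> N" "\<psi> n = c" "c \<in> carrier W" "d \<in> carrier W" "g \<in> Usep c d"
  shows "inv n \<otimes> g \<otimes> n \<in> B"
proof -
  have "inv n \<otimes> g \<otimes> n \<in> Usep \<one>\<^bsub>W\<^esub> (inv\<^bsub>W\<^esub> c \<otimes>\<^bsub>W\<^esub> d)"
    using assms by (intro Usep_conj') auto
  then show ?thesis by (rule Usep_B)
qed

text \<open>\<open>Usep 1 w\<close> acts freely on the chamber \<open>w B\<close>. Split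
  \<open>a\<close> at the first wall: if the factor \<open>y\<close> at that wall were nontrivial,
  one element would lie both in the cell of sw and in that of w. Hence \<open>y\<close> is trivial
  and induction handles the rest.\<close>

lemma Usep_inter_conj_B:
  assumes "n \<in> N" "a \<in> Usep \<one>\<^bsub>W\<^esub> (\<psi> n)" "inv n \<otimes> a \<otimes> n \<in> B"
  shows "a = \<one>"
  using assms
proof (induction "cox.len (\<psi> n)" arbitrary: n a)
  case 0
  then have "\<psi> n = \<one>\<^bsub>W\<^esub>" using cox.len_eq_0 \<psi>_closed by metis
  then show ?case using 0 Usep_trivial by auto
next
  case (Suc l)
  then have "\<psi> n \<noteq> \<one>\<^bsub>W\<^esub>" by auto
  moreover have W: "\<psi> n \<in> carrier W" using Suc \<psi>_closed by auto
  ultimately obtain s where s: "s \<in> S" "cox.len (\<psi> n) = Suc (cox.len (s \<otimes>\<^bsub>W\<^esub> \<psi> n))"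
    using cox.ex_left_descent by metis
  have sW [simp]: "s \<in> carrier W" using s cox.S_carrier by auto
  have r: "cox.simple_root s \<in> cox.roots" using s cox.simple_root_in_roots by auto
  obtain m where m: "m \<in> N" "\<psi> m = s" using \<psi>_surj [of s] by auto
  define n' where "n' = inv m \<otimes> n"
  have n': "n' \<in> N" "\<psi> n' = s \<otimes>\<^bsub>W\<^esub> \<psi> n" and nn': "n = m \<otimes> n'"
    using m Suc.prems s by (auto simp: n'_def \<psi>_mult \<psi>_inv cox.S_inv group_normalize)
  have W': "\<psi> n' \<in> carrier W" and nW: "\<psi> n = s \<otimes>\<^bsub>W\<^esub> \<psi> n'"
    using n' W s by (auto simp: cox.S_mult_S_mult)
  have one: "\<one>\<^bsub>W\<^esub> <#\<^bsub>W\<^esub> cox.simple_root s = cox.simple_root s"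
    using r cox.root_subset cox.lcos_mult_one by auto
  have "\<psi> n \<notin> cox.simple_root s" using s by (simp add: cox.simple_root_def)
  then obtain y z where yz: "y \<in> U (cox.simple_root s)" "z \<in> Usep s (\<psi> n)" "a = z \<otimes> y"
    using Usep_step [of "\<one>\<^bsub>W\<^esub>" s "\<psi> n" a] s W Suc.prems one by auto
  have [simp]: "y \<in> carrier G" "z \<in> carrier G" using yz r U_carrier by auto
  define a' where "a' = inv m \<otimes> z \<otimes> m"
  define y' where "y' = inv m \<otimes> y \<otimes> m"
  have a': "a' \<in> Usep \<one>\<^bsub>W\<^esub> (\<psi> n')"
    unfolding a'_def using m yz W' nW by (intro Usep_conj') auto
  have a'c [simp]: "a' \<in> carrier G" and a'B: "a' \<in> B" using a' Usep_B by auto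
  have y': "y' \<in> U (cox.neg (cox.simple_root s))"
    using U_conj' [of m _ y] m yz(1) r s unfolding y'_def by (metis cox.S_inv cox.S_l_coset_simple_root(1))
  have [simp]: "y' \<in> carrier G" using m by (simp add: y'_def)
  have eq: "inv n \<otimes> a \<otimes> n = inv n' \<otimes> a' \<otimes> y' \<otimes> n'"
    using m n' by (simp add: nn' yz a'_def y'_def group_normalize)
  define b where "b = inv n' \<otimes> a' \<otimes> y' \<otimes> n'"
  have bB: "b \<in> B" using Suc.prems(3) eq by (simp add: b_def)
  have "y' = \<one>"
  proof (rule ccontr)
    assume "y' \<noteq> \<one>"
    then have "y' \<in> cell s" using simple_nontrivial_cell s y' by auto
    moreover have "cox.len (\<psi> n') < cox.len (s \<otimes>\<^bsub>W\<^esub> \<psi> n')"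
      using s(2) n'(2) unfolding nW [symmetric] by simp
    ultimately have 1: "y' \<otimes> n' \<in> cell (s \<otimes>\<^bsub>W\<^esub> \<psi> n')"
      using cell_S_mult_less [OF s(1) W' _ _ N_cell [OF n'(1) HOL.refl]] by blast
    have "y' \<otimes> n' = inv a' \<otimes> n' \<otimes> b" using n' by (simp add: b_def group_normalize)
    then have "y' \<otimes> n' \<in> cell (\<psi> n')" using cellI [of "inv a'" n' b] a'B bB n' by simp
    then have "\<psi> n' = s \<otimes>\<^bsub>W\<^esub> \<psi> n'" using 1 cell_unique W' by (metis sW cox.m_closed)
    then show False using s(2) nW n'(2) by (metis n_not_Suc_n)
  qed
  then have "inv n' \<otimes> a' \<otimes> n' \<in> B" using bB n' by (simp add: b_def)
  then have "a' = \<one>" using Suc.hyps(1) [of n' a'] Suc.hyps(2) n' s a' by auto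
  have "z = m \<otimes> a' \<otimes> inv m" "y = m \<otimes> y' \<otimes> inv m" using m by (simp_all add: a'_def y'_def group_normalize)
  then show ?case using yz m \<open>a' = \<one>\<close> \<open>y' = \<one>\<close> by simp
qed

text \<open>Iterating \<open>Usep_step\<close> along a minimal gallery from 1 through
  \<open>q\<close> collects the walls before \<open>q\<close> in one factor and those after
  \<open>q\<close> in the other.\<close>

lemma Usep_between_decomp:
  assumes "q \<in> carrier W" "r \<in> carrier W" "cox.between q r" "g \<in> Usep \<one>\<^bsub>W\<^esub> r"
  shows "\<exists>y z. y \<in> Usep \<one>\<^bsub>W\<^esub> q \<and> z \<in> Usep q r \<and> g = z \<otimes> y"
  using assms
proof (induction "cox.len q" arbitrary: q)
  case 0
  then have "q = \<one>\<^bsub>W\<^esub>" using cox.len_eq_0 by auto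
  then show ?case using 0 by (intro exI [of _ \<one>] exI [of _ g]) auto
next
  case (Suc l)
  then have "q \<noteq> \<one>\<^bsub>W\<^esub>" by auto
  then obtain s where s: "s \<in> S" "cox.len q = Suc (cox.len (q \<otimes>\<^bsub>W\<^esub> s))"
    using cox.ex_right_descent Suc by metis
  have sW [simp]: "s \<in> carrier W" using s cox.S_carrier by auto
  define p where "p = q \<otimes>\<^bsub>W\<^esub> s"
  have p: "p \<in> carrier W" "q = p \<otimes>\<^bsub>W\<^esub> s" "cox.len p < cox.len (p \<otimes>\<^bsub>W\<^esub> s)" using s Suc by (auto simp: p_def)
  define \<alpha> where "\<alpha> = p <#\<^bsub>W\<^esub> cox.simple_root s"
  have \<alpha>: "\<alpha> \<in> cox.roots" "\<one>\<^bsub>W\<^esub> \<in> \<alpha>" "q \<notin> \<alpha>"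
    using p s cox.l_coset_in_roots cox.simple_root_in_roots cox.one_mem_l_coset_simple_root
    by (auto simp: \<alpha>_def cox.mem_l_coset cox.S_notin_simple_root)
  have pq: "cox.between p q" using p s cox.between_S by auto
  have pr: "cox.between p r" using pq Suc.prems by (auto simp: cox.between_def)
  have r\<alpha>: "r \<notin> \<alpha>" using Suc.prems \<alpha> by (auto simp: cox.between_def)
  have "l = cox.len p" using s Suc.hyps(2) by (simp add: p_def)
  then obtain y z where yz: "y \<in> Usep \<one>\<^bsub>W\<^esub> p" "z \<in> Usep p r" "g = z \<otimes> y"
    using Suc.hyps(1) [of p] p pr Suc.prems by metis
  obtain y0 z0 where 0: "y0 \<in> U \<alpha>" "z0 \<in> Usep q r" "z = z0 \<otimes> y0"
    using Usep_step [of p s r z] p s r\<alpha> yz Suc.prems by (auto simp: \<alpha>_def)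
  have "Usep \<one>\<^bsub>W\<^esub> p \<subseteq> Usep \<one>\<^bsub>W\<^esub> q"
    unfolding Usep_def by (rule root_gen_mono) (use pq in \<open>auto simp: cox.between_def\<close>)
  moreover have "y0 \<in> Usep \<one>\<^bsub>W\<^esub> q" using U_Usep [OF \<alpha>] 0 by auto
  ultimately have "y0 \<otimes> y \<in> Usep \<one>\<^bsub>W\<^esub> q" using yz by auto
  moreover have "g = z0 \<otimes> (y0 \<otimes> y)" using yz 0 \<alpha> U_carrier by (simp add: m_assoc)
  ultimately show ?case using 0 by blast
qed

section \<open>The covering chamber system and its local structure\<close>

lemma Uneg_carrier [simp]: "x \<in> Uneg \<Longrightarrow> x \<in> carrier G"
  unfolding Uneg_def by (rule root_gen_carrier)

lemma Uneg_closed [simp]: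
  "\<one> \<in> Uneg" "g \<in> Uneg \<Longrightarrow> h \<in> Uneg \<Longrightarrow> g \<otimes> h \<in> Uneg" "g \<in> Uneg \<Longrightarrow> inv g \<in> Uneg"
  unfolding Uneg_def by (auto simp: root_gen_closed)

text \<open>
  A pair \<open>(x, w)\<close> with \<open>x \<in> U\<^sub>-\<close> stands for the coset \<open>x \<cdot> Usep w 1\<close> placed over the chamber
  \<open>x w B\<close>. These cosets form a chamber system, with the adjacency \<open>adj\<close>, which covers the building
  \<open>G/B\<close>; two pairs denote the same coset if they are related by \<open>equ\<close>.
\<close>

definition covers :: "'g \<Rightarrow> 'w \<Rightarrow> 'g \<Rightarrow> bool" where
  "covers x w g \<longleftrightarrow> x \<in> Uneg \<and> w \<in> carrier W \<and> g \<in> carrier G \<and> (\<exists>n \<in> N. \<psi> n = w \<and> inv (x \<otimes> n) \<otimes> g \<in> B)"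

definition equ :: "'g \<Rightarrow> 'w \<Rightarrow> 'g \<Rightarrow> 'w \<Rightarrow> bool" where
  "equ x w x' w' \<longleftrightarrow> w = w' \<and> inv x \<otimes> x' \<in> Usep w \<one>\<^bsub>W\<^esub>"

text \<open>The chamber farther from 1 in the panel of \<open>w\<close>. Its group
  \<open>Usep (upper s w) 1\<close> contains the groups attached to both chambers, so it serves as
  the group attached to the panel.\<close>

definition upper :: "'w \<Rightarrow> 'w \<Rightarrow> 'w" where
  "upper s w = (if cox.len w < cox.len (w \<otimes>\<^bsub>W\<^esub> s) then w \<otimes>\<^bsub>W\<^esub> s else w)"

definition adj :: "'w \<Rightarrow> 'g \<Rightarrow> 'w \<Rightarrow> 'g \<Rightarrow> 'w \<Rightarrow> bool" where
  "adj s x w x' w' \<longleftrightarrow> (w' = w \<or> w' = w \<otimes>\<^bsub>W\<^esub> s) \<and> inv x \<otimes> x' \<in> Usep (upper s w) \<one>\<^bsub>W\<^esub>"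

lemma coversD: "covers x w g \<Longrightarrow> x \<in> Uneg" "covers x w g \<Longrightarrow> w \<in> carrier W" "covers x w g \<Longrightarrow> g \<in> carrier G"
  by (auto simp: covers_def)

lemma covers_rep:
  assumes "covers x w g" "n \<in> N" "\<psi> n = w"
  shows "inv (x \<otimes> n) \<otimes> g \<in> B"
proof -
  obtain m where m: "m \<in> N" "\<psi> m = w" "inv (x \<otimes> m) \<otimes> g \<in> B" using assms by (auto simp: covers_def)
  then have "inv n \<otimes> m \<in> B" using \<psi>_eq_T [of n m] assms by simp
  then have "(inv n \<otimes> m) \<otimes> (inv (x \<otimes> m) \<otimes> g) \<in> B" using m by simp
  then show ?thesis using m assms coversD [OF assms(1)] by (simp add: group_normalize)
qed

lemma coversI: "x \<in> Uneg \<Longrightarrow> w \<in> carrier W \<Longrightarrow> n \<in> N \<Longrightarrow> \<psi> n = w \<Longrightarrow> b \<in> B \<Longrightarrow> g = x \<otimes> n \<otimes> b \<Longrightarrow> covers x w g"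
  unfolding covers_def by (auto simp: group_normalize)

lemma covers_cong:
  assumes "covers x w g" "h \<in> carrier G" "inv g \<otimes> h \<in> B"
  shows "covers x w h"
proof -
  obtain n where n: "n \<in> N" "\<psi> n = w" "inv (x \<otimes> n) \<otimes> g \<in> B" using assms by (auto simp: covers_def)
  then have "(inv (x \<otimes> n) \<otimes> g) \<otimes> (inv g \<otimes> h) \<in> B" using assms by simp
  then have "inv (x \<otimes> n) \<otimes> h \<in> B" using assms n coversD [OF assms(1)] by (simp add: group_normalize)
  then show ?thesis using assms n coversD [OF assms(1)] by (auto simp: covers_def)
qed

lemma between_negative:
  assumes "cox.between w v" "\<gamma> \<in> cox.roots" "w \<in> \<gamma>" "\<one>\<^bsub>W\<^esub> \<notin> \<gamma>" "v \<in> carrier W"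
  shows "v \<in> \<gamma>"
proof (rule ccontr)
  assume "v \<notin> \<gamma>"
  then have "\<one>\<^bsub>W\<^esub> \<in> cox.neg \<gamma>" "v \<in> cox.neg \<gamma>" using assms by (auto simp: cox.neg_def)
  then have "w \<in> cox.neg \<gamma>" using assms cox.neg_in_roots by (auto simp: cox.between_def)
  then show False using assms by (simp add: cox.neg_def)
qed

lemma Usep_between_mono:
  assumes "cox.between w v" "v \<in> carrier W"
  shows "Usep w \<one>\<^bsub>W\<^esub> \<subseteq> Usep v \<one>\<^bsub>W\<^esub>"
  unfolding Usep_def by (rule root_gen_mono) (use between_negative assms in auto)

lemma upper_carrier: "s \<in> S \<Longrightarrow> w \<in> carrier W \<Longrightarrow> upper s w \<in> carrier W"
  by (simp add: upper_def cox.S_carrier)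

lemma upper_cases: "upper s w = w \<or> upper s w = w \<otimes>\<^bsub>W\<^esub> s"
  by (simp add: upper_def)

lemma between_upper:
  assumes "s \<in> S" "w \<in> carrier W"
  shows "cox.between w (upper s w)" "cox.between (w \<otimes>\<^bsub>W\<^esub> s) (upper s w)"
proof -
  show "cox.between w (upper s w)"
    using assms cox.between_S cox.between_refl by (auto simp: upper_def)
  show "cox.between (w \<otimes>\<^bsub>W\<^esub> s) (upper s w)"
  proof (cases "cox.len w < cox.len (w \<otimes>\<^bsub>W\<^esub> s)")
    case True
    then show ?thesis using cox.between_refl by (simp add: upper_def)
  next
    case False
    then have "cox.len (w \<otimes>\<^bsub>W\<^esub> s) < cox.len (w \<otimes>\<^bsub>W\<^esub> s \<otimes>\<^bsub>W\<^esub> s)"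
      using assms cox.len_mult_S_cases [of w s] by simp
    then have "cox.between (w \<otimes>\<^bsub>W\<^esub> s) (w \<otimes>\<^bsub>W\<^esub> s \<otimes>\<^bsub>W\<^esub> s)"
      using assms by (intro cox.between_S) (auto simp: cox.S_carrier)
    then show ?thesis using False assms by (simp add: upper_def)
  qed
qed

lemma upper_mult_S:
  assumes "s \<in> S" "w \<in> carrier W"
  shows "upper s (w \<otimes>\<^bsub>W\<^esub> s) = upper s w"
proof (cases "cox.len w < cox.len (w \<otimes>\<^bsub>W\<^esub> s)")
  case True
  then show ?thesis using assms by (simp add: upper_def)
next
  case False
  then have "cox.len (w \<otimes>\<^bsub>W\<^esub> s) < cox.len w" using assms cox.len_mult_S_cases [of w s] by auto
  then show ?thesis using False assms by (simp add: upper_def)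
qed

lemma equ_sym: "x \<in> carrier G \<Longrightarrow> x' \<in> carrier G \<Longrightarrow> equ x w x' w' \<Longrightarrow> equ x' w' x w"
  unfolding equ_def using Usep_closed(3) [of "inv x \<otimes> x'"] by (auto simp: group_normalize)

lemma equ_trans:
  assumes "x \<in> carrier G" "x' \<in> carrier G" "x'' \<in> carrier G" "equ x w x' w'" "equ x' w' x'' w''"
  shows "equ x w x'' w''"
proof -
  have "(inv x \<otimes> x') \<otimes> (inv x' \<otimes> x'') \<in> Usep w \<one>\<^bsub>W\<^esub>"
    using assms by (intro Usep_closed(2) [of "inv x \<otimes> x'" _ _ "inv x' \<otimes> x''"]) (auto simp: equ_def)
  then show ?thesis using assms by (auto simp: equ_def group_normalize)
qed

lemma equ_adj: "s \<in> S \<Longrightarrow> w \<in> carrier W \<Longrightarrow> equ x w x' w' \<Longrightarrow> adj s x w x' w'"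
  using Usep_between_mono [OF between_upper(1)] upper_carrier by (auto simp: equ_def adj_def)

lemma adj_sym:
  assumes "s \<in> S" "w \<in> carrier W" "x \<in> carrier G" "x' \<in> carrier G" "adj s x w x' w'"
  shows "adj s x' w' x w"
proof -
  have "upper s w' = upper s w" "w = w' \<or> w = w' \<otimes>\<^bsub>W\<^esub> s" using assms upper_mult_S by (auto simp: adj_def)
  then show ?thesis
    using assms Usep_closed(3) [of "inv x \<otimes> x'"] by (auto simp: adj_def group_normalize)
qed

lemma adj_trans:
  assumes "s \<in> S" "w \<in> carrier W" "x \<in> carrier G" "x' \<in> carrier G" "x'' \<in> carrier G"
    and "adj s x w x' w'" "adj s x' w' x'' w''"
  shows "adj s x w x'' w''"
proof -
  have "upper s w' = upper s w" "w'' = w \<or> w'' = w \<otimes>\<^bsub>W\<^esub> s" using assms upper_mult_S by (auto simp: adj_def)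
  moreover from this have "(inv x \<otimes> x') \<otimes> (inv x' \<otimes> x'') \<in> Usep (upper s w) \<one>\<^bsub>W\<^esub>"
    using assms by (intro Usep_closed(2) [of "inv x \<otimes> x'" _ _ "inv x' \<otimes> x''"]) (auto simp: adj_def)
  ultimately show ?thesis using assms by (auto simp: adj_def group_normalize)
qed

text \<open>Seen from the chamber \<open>v\<close>, the difference of the two pairs becomes an
  element \<open>b\<close> of \<open>B\<close>, and uniqueness in the Bruhat decomposition forces
  equal types. Then \<open>b\<close> fixes the chamber of \<open>q\<close>; its factor beyond
  \<open>q\<close> fixes that chamber too, so the factor before \<open>q\<close> is trivial by
  \<open>Usep_inter_conj_B\<close>. With \<open>v\<close> on top of a panel this gives injectivity
  on panels, with \<open>v\<close> farthest in a rank 2 residue injectivity there.\<close>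

lemma local_injectivity:
  assumes "covers x w g" "covers x' w' g" "cox.between w v" "cox.between w' v" "v \<in> carrier W"
    and "inv x \<otimes> x' \<in> Usep v \<one>\<^bsub>W\<^esub>"
  shows "equ x w x' w'"
proof -
  have [simp]: "x \<in> carrier G" "x' \<in> carrier G" "g \<in> carrier G" and W [simp]: "w \<in> carrier W" "w' \<in> carrier W"
    using coversD assms by auto
  obtain m where m: "m \<in> N" "\<psi> m = v" using \<psi>_surj assms by auto
  obtain n where n: "n \<in> N" "\<psi> n = w" using \<psi>_surj [of w] by auto
  obtain n' where n': "n' \<in> N" "\<psi> n' = w'" using \<psi>_surj [of w'] by auto
  have [simp]: "m \<in> carrier G" "n \<in> carrier G" "n' \<in> carrier G" using m n n' by auto
  define z where "z = inv x \<otimes> x'"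
  have [simp]: "z \<in> carrier G" by (simp add: z_def)
  define b where "b = inv m \<otimes> z \<otimes> m"
  have b: "b \<in> Usep \<one>\<^bsub>W\<^esub> (inv\<^bsub>W\<^esub> v)"
    unfolding b_def by (rule Usep_conj') (use m assms in \<open>auto simp: z_def\<close>)
  then have bB: "b \<in> B" and [simp]: "b \<in> carrier G" using Usep_B by auto
  have bq: "inv (inv m \<otimes> k) \<otimes> b \<otimes> (inv m \<otimes> k') \<in> B" if "k \<in> N" "\<psi> k = w" "k' \<in> N" "\<psi> k' = w'" for k k'
  proof -
    have "inv (x \<otimes> k) \<otimes> g \<otimes> inv (inv (x' \<otimes> k') \<otimes> g) \<in> B"
      using covers_rep [OF assms(1)] covers_rep [OF assms(2)] that by simp
    then show ?thesis using that by (simp add: b_def z_def group_normalize)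
  qed
  have "inv m \<otimes> n = b \<otimes> (inv m \<otimes> n') \<otimes> inv (inv (inv m \<otimes> n) \<otimes> b \<otimes> (inv m \<otimes> n'))"
    by (simp add: group_normalize)
  moreover have "b \<otimes> (inv m \<otimes> n') \<otimes> inv (inv (inv m \<otimes> n) \<otimes> b \<otimes> (inv m \<otimes> n')) \<in> cell (\<psi> (inv m \<otimes> n'))"
    using bB bq [OF n n'] m n' by (intro cellI) auto
  ultimately have "inv m \<otimes> n \<in> cell (\<psi> (inv m \<otimes> n'))" by simp
  then have "\<psi> (inv m \<otimes> n) = \<psi> (inv m \<otimes> n')"
    using m n n' N_cell [of "inv m \<otimes> n"] \<psi>_closed
    by (intro cell_unique [of _ _ "inv m \<otimes> n"]) auto
  then have ww: "w = w'" using m n n' assms by (simp add: \<psi>_mult \<psi>_inv)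
  define q where "q = inv m \<otimes> n"
  have q: "q \<in> N" "\<psi> q = inv\<^bsub>W\<^esub> v \<otimes>\<^bsub>W\<^esub> w" using m n by (auto simp: q_def \<psi>_mult \<psi>_inv)
  have qB: "inv q \<otimes> b \<otimes> q \<in> B" using bq [of n n] n ww by (simp add: q_def)
  \<comment> \<open>Left translation by \<open>v\<close> turns a minimal gallery from
    \<open>v\<close> through \<open>w\<close> to 1 into one from 1 through \<open>q\<close> to the
    inverse of \<open>v\<close>.\<close>
  have "cox.between (\<psi> q) (inv\<^bsub>W\<^esub> v)"
    unfolding cox.between_def
  proof (intro ballI impI)
    fix \<gamma> assume \<gamma>: "\<gamma> \<in> cox.roots" "\<one>\<^bsub>W\<^esub> \<in> \<gamma>" "inv\<^bsub>W\<^esub> v \<in> \<gamma>"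
    have v\<gamma>: "v <#\<^bsub>W\<^esub> \<gamma> \<in> cox.roots" using \<gamma> assms cox.l_coset_in_roots by auto
    have "\<one>\<^bsub>W\<^esub> \<in> v <#\<^bsub>W\<^esub> \<gamma>" "v \<in> v <#\<^bsub>W\<^esub> \<gamma>" using \<gamma> assms by (auto simp: cox.mem_l_coset)
    then have "w \<in> v <#\<^bsub>W\<^esub> \<gamma>" using v\<gamma> assms by (auto simp: cox.between_def)
    then show "\<psi> q \<in> \<gamma>" using \<gamma> assms q by (simp add: cox.mem_l_coset)
  qed
  then obtain y1 z1 where *: "y1 \<in> Usep \<one>\<^bsub>W\<^esub> (\<psi> q)" "z1 \<in> Usep (\<psi> q) (inv\<^bsub>W\<^esub> v)" "b = z1 \<otimes> y1"
    using Usep_between_decomp [of "\<psi> q" "inv\<^bsub>W\<^esub> v" b] b \<psi>_closed q(1) assms by auto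
  have [simp]: "y1 \<in> carrier G" "z1 \<in> carrier G" "q \<in> carrier G" using * q by auto
  have "inv q \<otimes> z1 \<otimes> q \<in> B"
    using Usep_one_conj_B [OF q(1) HOL.refl _ _ *(2)] \<psi>_closed q(1) assms by simp
  then have "inv (inv q \<otimes> z1 \<otimes> q) \<otimes> (inv q \<otimes> b \<otimes> q) \<in> B" using qB by simp
  then have "inv q \<otimes> y1 \<otimes> q \<in> B" by (simp add: *(3) group_normalize)
  then have "y1 = \<one>" using Usep_inter_conj_B q(1) * by auto
  then have "b \<in> Usep (\<psi> q) (inv\<^bsub>W\<^esub> v)" using * by simp
  then have "m \<otimes> b \<otimes> inv m \<in> Usep (\<psi> m \<otimes>\<^bsub>W\<^esub> \<psi> q) (\<psi> m \<otimes>\<^bsub>W\<^esub> inv\<^bsub>W\<^esub> v)"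
    using m q \<psi>_closed assms by (intro Usep_conj) auto
  then have "z \<in> Usep w \<one>\<^bsub>W\<^esub>"
    using m q assms by (simp add: b_def group_normalize)
  then show ?thesis using ww by (simp add: equ_def z_def)
qed

lemma panel_injectivity:
  assumes "s \<in> S" "adj s x w x' w'" "covers x w g" "covers x' w' g"
  shows "equ x w x' w'"
  using assms coversD [OF assms(3)] between_upper [of s w] upper_carrier
  by (intro local_injectivity [of x w g x' w' "upper s w"]) (auto simp: adj_def)

lemma adj_translate:
  assumes "adj s x w x' w'" "y \<in> carrier G" "x \<in> carrier G" "x' \<in> carrier G"
  shows "adj s (y \<otimes> x) w (y \<otimes> x') w'"
  using assms by (simp add: adj_def group_normalize)

text \<open>Displacements are limited to the group of the upper chamber, so the panel is
  parametrized from its lower end by the negative root group (\<open>para_decomp\<close>) and from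
  its upper end by the positive one (\<open>cell_S_decomp\<close>). In both cases conjugation by
  \<open>n\<close> gives a root that contains the upper chamber and not 1.\<close>

lemma panel_surjectivity:
  assumes "s \<in> S" "covers x w g" "h \<in> carrier G" "inv g \<otimes> h \<in> para s"
  shows "\<exists>x' w'. adj s x w x' w' \<and> covers x' w' h"
proof -
  have [simp]: "x \<in> carrier G" "g \<in> carrier G" and x: "x \<in> Uneg" and W [simp]: "w \<in> carrier W" "s \<in> carrier W"
    using coversD assms cox.S_carrier by auto
  have r: "cox.simple_root s \<in> cox.roots" and nr: "cox.neg (cox.simple_root s) \<in> cox.roots"
    using assms cox.simple_root_in_roots cox.neg_in_roots by auto
  define \<alpha> where "\<alpha> = w <#\<^bsub>W\<^esub> cox.simple_root s"
  have \<alpha>: "\<alpha> \<in> cox.roots" "cox.neg \<alpha> \<in> cox.roots"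
    using r cox.l_coset_in_roots cox.neg_in_roots by (auto simp: \<alpha>_def)
  obtain n where n: "n \<in> N" "\<psi> n = w" using \<psi>_surj [of w] by auto
  obtain m where m: "m \<in> N" "\<psi> m = s" using \<psi>_surj [of s] by auto
  have [simp]: "m \<in> carrier G" "n \<in> carrier G" using m n by auto
  define p where "p = inv (x \<otimes> n) \<otimes> h"
  have "inv (x \<otimes> n) \<otimes> g \<in> para s" using covers_rep assms n B_para by auto
  then have "(inv (x \<otimes> n) \<otimes> g) \<otimes> (inv g \<otimes> h) \<in> para s" using para_mult assms by blast
  then have p: "p \<in> para s" using assms by (simp add: p_def group_normalize)
  have h: "h = x \<otimes> n \<otimes> p" using assms by (simp add: p_def group_normalize)
  show ?thesis
  proof (cases "cox.len w < cox.len (w \<otimes>\<^bsub>W\<^esub> s)")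
    case True
    then have up: "upper s w = w \<otimes>\<^bsub>W\<^esub> s" by (simp add: upper_def)
    have one: "\<one>\<^bsub>W\<^esub> \<in> \<alpha>" using True cox.one_mem_l_coset_simple_root assms by (simp add: \<alpha>_def)
    show ?thesis
      using assms(1) p m
    proof (cases rule: para_decomp)
      case (upper b)
      then have "covers x (w \<otimes>\<^bsub>W\<^esub> s) h"
        using h x n m by (intro coversI [of _ _ "n \<otimes> m" b]) (auto simp: \<psi>_mult m_assoc)
      then show ?thesis by (intro exI [of _ x] exI [of _ "w \<otimes>\<^bsub>W\<^esub> s"]) (simp add: adj_def)
    next
      case (lower y b)
      have [simp]: "y \<in> carrier G" "b \<in> carrier G" using lower U_carrier nr by auto
      have "n \<otimes> y \<otimes> inv n \<in> U (cox.neg \<alpha>)"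
        using U_conj [OF n(1) nr lower(1)] n r by (simp add: \<alpha>_def cox.l_coset_neg)
      moreover have "w \<otimes>\<^bsub>W\<^esub> s \<in> cox.neg \<alpha>" "\<one>\<^bsub>W\<^esub> \<notin> cox.neg \<alpha>"
        using one r assms by (auto simp: cox.neg_def \<alpha>_def cox.mem_l_coset cox.S_notin_simple_root)
      ultimately have y: "n \<otimes> y \<otimes> inv n \<in> Usep (w \<otimes>\<^bsub>W\<^esub> s) \<one>\<^bsub>W\<^esub>"
        using U_Usep [OF \<alpha>(2)] by auto
      then have "n \<otimes> y \<otimes> inv n \<in> Uneg" using Usep_Uneg by auto
      then have "covers (x \<otimes> (n \<otimes> y \<otimes> inv n)) w h"
        using h x n lower by (intro coversI [of _ _ n b]) (auto simp: group_normalize)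
      then show ?thesis using y up
        by (intro exI [of _ "x \<otimes> (n \<otimes> y \<otimes> inv n)"] exI [of _ w]) (simp add: adj_def group_normalize)
    qed
  next
    case False
    then have up: "upper s w = w" by (simp add: upper_def)
    have one: "\<one>\<^bsub>W\<^esub> \<notin> \<alpha>" using False cox.one_mem_l_coset_simple_root assms by (simp add: \<alpha>_def)
    consider "p \<in> B" | "p \<in> cell s" using p by (auto simp: para_def)
    then show ?thesis
    proof cases
      case 1
      then have "covers x w h" using h x n by (intro coversI) auto
      then show ?thesis by (intro exI [of _ x] exI [of _ w]) (simp add: adj_def)
    next
      case 2
      then obtain u b where ub: "u \<in> U (cox.simple_root s)" "b \<in> B" "p = u \<otimes> m \<otimes> b"
        using cell_S_decomp assms m by metis
      have [simp]: "u \<in> carrier G" "b \<in> carrier G" using ub U_carrier r by auto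
      have "n \<otimes> u \<otimes> inv n \<in> U \<alpha>"
        using U_conj [OF n(1) r ub(1)] n by (simp add: \<alpha>_def)
      moreover have "w \<in> \<alpha>"
        using r assms by (auto simp: \<alpha>_def cox.mem_l_coset cox.one_in_simple_root)
      ultimately have y: "n \<otimes> u \<otimes> inv n \<in> Usep w \<one>\<^bsub>W\<^esub>"
        using U_Usep [OF \<alpha>(1)] one by auto
      then have "n \<otimes> u \<otimes> inv n \<in> Uneg" using Usep_Uneg by auto
      then have "covers (x \<otimes> (n \<otimes> u \<otimes> inv n)) (w \<otimes>\<^bsub>W\<^esub> s) h"
        using h x n m ub by (intro coversI [of _ _ "n \<otimes> m" b]) (auto simp: group_normalize \<psi>_mult)
      then show ?thesis using y up
        by (intro exI [of _ "x \<otimes> (n \<otimes> u \<otimes> inv n)"] exI [of _ "w \<otimes>\<^bsub>W\<^esub> s"]) (simp add: adj_def group_normalize)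
    qed
  qed
qed

text \<open>Both chambers are compared with the one represented by \<open>m\<close> over the upper
  type; the displacement \<open>z\<close>, conjugated by \<open>m\<close>, lies in
  \<open>B\<close>.\<close>

lemma adj_covers:
  assumes "s \<in> S" "adj s x w x' w'" "covers x w g" "covers x' w' h"
  shows "inv g \<otimes> h \<in> para s"
proof -
  have [simp]: "x \<in> carrier G" "x' \<in> carrier G" "g \<in> carrier G" "h \<in> carrier G"
    and W [simp]: "w \<in> carrier W" "w' \<in> carrier W" "s \<in> carrier W"
    using coversD assms cox.S_carrier by auto
  define v where "v = upper s w"
  have v [simp]: "v \<in> carrier W" using upper_carrier assms by (simp add: v_def)
  obtain m where m: "m \<in> N" "\<psi> m = v" using \<psi>_surj [of v] by auto
  obtain n where n: "n \<in> N" "\<psi> n = w" using \<psi>_surj [of w] by auto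
  obtain n' where n': "n' \<in> N" "\<psi> n' = w'" using \<psi>_surj [of w'] by auto
  have [simp]: "m \<in> carrier G" "n \<in> carrier G" "n' \<in> carrier G" using m n n' by auto
  define z where "z = inv x \<otimes> x'"
  have z: "z \<in> Usep v \<one>\<^bsub>W\<^esub>" using assms by (simp add: adj_def z_def v_def)
  then have b: "inv m \<otimes> z \<otimes> m \<in> para s"
    using Usep_one_conj_B [OF m v _ z] B_para by simp
  have P: "inv m \<otimes> k \<in> para s" if k: "k \<in> N" "\<psi> k = u" "u = v \<or> u = v \<otimes>\<^bsub>W\<^esub> s" for k u
  proof -
    have "\<psi> (inv m \<otimes> k) = inv\<^bsub>W\<^esub> v \<otimes>\<^bsub>W\<^esub> u" using k m by (simp add: \<psi>_mult \<psi>_inv)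
    then have "\<psi> (inv m \<otimes> k) = \<one>\<^bsub>W\<^esub> \<or> \<psi> (inv m \<otimes> k) = s" using k(3) by auto
    then show ?thesis using k m N_para [of "inv m \<otimes> k" s] T_I [of "inv m \<otimes> k"] B_para by auto
  qed
  have "w = v \<or> w = v \<otimes>\<^bsub>W\<^esub> s" using upper_cases [of s w] assms by (auto simp: v_def)
  then have 1: "inv m \<otimes> n \<in> para s"
    using n by (intro P) auto
  have "w' = w \<or> w' = w \<otimes>\<^bsub>W\<^esub> s" using assms by (simp add: adj_def)
  then have "w' = v \<or> w' = v \<otimes>\<^bsub>W\<^esub> s" using \<open>w = v \<or> _\<close> assms by auto
  then have 2: "inv m \<otimes> n' \<in> para s"
    using n' by (intro P) auto
  have 3: "inv (x \<otimes> n) \<otimes> g \<in> para s" "inv (x' \<otimes> n') \<otimes> h \<in> para s"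
    using covers_rep assms n n' B_para by auto
  have "inv (inv (x \<otimes> n) \<otimes> g) \<otimes> (inv (inv m \<otimes> n) \<otimes> ((inv m \<otimes> z \<otimes> m) \<otimes> ((inv m \<otimes> n') \<otimes> (inv (x' \<otimes> n') \<otimes> h)))) \<in> para s"
    by (rule para_mult [OF assms(1) para_inv [OF assms(1) 3(1)] para_mult [OF assms(1) para_inv [OF assms(1) 1]
      para_mult [OF assms(1) b para_mult [OF assms(1) 2 3(2)]]]])
  then show ?thesis by (simp add: z_def group_normalize)
qed

text \<open>
  \<open>lift g x w\<close>: the pair \<open>(x, w)\<close> is the end of a lift, starting at the base point \<open>(1, 1)\<close>, of some
  minimal gallery from \<open>B\<close> to \<open>gB\<close>.
\<close>

inductive lift :: "'g \<Rightarrow> 'g \<Rightarrow> 'w \<Rightarrow> bool" where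
  lift_base: "b \<in> B \<Longrightarrow> lift b \<one> \<one>\<^bsub>W\<^esub>"
| lift_step: "lift g x w \<Longrightarrow> g \<in> cell v \<Longrightarrow> v \<in> carrier W \<Longrightarrow> s \<in> S \<Longrightarrow>
    cox.len v < cox.len (v \<otimes>\<^bsub>W\<^esub> s) \<Longrightarrow> h \<in> cell (v \<otimes>\<^bsub>W\<^esub> s) \<Longrightarrow> inv g \<otimes> h \<in> para s \<Longrightarrow>
    adj s x w x' w' \<Longrightarrow> covers x' w' h \<Longrightarrow> lift h x' w'"

section \<open>Lifting minimal galleries\<close>

lemma lift_covers: "lift g x w \<Longrightarrow> covers x w g"
  by (induction rule: lift.induct) (auto intro: coversI [of _ _ \<one>])

lemma lift_carrier:
  assumes "lift g x w"
  shows "g \<in> carrier G" "x \<in> carrier G" "w \<in> carrier W"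
  using lift_covers [OF assms] coversD [of x w g] by auto

text \<open>Any chamber of the panel other than that of \<open>g\<close> would be farther from
  \<open>B\<close>.\<close>

lemma gate_unique:
  assumes "s \<in> S" "v \<in> carrier W" "cox.len v < cox.len (v \<otimes>\<^bsub>W\<^esub> s)" "g \<in> cell v" "h \<in> cell v" "inv g \<otimes> h \<in> para s"
  shows "inv g \<otimes> h \<in> B"
proof (rule ccontr)
  assume "inv g \<otimes> h \<notin> B"
  then have "inv g \<otimes> h \<in> cell s" using assms by (simp add: para_def)
  then have "g \<otimes> (inv g \<otimes> h) \<in> cell (v \<otimes>\<^bsub>W\<^esub> s)" using cell_mult_S_less assms by blast
  then have "h \<in> cell (v \<otimes>\<^bsub>W\<^esub> s)" using assms cell_carrier by (simp add: mult_inv_cancel)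
  then have "v = v \<otimes>\<^bsub>W\<^esub> s" using cell_unique assms cox.S_carrier by (metis cox.m_closed)
  then show False using assms by simp
qed

lemma gate_exists:
  assumes "s \<in> S" "v \<in> carrier W" "h \<in> cell (v \<otimes>\<^bsub>W\<^esub> s)"
  obtains g where "g \<in> cell v" "inv g \<otimes> h \<in> para s"
proof -
  obtain n where n: "n \<in> N" "\<psi> n = v" using \<psi>_surj assms by auto
  obtain m where m: "m \<in> N" "\<psi> m = s" using \<psi>_surj [of s] assms cox.S_carrier by auto
  have "n \<otimes> m \<in> N" "\<psi> (n \<otimes> m) = v \<otimes>\<^bsub>W\<^esub> s" using m n by (auto simp: \<psi>_mult)
  then obtain b b' where b: "b \<in> B" "b' \<in> B" "h = b \<otimes> (n \<otimes> m) \<otimes> b'" using cell_eq_B_mult [OF assms(3)] by metis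
  have "inv (b \<otimes> n) \<otimes> h = m \<otimes> b'" using b m n by (simp add: group_normalize)
  moreover have "m \<otimes> b' \<in> para s" using m b assms para_mult N_para B_para by auto
  moreover have "b \<otimes> n \<in> cell v" using B_mult_cell N_cell b n by auto
  ultimately show thesis using that by metis
qed

lemma lift_exists:
  assumes "u \<in> carrier W" "g \<in> cell u"
  shows "\<exists>x w. lift g x w"
  using assms
proof (induction "cox.len u" arbitrary: u g)
  case 0
  then have "g \<in> B" using cox.len_eq_0 cell_one by metis
  then show ?case using lift_base by blast
next
  case (Suc l)
  then have "u \<noteq> \<one>\<^bsub>W\<^esub>" by auto
  then obtain s where s: "s \<in> S" "cox.len u = Suc (cox.len (u \<otimes>\<^bsub>W\<^esub> s))"
    using cox.ex_right_descent Suc by metis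
  define v where "v = u \<otimes>\<^bsub>W\<^esub> s"
  have v: "v \<in> carrier W" "u = v \<otimes>\<^bsub>W\<^esub> s" "l = cox.len v" "cox.len v < cox.len (v \<otimes>\<^bsub>W\<^esub> s)"
    using s Suc cox.S_carrier by (auto simp: v_def)
  obtain h where h: "h \<in> cell v" "inv h \<otimes> g \<in> para s" using gate_exists s v Suc by metis
  obtain x w where xw: "lift h x w" using Suc.hyps(1) v h by blast
  have gc: "g \<in> carrier G" using Suc.prems cell_carrier by auto
  obtain x' w' where "adj s x w x' w'" "covers x' w' g"
    using panel_surjectivity [OF s(1) lift_covers [OF xw] gc h(2)] by auto
  then show ?case using lift_step [OF xw h(1) v(1) s(1) v(4)] h(2) Suc.prems v(2) by blast
qed

lemma lift_mult_B:
  assumes "lift g x w" "b \<in> B"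
  shows "lift (g \<otimes> b) x w"
  using assms(1)
proof cases
  case lift_base
  then show ?thesis using assms(2) lift.lift_base by simp
next
  case (lift_step h y z v s)
  have "g \<in> carrier G" "h \<in> carrier G" using lift_step cell_carrier by auto
  then have "inv h \<otimes> (g \<otimes> b) \<in> para s" "covers x w (g \<otimes> b)"
    using para_mult [of s "inv h \<otimes> g" b] B_para covers_cong [of x w g "g \<otimes> b"] assms(2) lift_step
    by (auto simp: m_assoc inv_mult_cancel)
  then show ?thesis using lift.lift_step [OF lift_step(1-5) cell_mult_B] assms(2) lift_step by blast
qed

lemma lift_cell_one:
  assumes "lift g x w" "g \<in> B"
  shows "x = \<one>" "w = \<one>\<^bsub>W\<^esub>"
proof -
  have "x = \<one> \<and> w = \<one>\<^bsub>W\<^esub>"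
    using assms
  proof cases
    case (lift_step g' x' w' v s)
    then have "v \<otimes>\<^bsub>W\<^esub> s = \<one>\<^bsub>W\<^esub>" using cell_unique [of _ "\<one>\<^bsub>W\<^esub>" g] assms cell_one cox.S_carrier by auto
    then show ?thesis using lift_step by simp
  qed auto
  then show "x = \<one>" "w = \<one>\<^bsub>W\<^esub>" by auto
qed

lemma lift_last_step:
  assumes "lift g x w" "g \<in> cell u" "u \<in> carrier W" "u \<noteq> \<one>\<^bsub>W\<^esub>"
  obtains s v h y z where "s \<in> S" "v \<in> carrier W" "u = v \<otimes>\<^bsub>W\<^esub> s" "cox.len v < cox.len u"
    "lift h y z" "h \<in> cell v" "inv h \<otimes> g \<in> para s" "adj s y z x w"
  using assms(1)
proof cases
  case lift_base
  then have "u = \<one>\<^bsub>W\<^esub>" using cell_unique [of u "\<one>\<^bsub>W\<^esub>" g] assms cell_one by auto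
  then show thesis using assms by simp
next
  case (lift_step h y z v s)
  then have "u = v \<otimes>\<^bsub>W\<^esub> s" using cell_unique [of u "v \<otimes>\<^bsub>W\<^esub> s" g] assms cox.S_carrier by auto
  then show thesis using that lift_step by blast
qed

definition lift_unique_at :: "'w \<Rightarrow> bool" where
  "lift_unique_at v \<longleftrightarrow> (\<forall>g h x w x' w'. g \<in> cell v \<longrightarrow> inv g \<otimes> h \<in> B \<longrightarrow> h \<in> carrier G \<longrightarrow>
     lift g x w \<longrightarrow> lift h x' w' \<longrightarrow> equ x w x' w')"

text \<open>Both galleries enter the last panel through its gate, where the lifts agree by
  hypothesis. Hence the two ends are adjacent over the same chamber, and
  \<open>panel_injectivity\<close> applies.\<close>

lemma lift_unique_same_type:
  assumes v: "lift_unique_at v" "v \<in> carrier W" "s \<in> S" "cox.len v < cox.len (v \<otimes>\<^bsub>W\<^esub> s)"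
    and h: "lift h y z" "h \<in> cell v" "inv h \<otimes> g \<in> para s" "adj s y z x w" "covers x w g"
    and h': "lift h' y' z'" "h' \<in> cell v" "inv h' \<otimes> g \<in> para s" "adj s y' z' x' w'" "covers x' w' g"
  shows "equ x w x' w'"
proof -
  have [simp]: "h \<in> carrier G" "h' \<in> carrier G" "g \<in> carrier G"
    "x \<in> carrier G" "x' \<in> carrier G" "y \<in> carrier G" "y' \<in> carrier G"
    using coversD [OF h(5)] coversD [OF h'(5)] lift_carrier [OF h(1)] lift_carrier [OF h'(1)] by auto
  have [simp]: "z \<in> carrier W" "z' \<in> carrier W" "w \<in> carrier W" "w' \<in> carrier W"
    using coversD [OF h(5)] coversD [OF h'(5)] lift_carrier [OF h(1)] lift_carrier [OF h'(1)] by auto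
  have "(inv h \<otimes> g) \<otimes> inv (inv h' \<otimes> g) \<in> para s" using h h' v para_mult para_inv by auto
  then have "inv h \<otimes> h' \<in> para s" by (simp add: group_normalize)
  then have "inv h \<otimes> h' \<in> B" using gate_unique v h h' by blast
  then have "equ y z y' z'" using v(1) h(1,2) h'(1) unfolding lift_unique_at_def by simp
  then have "adj s y z y' z'" using v by (intro equ_adj) auto
  then have "adj s y z x' w'" using adj_trans [of s z y y' x' z' w'] v h' by simp
  moreover have "adj s x w y z" using adj_sym [of s z y x w] v h by simp
  ultimately have "adj s x w x' w'" using adj_trans [of s w x y x' z w'] v by simp
  then show ?thesis using panel_injectivity v h h' by blast
qed

text \<open>A gallery inside the rank 2 residue is lifted step by step from its gate
  \<open>b \<otimes> n1\<close>. The lift need not start at the minimal element of its own coset: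
  \<open>w1\<close> is minimal for the types below, \<open>v1\<close> for those above, and the two
  are not related. All types above stay in the coset of \<open>v1\<close>, so every displacement
  stays in the group attached to \<open>v1 \<otimes> p\<close>.\<close>

lemma lift_gallery:
  assumes "s \<in> S" "t \<in> S" "cox.dihedral_longest s t k p"
    and w1: "cox.coset_minimal {s, t} w1" and b: "b \<in> B" and n1: "n1 \<in> N" "\<psi> n1 = w1"
    and lift0: "lift (b \<otimes> n1) x0 (v1 \<otimes>\<^bsub>W\<^esub> word_prod W vs)" and v1: "cox.coset_minimal {s, t} v1" "vs \<in> lists {s, t}"
    and us: "cox.reduced_in {s, t} us" "n \<in> N" "\<psi> n = word_prod W us"
  shows "\<exists>x us'. us' \<in> lists {s, t} \<and> lift (b \<otimes> n1 \<otimes> n) x (v1 \<otimes>\<^bsub>W\<^esub> word_prod W us') \<and>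
    inv x0 \<otimes> x \<in> Usep (v1 \<otimes>\<^bsub>W\<^esub> p) \<one>\<^bsub>W\<^esub>"
  using us
proof (induction us arbitrary: n rule: rev_induct)
  case Nil
  then have "n \<in> B" using T_I by simp
  then have "lift (b \<otimes> n1 \<otimes> n) x0 (v1 \<otimes>\<^bsub>W\<^esub> word_prod W vs)"
    using lift_mult_B lift0 by auto
  then show ?case using v1 lift_covers [OF lift0] coversD by (intro exI [of _ x0] exI [of _ vs]) auto
next
  case (snoc a us)
  have A: "{s, t} \<subseteq> S" using assms by auto
  have red: "cox.reduced_in {s, t} us" using cox.reduced_in_infix [OF A, of "[]" us "[a]"] snoc.prems by simp
  have a: "a \<in> {s, t}" "a \<in> S" and usS: "us \<in> lists S" using snoc.prems A by (auto simp: cox.reduced_in_def)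
  have [simp]: "a \<in> carrier W" "word_prod W us \<in> carrier W" "w1 \<in> carrier W" "v1 \<in> carrier W"
    using a usS w1 v1 cox.S_carrier by (auto simp: cox.coset_minimal_def)
  obtain m where m: "m \<in> N" "\<psi> m = a" using \<psi>_surj [of a] by auto
  define n' where "n' = n \<otimes> inv m"
  have wp: "word_prod W (us @ [a]) = word_prod W us \<otimes>\<^bsub>W\<^esub> a" using usS a by simp
  have n': "n' \<in> N" "\<psi> n' = word_prod W us" and nn': "n = n' \<otimes> m"
    using snoc.prems m a wp by (auto simp: n'_def \<psi>_mult \<psi>_inv group_normalize cox.S_inv)
  obtain x us' where IH: "us' \<in> lists {s, t}" "lift (b \<otimes> n1 \<otimes> n') x (v1 \<otimes>\<^bsub>W\<^esub> word_prod W us')"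
    "inv x0 \<otimes> x \<in> Usep (v1 \<otimes>\<^bsub>W\<^esub> p) \<one>\<^bsub>W\<^esub>"
    using snoc.IH [OF red n'] by blast
  have us'S: "us' \<in> lists S" using IH A by auto
  have [simp]: "b \<in> carrier G" "n1 \<in> carrier G" "n' \<in> carrier G" "m \<in> carrier G" using b n1 n' m by auto
  have "inv (b \<otimes> n1 \<otimes> n') \<otimes> (b \<otimes> n1 \<otimes> n) = m" by (simp add: nn' group_normalize)
  then have par: "inv (b \<otimes> n1 \<otimes> n') \<otimes> (b \<otimes> n1 \<otimes> n) \<in> para a" using m N_para by simp
  then obtain x' z' where x': "adj a x (v1 \<otimes>\<^bsub>W\<^esub> word_prod W us') x' z'" "covers x' z' (b \<otimes> n1 \<otimes> n)"
    using panel_surjectivity [OF a(2) lift_covers [OF IH(2)] _ par] b n1 snoc.prems(2) by auto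
  have len: "cox.len (w1 \<otimes>\<^bsub>W\<^esub> word_prod W us) = cox.len w1 + length us"
    "cox.len (w1 \<otimes>\<^bsub>W\<^esub> word_prod W (us @ [a])) = cox.len w1 + length (us @ [a])"
    using cox.len_coset_minimal_mult [OF A w1] red snoc.prems by blast+
  have cells: "b \<otimes> n1 \<otimes> n' \<in> cell (w1 \<otimes>\<^bsub>W\<^esub> word_prod W us)" "b \<otimes> n1 \<otimes> n \<in> cell (w1 \<otimes>\<^bsub>W\<^esub> word_prod W us \<otimes>\<^bsub>W\<^esub> a)"
    using B_mult_cell [OF b N_cell, of "n1 \<otimes> n'"] B_mult_cell [OF b N_cell, of "n1 \<otimes> n"] n1 n' snoc.prems wp
    by (simp_all add: \<psi>_mult m_assoc cox.m_assoc)
  have lift': "lift (b \<otimes> n1 \<otimes> n) x' z'"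
    using lift_step [OF IH(2) cells(1) _ a(2) _ cells(2) par x'] len wp by (simp add: cox.m_assoc)
  have z: "z' = v1 \<otimes>\<^bsub>W\<^esub> word_prod W us' \<or> z' = v1 \<otimes>\<^bsub>W\<^esub> word_prod W (us' @ [a])"
    using x'(1) us'S a by (auto simp: adj_def cox.m_assoc)
  have pW: "v1 \<otimes>\<^bsub>W\<^esub> p \<in> carrier W"
    using assms(3) unfolding cox.dihedral_longest_def cox.reduced_in_def
    using A cox.word_prod_closed by (metis \<open>v1 \<in> carrier W\<close> cox.m_closed lists_mono subsetD)
  define up where "up = upper a (v1 \<otimes>\<^bsub>W\<^esub> word_prod W us')"
  have "up = v1 \<otimes>\<^bsub>W\<^esub> word_prod W us' \<or> up = v1 \<otimes>\<^bsub>W\<^esub> word_prod W (us' @ [a])"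
    using upper_cases [of a "v1 \<otimes>\<^bsub>W\<^esub> word_prod W us'"] us'S a by (auto simp: up_def cox.m_assoc)
  moreover have "us' @ [a] \<in> lists {s, t}" using IH a by auto
  ultimately have "cox.between up (v1 \<otimes>\<^bsub>W\<^esub> p)"
    using cox.between_dihedral [OF assms(1-3) _ v1(1)] IH by blast
  then have "inv x \<otimes> x' \<in> Usep (v1 \<otimes>\<^bsub>W\<^esub> p) \<one>\<^bsub>W\<^esub>"
    using Usep_between_mono pW x'(1) by (auto simp: adj_def up_def)
  then have "(inv x0 \<otimes> x) \<otimes> (inv x \<otimes> x') \<in> Usep (v1 \<otimes>\<^bsub>W\<^esub> p) \<one>\<^bsub>W\<^esub>"
    using IH by simp
  moreover have "x0 \<in> Uneg" "x \<in> Uneg" "x' \<in> Uneg" using lift_covers [OF lift0] lift_covers [OF IH(2)] x' coversD by auto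
  ultimately have "inv x0 \<otimes> x' \<in> Usep (v1 \<otimes>\<^bsub>W\<^esub> p) \<one>\<^bsub>W\<^esub>" by (simp add: group_normalize)
  then show ?case using z lift' IH(1) \<open>us' @ [a] \<in> lists {s, t}\<close> by metis
qed

text \<open>If the last letters agree, the induction hypothesis and
  \<open>lift_unique_same_type\<close> suffice. If they are different letters s and t, each given
  lift is replaced by one along a gallery through a common gate of the {s, t}-residue, the
  replacement being justified by induction at the last but one chamber. The two new lifts differ by
  an element of the group attached to \<open>v1 \<otimes> p\<close>, so
  \<open>local_injectivity\<close> identifies them.\<close>

lemma lift_unique:
  assumes "u \<in> carrier W"
  shows "lift_unique_at u"
  using assms
proof (induction "cox.len u" arbitrary: u rule: less_induct)
  case less
  have "equ x w x' w'" if g: "g \<in> cell u" "inv g \<otimes> g' \<in> B" "g' \<in> carrier G" and l: "lift g x w" "lift g' x' w'" for g g' x w x' w'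
  proof (cases "u = \<one>\<^bsub>W\<^esub>")
    case True
    then have "g \<in> B" using g cell_one by auto
    then have "g \<otimes> (inv g \<otimes> g') \<in> B" using g by simp
    then have "g' \<in> B" using g cell_carrier by (simp add: mult_inv_cancel)
    then show ?thesis using lift_cell_one [OF l(1)] lift_cell_one [OF l(2)] \<open>g \<in> B\<close> by (auto simp: equ_def)
  next
    case False
    have gc [simp]: "g \<in> carrier G" using g cell_carrier by auto
    have g'u: "g' \<in> cell u"
      using cell_mult_B [OF g(2,1)] g by (simp add: mult_inv_cancel)
    have cov: "covers x w g" "covers x' w' g"
      using l lift_covers covers_cong [of x' w' g' g] B_inv [OF g(2)] g by (auto simp: group_normalize)
    obtain s v h y z where s: "s \<in> S" "v \<in> carrier W" "u = v \<otimes>\<^bsub>W\<^esub> s" "cox.len v < cox.len u"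
      "lift h y z" "h \<in> cell v" "inv h \<otimes> g \<in> para s" "adj s y z x w"
      by (rule lift_last_step [OF l(1) g(1) less.prems False])
    obtain t v' h' y' z' where t: "t \<in> S" "v' \<in> carrier W" "u = v' \<otimes>\<^bsub>W\<^esub> t" "cox.len v' < cox.len u"
      "lift h' y' z'" "h' \<in> cell v'" "inv h' \<otimes> g' \<in> para t" "adj t y' z' x' w'"
      by (rule lift_last_step [OF l(2) g'u less.prems False])
    have [simp]: "h \<in> carrier G" "h' \<in> carrier G" using s t cell_carrier by auto
    have "(inv h' \<otimes> g') \<otimes> inv (inv g \<otimes> g') \<in> para t" using t(1,7) g para_mult B_para by auto
    then have h'g: "inv h' \<otimes> g \<in> para t" using g by (simp add: group_normalize)
    have [simp]: "s \<in> carrier W" "t \<in> carrier W" using s t cox.S_carrier by auto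
    have vs: "v = u \<otimes>\<^bsub>W\<^esub> s" using s(1-3) by simp
    have vt: "v' = u \<otimes>\<^bsub>W\<^esub> t" using t(1-3) by simp
    have uniq: "lift_unique_at v" "lift_unique_at v'" using less.hyps s t by auto
    show ?thesis
    proof (cases "s = t")
      case True
      then have "v' = v" using vs vt by simp
      show ?thesis
        by (rule lift_unique_same_type [OF uniq(1) s(2,1) _ s(5-8) cov(1) t(5) _ _ _ cov(2)])
          (use s t True \<open>v' = v\<close> h'g in auto)
    next
      case False
      obtain w1 k p where w1: "cox.coset_minimal {s, t} w1" and p: "cox.dihedral_longest s t k p" and u: "u = w1 \<otimes>\<^bsub>W\<^esub> p"
        using cox.two_descents [OF less.prems s(1) t(1) False] s(4) t(4) vs vt by auto
      have A: "{s, t} \<subseteq> S" using s t by auto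
      have w1W: "w1 \<in> carrier W" using w1 by (simp add: cox.coset_minimal_def)
      obtain n1 where n1: "n1 \<in> N" "\<psi> n1 = w1" using \<psi>_surj w1W by auto
      obtain us0 where "cox.reduced_in {s, t} us0" "word_prod W us0 = p" using p by (auto simp: cox.dihedral_longest_def)
      then have pW: "p \<in> carrier W" using A cox.word_prod_closed unfolding cox.reduced_in_def
        by (metis lists_mono subsetD)
      obtain np where np: "np \<in> N" "\<psi> np = p" using \<psi>_surj pW by auto
      have "n1 \<otimes> np \<in> N" "\<psi> (n1 \<otimes> np) = u" using n1 np u by (auto simp: \<psi>_mult)
      then obtain b b' where b: "b \<in> B" "b' \<in> B" "g = b \<otimes> (n1 \<otimes> np) \<otimes> b'" using cell_eq_B_mult [OF g(1)] by metis
      have [simp]: "b \<in> carrier G" "b' \<in> carrier G" "n1 \<in> carrier G" "np \<in> carrier G" using b n1 np by auto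
      obtain x0 w0 where l0: "lift (b \<otimes> n1) x0 w0"
        using lift_exists [OF w1W, of "b \<otimes> n1"] B_mult_cell [OF b(1) N_cell [OF n1]] by auto
      have w0W: "w0 \<in> carrier W" and x0: "x0 \<in> carrier G" using lift_covers [OF l0] coversD Uneg_carrier by metis+
      obtain v1 vs where v1: "cox.coset_minimal {s, t} v1" "cox.reduced_in {s, t} vs" "w0 = v1 \<otimes>\<^bsub>W\<^esub> word_prod W vs"
        using cox.ex_coset_minimal [OF w0W A] by metis
      have vsA: "vs \<in> lists {s, t}" using v1 by (simp add: cox.reduced_in_def)
      have v1W: "v1 \<in> carrier W" using v1 by (simp add: cox.coset_minimal_def)
      have l0': "lift (b \<otimes> n1) x0 (v1 \<otimes>\<^bsub>W\<^esub> word_prod W vs)" using l0 v1 by simp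
      \<comment> \<open>For either last letter \<open>a\<close>, choose the reduced word of
        \<open>p\<close> ending in \<open>a\<close>, lift its gallery from the gate and compare only
        the final panel with the given lift.\<close>
      have last: "\<exists>xa us'. us' \<in> lists {s, t} \<and> covers xa (v1 \<otimes>\<^bsub>W\<^esub> word_prod W us') g \<and>
          inv x0 \<otimes> xa \<in> Usep (v1 \<otimes>\<^bsub>W\<^esub> p) \<one>\<^bsub>W\<^esub> \<and> equ xa (v1 \<otimes>\<^bsub>W\<^esub> word_prod W us') xx ww"
        if a: "a \<in> {s, t}" and va: "va \<in> carrier W" "u = va \<otimes>\<^bsub>W\<^esub> a" "cox.len va < cox.len u"
          and ha: "lift ha ya za" "ha \<in> cell va" "inv ha \<otimes> g \<in> para a" "adj a ya za xx ww" "covers xx ww g"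
        for a va ha ya za xx ww
      proof -
        have aS: "a \<in> S" using a A by auto
        then have aW [simp]: "a \<in> carrier W" using cox.S_carrier by auto
        obtain us where us: "cox.reduced_in {s, t} (us @ [a])" "word_prod W (us @ [a]) = p"
          using cox.dihedral_longest_last [OF p a] by metis
        have usred: "cox.reduced_in {s, t} us" using cox.reduced_in_infix [OF A, of "[]" us "[a]"] us by simp
        have usS: "us \<in> lists S" using usred A by (auto simp: cox.reduced_in_def)
        then have usW [simp]: "word_prod W us \<in> carrier W" by simp
        have pa: "p = word_prod W us \<otimes>\<^bsub>W\<^esub> a" using us usS aS by simp
        obtain m where m: "m \<in> N" "\<psi> m = a" using \<psi>_surj [of a] by auto
        have [simp]: "m \<in> carrier G" using m by auto
        define n where "n = np \<otimes> inv m"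
        have n: "n \<in> N" "\<psi> n = word_prod W us" using np m aS by (auto simp: n_def \<psi>_mult \<psi>_inv pa cox.S_inv)
        obtain y us' where y: "us' \<in> lists {s, t}" "lift (b \<otimes> n1 \<otimes> n) y (v1 \<otimes>\<^bsub>W\<^esub> word_prod W us')"
            "inv x0 \<otimes> y \<in> Usep (v1 \<otimes>\<^bsub>W\<^esub> p) \<one>\<^bsub>W\<^esub>"
          using lift_gallery [OF s(1) t(1) p w1 b(1) n1 l0' v1(1) vsA usred n] by blast
        have us'S: "us' \<in> lists S" using y A by auto
        have "va = u \<otimes>\<^bsub>W\<^esub> a" using va aS by simp
        also have "\<dots> = w1 \<otimes>\<^bsub>W\<^esub> word_prod W us" using w1W aS by (simp add: u pa cox.m_assoc cox.S_sq)
        finally have cell: "b \<otimes> n1 \<otimes> n \<in> cell va"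
          using B_mult_cell [OF b(1) N_cell, of "n1 \<otimes> n"] n1 n by (simp add: \<psi>_mult m_assoc)
        have "inv (b \<otimes> n1 \<otimes> n) \<otimes> g = m \<otimes> b'" by (simp add: b n_def group_normalize)
        then have par: "inv (b \<otimes> n1 \<otimes> n) \<otimes> g \<in> para a"
          using para_mult [OF aS N_para [OF m] B_para [OF b(2)]] by simp
        obtain xa wa where xa: "adj a y (v1 \<otimes>\<^bsub>W\<^esub> word_prod W us') xa wa" "covers xa wa g"
          using panel_surjectivity [OF aS lift_covers [OF y(2)] gc par] by auto
        have "lift_unique_at va" using less.hyps va by auto
        then have eq: "equ xa wa xx ww"
          using va aS xa par y ha cell
          by (intro lift_unique_same_type [of va a "b \<otimes> n1 \<otimes> n" y "v1 \<otimes>\<^bsub>W\<^esub> word_prod W us'" g xa wa ha ya za xx ww]) auto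
        have us'a: "us' @ [a] \<in> lists {s, t}" using y a by auto
        have wa: "wa = v1 \<otimes>\<^bsub>W\<^esub> word_prod W us' \<or> wa = v1 \<otimes>\<^bsub>W\<^esub> word_prod W (us' @ [a])"
          using xa(1) us'S aS v1W by (auto simp: adj_def cox.m_assoc)
        define up where "up = upper a (v1 \<otimes>\<^bsub>W\<^esub> word_prod W us')"
        have "up = v1 \<otimes>\<^bsub>W\<^esub> word_prod W us' \<or> up = v1 \<otimes>\<^bsub>W\<^esub> word_prod W (us' @ [a])"
          using upper_cases [of a "v1 \<otimes>\<^bsub>W\<^esub> word_prod W us'"] us'S aS v1W by (auto simp: up_def cox.m_assoc)
        then have "cox.between up (v1 \<otimes>\<^bsub>W\<^esub> p)"
          using cox.between_dihedral [OF s(1) t(1) p _ v1(1)] y us'a by blast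
        then have "inv y \<otimes> xa \<in> Usep (v1 \<otimes>\<^bsub>W\<^esub> p) \<one>\<^bsub>W\<^esub>"
          using Usep_between_mono v1W pW xa(1) by (auto simp: adj_def up_def)
        then have "(inv x0 \<otimes> y) \<otimes> (inv y \<otimes> xa) \<in> Usep (v1 \<otimes>\<^bsub>W\<^esub> p) \<one>\<^bsub>W\<^esub>" using y by simp
        moreover have "y \<in> carrier G" "xa \<in> carrier G" using lift_covers [OF y(2)] xa coversD Uneg_carrier by metis+
        ultimately have "inv x0 \<otimes> xa \<in> Usep (v1 \<otimes>\<^bsub>W\<^esub> p) \<one>\<^bsub>W\<^esub>" using x0 by (simp add: group_normalize)
        then show ?thesis using wa xa eq y(1) us'a by metis
      qed
      obtain xs us1 where xs: "us1 \<in> lists {s, t}" "covers xs (v1 \<otimes>\<^bsub>W\<^esub> word_prod W us1) g"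
          "inv x0 \<otimes> xs \<in> Usep (v1 \<otimes>\<^bsub>W\<^esub> p) \<one>\<^bsub>W\<^esub>" "equ xs (v1 \<otimes>\<^bsub>W\<^esub> word_prod W us1) x w"
        using last [OF _ s(2-8) cov(1)] by blast
      obtain xt us2 where xt: "us2 \<in> lists {s, t}" "covers xt (v1 \<otimes>\<^bsub>W\<^esub> word_prod W us2) g"
          "inv x0 \<otimes> xt \<in> Usep (v1 \<otimes>\<^bsub>W\<^esub> p) \<one>\<^bsub>W\<^esub>" "equ xt (v1 \<otimes>\<^bsub>W\<^esub> word_prod W us2) x' w'"
        using last [OF _ t(2-6) h'g t(8) cov(2)] by blast
      have [simp]: "xs \<in> carrier G" "xt \<in> carrier G" "x \<in> carrier G" "x' \<in> carrier G" "x0 \<in> carrier G"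
        using xs xt cov x0 coversD Uneg_carrier by metis+
      have "inv (inv x0 \<otimes> xs) \<otimes> (inv x0 \<otimes> xt) \<in> Usep (v1 \<otimes>\<^bsub>W\<^esub> p) \<one>\<^bsub>W\<^esub>" using xs xt by simp
      then have "inv xs \<otimes> xt \<in> Usep (v1 \<otimes>\<^bsub>W\<^esub> p) \<one>\<^bsub>W\<^esub>" by (simp add: group_normalize)
      then have "equ xs (v1 \<otimes>\<^bsub>W\<^esub> word_prod W us1) xt (v1 \<otimes>\<^bsub>W\<^esub> word_prod W us2)"
        using xs xt v1W pW cox.between_dihedral [OF s(1) t(1) p _ v1(1)]
        by (intro local_injectivity [of _ _ g _ _ "v1 \<otimes>\<^bsub>W\<^esub> p"]) auto
      then have e1: "equ xs (v1 \<otimes>\<^bsub>W\<^esub> word_prod W us1) x' w'" by (rule equ_trans [rotated 3, OF _ xt(4)]) simp_all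
      have "equ x w xs (v1 \<otimes>\<^bsub>W\<^esub> word_prod W us1)" by (rule equ_sym [rotated 2, OF xs(4)]) simp_all
      then show ?thesis by (rule equ_trans [rotated 3, OF _ e1]) simp_all
    qed
  qed
  then show ?case unfolding lift_unique_at_def by blast
qed

lemma lift_unique':
  assumes "lift g x w" "lift h x' w'" "inv g \<otimes> h \<in> B"
  shows "equ x w x' w'"
proof -
  obtain u where "u \<in> carrier W" "g \<in> cell u" using carrier_cells lift_carrier(1) [OF assms(1)] by metis
  then show ?thesis using lift_unique [of u] assms lift_carrier(1) [OF assms(2)] unfolding lift_unique_at_def by blast
qed

text \<open>Lifting is compatible with adjacency: all chambers of a panel can be lifted through its
  gate \<open>d\<close>, and uniqueness of lifts shows that any other lift of them is adjacent to
  the lift of \<open>d\<close> too.\<close>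

lemma lift_adj:
  assumes s: "s \<in> S" and l: "lift g x w" "lift g' x' w'" and gg: "inv g \<otimes> g' \<in> para s"
  shows "adj s x w x' w'"
proof -
  have [simp]: "g \<in> carrier G" "g' \<in> carrier G" using lift_carrier l by auto
  have sW [simp]: "s \<in> carrier W" using s cox.S_carrier by auto
  obtain u where u: "u \<in> carrier W" "g \<in> cell u" using carrier_cells lift_carrier(1) [OF l(1)] by metis
  obtain v d where v: "v \<in> carrier W" "cox.len v < cox.len (v \<otimes>\<^bsub>W\<^esub> s)" "d \<in> cell v" "inv d \<otimes> g \<in> para s"
  proof (cases "cox.len u < cox.len (u \<otimes>\<^bsub>W\<^esub> s)")
    case True
    then show thesis using that [of u g] u B_para by simp
  next
    case False
    then have less: "cox.len (u \<otimes>\<^bsub>W\<^esub> s) < cox.len (u \<otimes>\<^bsub>W\<^esub> s \<otimes>\<^bsub>W\<^esub> s)"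
      using cox.len_mult_S_cases [of u s] u s by auto
    obtain d where "d \<in> cell (u \<otimes>\<^bsub>W\<^esub> s)" "inv d \<otimes> g \<in> para s"
      using gate_exists [of s "u \<otimes>\<^bsub>W\<^esub> s" g] s u by auto
    then show thesis using that [of "u \<otimes>\<^bsub>W\<^esub> s" d] less u by auto
  qed
  have dc [simp]: "d \<in> carrier G" using v cell_carrier by auto
  obtain e f where ef: "lift d e f" using lift_exists v by blast
  have *: "adj s e f y z" if h: "lift h y z" "inv d \<otimes> h \<in> para s" for h y z
  proof -
    have [simp]: "h \<in> carrier G" using lift_carrier h by auto
    consider "inv d \<otimes> h \<in> B" | "inv d \<otimes> h \<in> cell s" using h by (auto simp: para_def)
    then show ?thesis
    proof cases
      case 1
      then show ?thesis using lift_unique' [OF ef h(1)] equ_adj s lift_carrier [OF ef] by blast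
    next
      case 2
      then have "d \<otimes> (inv d \<otimes> h) \<in> cell (v \<otimes>\<^bsub>W\<^esub> s)" using cell_mult_S_less s v by blast
      then have hc: "h \<in> cell (v \<otimes>\<^bsub>W\<^esub> s)" by (simp add: mult_inv_cancel)
      obtain y' z' where y': "adj s e f y' z'" "covers y' z' h"
        using panel_surjectivity [OF s lift_covers [OF ef] _ h(2)] by auto
      then have l': "lift h y' z'" using lift_step [OF ef v(3,1) s v(2) hc h(2)] by blast
      then have "equ y' z' y z" using lift_unique' h by simp
      then have "adj s y' z' y z" using equ_adj s lift_carrier [OF l'] by blast
      then show ?thesis using adj_trans s y' lift_carrier [OF ef] lift_carrier [OF l'] lift_carrier [OF h(1)] by blast
    qed
  qed
  have "(inv d \<otimes> g) \<otimes> (inv g \<otimes> g') \<in> para s" using para_mult s v gg by blast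
  then have "inv d \<otimes> g' \<in> para s" by (simp add: group_normalize)
  then have "adj s e f x' w'" using * l by blast
  moreover have "adj s x w e f" using * [OF l(1) v(4)] adj_sym s lift_carrier [OF ef] lift_carrier [OF l(1)] by blast
  ultimately show ?thesis using adj_trans s lift_carrier [OF ef] lift_carrier [OF l(1)] lift_carrier [OF l(2)] by blast
qed

section \<open>Connectedness and injectivity of the covering\<close>

inductive reach :: "'g \<Rightarrow> 'w \<Rightarrow> bool" where
  reach_base: "reach \<one> \<one>\<^bsub>W\<^esub>"
| reach_step: "reach x w \<Longrightarrow> s \<in> S \<Longrightarrow> adj s x w x' w' \<Longrightarrow> x' \<in> Uneg \<Longrightarrow> reach x' w'"

lemma reach_carrier: "reach x w \<Longrightarrow> x \<in> Uneg \<and> w \<in> carrier W"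
  by (induction rule: reach.induct) (auto simp: adj_def cox.S_carrier)

lemma reach_word:
  assumes "reach x w" "v \<in> carrier W"
  shows "reach x v"
proof -
  have "us \<in> lists S \<Longrightarrow> reach x (w \<otimes>\<^bsub>W\<^esub> word_prod W us)" for us
  proof (induction us rule: rev_induct)
    case Nil
    then show ?case using assms reach_carrier by simp
  next
    case (snoc s us)
    then have *: "reach x (w \<otimes>\<^bsub>W\<^esub> word_prod W us)" and us: "us \<in> lists S" "s \<in> S" by auto
    have "w \<otimes>\<^bsub>W\<^esub> word_prod W (us @ [s]) = w \<otimes>\<^bsub>W\<^esub> word_prod W us \<otimes>\<^bsub>W\<^esub> s"
      using us assms reach_carrier cox.S_carrier by (simp add: cox.m_assoc)
    then have "adj s x (w \<otimes>\<^bsub>W\<^esub> word_prod W us) x (w \<otimes>\<^bsub>W\<^esub> word_prod W (us @ [s]))"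
      using assms reach_carrier by (simp add: adj_def)
    then show ?case using reach_step [OF * us(2)] assms reach_carrier by blast
  qed
  moreover obtain us where "us \<in> lists S" "word_prod W us = inv\<^bsub>W\<^esub> w \<otimes>\<^bsub>W\<^esub> v"
    using cox.ex_word [of "inv\<^bsub>W\<^esub> w \<otimes>\<^bsub>W\<^esub> v"] reach_carrier assms by auto
  ultimately have "reach x (w \<otimes>\<^bsub>W\<^esub> (inv\<^bsub>W\<^esub> w \<otimes>\<^bsub>W\<^esub> v))" by metis
  then show ?thesis using reach_carrier assms by simp
qed

lemma reach_translate:
  assumes "reach x w" "reach y \<one>\<^bsub>W\<^esub>"
  shows "reach (y \<otimes> x) w"
  using assms(1)
proof (induction rule: reach.induct)
  case reach_base
  then show ?case using assms reach_carrier by simp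
next
  case (reach_step x w s x' w')
  have "adj s (y \<otimes> x) w (y \<otimes> x') w'"
    using adj_translate reach_step reach_carrier [OF assms(2)] reach_carrier [OF reach_step(1)] by auto
  then show ?case using reach.reach_step reach_step reach_carrier [OF assms(2)] by auto
qed

text \<open>For \<open>w\<close> in \<gamma> the pairs of 1 and of \<open>u\<close> with type
  \<open>w\<close> denote the same coset. A path therefore goes out from type 1 to type
  \<open>w\<close> with first entry 1, changes the entry to \<open>u\<close>, and returns to type
  1.\<close>

lemma reach_negative:
  assumes "\<gamma> \<in> cox.roots" "\<one>\<^bsub>W\<^esub> \<notin> \<gamma>" "u \<in> U \<gamma>"
  shows "reach u \<one>\<^bsub>W\<^esub>"
proof -
  obtain v s where v: "s \<in> S" "\<gamma> = v <#\<^bsub>W\<^esub> cox.simple_root s" using assms by (auto simp: cox.roots_def)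
  obtain w where w: "w \<in> carrier W" "w \<in> \<gamma>" using cox.root_nonempty assms by blast
  have uc: "u \<in> carrier G" using assms U_carrier by auto
  have u: "u \<in> Usep w \<one>\<^bsub>W\<^esub>" using U_Usep assms w by auto
  then have "u \<in> Usep (upper s w) \<one>\<^bsub>W\<^esub>" using Usep_between_mono [OF between_upper(1)] upper_carrier v w by blast
  then have "adj s \<one> w u w" using uc by (simp add: adj_def)
  moreover have "u \<in> Uneg" using u Usep_Uneg by auto
  ultimately have "reach u w" using reach_step [of \<one> w s u w] reach_word [OF reach_base w(1)] v by blast
  then show ?thesis using reach_word by auto
qed

lemma reach_all:
  assumes "x \<in> Uneg" "w \<in> carrier W"
  shows "reach x w"
proof -
  have "x \<otimes> \<one> \<in> {x. reach x \<one>\<^bsub>W\<^esub>}"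
  proof (rule generate_left_closed [OF root_gen_base [of "\<lambda>\<gamma>. \<one>\<^bsub>W\<^esub> \<notin> \<gamma>"]])
    show "inv h \<in> \<Union> (U ` {\<gamma> \<in> cox.roots. \<one>\<^bsub>W\<^esub> \<notin> \<gamma>})" if "h \<in> \<Union> (U ` {\<gamma> \<in> cox.roots. \<one>\<^bsub>W\<^esub> \<notin> \<gamma>})" for h
      using that U_inv by auto
    show "{x. reach x \<one>\<^bsub>W\<^esub>} \<subseteq> carrier G" using reach_carrier by auto
    show "x \<in> generate G (\<Union> (U ` {\<gamma> \<in> cox.roots. \<one>\<^bsub>W\<^esub> \<notin> \<gamma>}))"
      using assms by (simp add: Uneg_def root_gen_def)
    show "\<one> \<in> {x. reach x \<one>\<^bsub>W\<^esub>}" using reach_base by simp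
    show "h \<otimes> y \<in> {x. reach x \<one>\<^bsub>W\<^esub>}"
      if "h \<in> \<Union> (U ` {\<gamma> \<in> cox.roots. \<one>\<^bsub>W\<^esub> \<notin> \<gamma>})" "y \<in> {x. reach x \<one>\<^bsub>W\<^esub>}" for h y
      using that reach_negative reach_translate by auto
  qed
  then show ?thesis using assms reach_word by simp
qed

text \<open>Lifting inverts the projection to chambers: this holds at the base point and is carried
  along a path, since adjacent pairs project to adjacent chambers, lifts of these are adjacent, and
  the projection is injective on panels.\<close>

lemma lift_covers_unique:
  assumes "reach x w" "covers x w g" "lift g y z"
  shows "equ y z x w"
  using assms
proof (induction arbitrary: g y z rule: reach.induct)
  case reach_base
  then have "inv (\<one> \<otimes> \<one>) \<otimes> g \<in> B" using covers_rep [of \<one> "\<one>\<^bsub>W\<^esub>" g \<one>] by simp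
  then have "g \<in> B" using coversD [OF reach_base(1)] by simp
  then show ?case using lift_cell_one [OF reach_base(2)] by (simp add: equ_def)
next
  case (reach_step x w s x' w')
  have x: "x \<in> Uneg" "w \<in> carrier W" using reach_carrier reach_step by auto
  obtain n where n: "n \<in> N" "\<psi> n = w" using \<psi>_surj x by auto
  have cov: "covers x w (x \<otimes> n)" using x n by (intro coversI [of x w n \<one>]) auto
  obtain u where "u \<in> carrier W" "x \<otimes> n \<in> cell u" using carrier_cells coversD [OF cov] by metis
  then obtain e f where ef: "lift (x \<otimes> n) e f" using lift_exists by blast
  have "equ e f x w" using reach_step.IH [OF cov ef] .
  then have 1: "adj s e f x w" using equ_adj reach_step lift_carrier [OF ef] by blast
  have "inv (x \<otimes> n) \<otimes> g \<in> para s" using adj_covers [OF reach_step(2,3) cov] reach_step by blast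
  then have 2: "adj s e f y z" using lift_adj [OF reach_step(2) ef] reach_step by blast
  have carr: "e \<in> carrier G" "f \<in> carrier W" "x \<in> carrier G" "x' \<in> carrier G" "y \<in> carrier G" "z \<in> carrier W"
    using lift_carrier [OF ef] x reach_step lift_carrier by auto
  have "adj s e f x' w'" using adj_trans [OF reach_step(2) carr(2,1,3,4) 1 reach_step(3)] .
  moreover have "adj s y z e f" using adj_sym [OF reach_step(2) carr(2,1,5) 2] .
  ultimately have "adj s y z x' w'" using adj_trans [OF reach_step(2) carr(6,5,1,4)] by blast
  then show ?case using panel_injectivity [OF reach_step(2)] lift_covers reach_step by blast
qed

theorem covers_unique:
  assumes "covers x w g" "covers x' w' g"
  shows "equ x w x' w'"
proof -
  have D: "x \<in> Uneg" "w \<in> carrier W" "g \<in> carrier G" "x' \<in> Uneg" "w' \<in> carrier W"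
    using assms coversD by auto
  obtain u where "u \<in> carrier W" "g \<in> cell u" using carrier_cells D by metis
  then obtain y z where yz: "lift g y z" using lift_exists by blast
  have "equ y z x w" "equ y z x' w'" using lift_covers_unique reach_all D assms yz by blast+
  moreover have "x \<in> carrier G" "x' \<in> carrier G" "y \<in> carrier G" using D lift_carrier [OF yz] by auto
  ultimately show ?thesis using equ_sym equ_trans by blast
qed

theorem covers_exists:
  assumes "g \<in> carrier G"
  obtains x w where "covers x w g"
  using carrier_cells [OF assms] lift_exists lift_covers by metis

text \<open>The pairs of 1 and of \<open>x\<close> with type 1 lie over the same chamber, and the
  group attached to type 1 is trivial.\<close>

lemma Uneg_inter_B:
  assumes "x \<in> Uneg" "x \<in> B"
  shows "x = \<one>"
proof -
  have "covers \<one> \<one>\<^bsub>W\<^esub> x" "covers x \<one>\<^bsub>W\<^esub> x"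
    using assms by (auto intro: coversI [of _ _ \<one> x] coversI [of _ _ \<one> \<one>])
  then have "equ \<one> \<one>\<^bsub>W\<^esub> x \<one>\<^bsub>W\<^esub>" using covers_unique by blast
  then show ?thesis using assms by (simp add: equ_def Usep_trivial)
qed

section \<open>The system with the signs of the roots exchanged\<close>

lemma opposite_rgd_core: "rgd_core W S G (\<lambda>\<alpha>. U (cox.neg \<alpha>)) T N \<psi>"
proof (intro rgd_core.intro rgd_core_axioms.intro)
  fix \<alpha> assume \<alpha>: "\<alpha> \<in> cox.roots"
  show "subgroup (U (cox.neg \<alpha>)) G" "U (cox.neg \<alpha>) \<noteq> {\<one>}"
    using \<alpha> U_subgroup U_nontrivial cox.neg_in_roots by auto
next
  fix n \<alpha> u assume "n \<in> N" "\<alpha> \<in> cox.roots" "u \<in> U (cox.neg \<alpha>)"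
  then show "n \<otimes> u \<otimes> inv n \<in> U (cox.neg (\<psi> n <#\<^bsub>W\<^esub> \<alpha>))"
    using U_conj [of n "cox.neg \<alpha>" u] cox.neg_in_roots cox.l_coset_neg \<psi>_closed by metis
next
  fix \<alpha> \<beta> x y
  assume r: "\<alpha> \<in> cox.roots" "\<beta> \<in> cox.roots" "\<alpha> \<noteq> \<beta>" "cox.prenilpotent \<alpha> \<beta>"
    and xy: "x \<in> U (cox.neg \<alpha>)" "y \<in> U (cox.neg \<beta>)"
  have "cox.neg \<alpha> \<noteq> cox.neg \<beta>" using r cox.neg_neg by metis
  moreover have "cox.prenilpotent (cox.neg \<alpha>) (cox.neg \<beta>)"
    using r cox.neg_neg by (auto simp: cox.prenilpotent_def)
  ultimately have "x \<otimes> y \<otimes> inv x \<otimes> inv y \<in> generate G (\<Union>\<gamma> \<in> cox.open_interval (cox.neg \<alpha>) (cox.neg \<beta>). U \<gamma>)"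
    using r xy cox.neg_in_roots by (intro U_commutator) auto
  moreover have "(\<Union>\<gamma> \<in> cox.open_interval (cox.neg \<alpha>) (cox.neg \<beta>). U \<gamma>) \<subseteq> (\<Union>\<gamma> \<in> cox.open_interval \<alpha> \<beta>. U (cox.neg \<gamma>))"
  proof (intro UN_least)
    fix \<gamma> assume \<gamma>: "\<gamma> \<in> cox.open_interval (cox.neg \<alpha>) (cox.neg \<beta>)"
    then have "\<gamma> \<in> cox.roots" by (simp add: cox.open_interval_def)
    then have "cox.neg \<gamma> \<in> cox.open_interval \<alpha> \<beta>" "cox.neg (cox.neg \<gamma>) = \<gamma>"
      using \<gamma> r cox.neg_neg cox.neg_in_roots by (auto simp: cox.open_interval_def)
    then show "U \<gamma> \<subseteq> (\<Union>\<gamma> \<in> cox.open_interval \<alpha> \<beta>. U (cox.neg \<gamma>))"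
      using UN_upper [of "cox.neg \<gamma>" "cox.open_interval \<alpha> \<beta>" "\<lambda>\<gamma>. U (cox.neg \<gamma>)"] by simp
  qed
  ultimately show "x \<otimes> y \<otimes> inv x \<otimes> inv y \<in> generate G (\<Union>\<gamma> \<in> cox.open_interval \<alpha> \<beta>. U (cox.neg \<gamma>))"
    using mono_generate by blast
next
  have "(\<Union>\<alpha> \<in> cox.roots. U (cox.neg \<alpha>)) = (\<Union>\<alpha> \<in> cox.roots. U \<alpha>)"
  proof (intro equalityI UN_least)
    fix \<alpha> assume \<alpha>: "\<alpha> \<in> cox.roots"
    show "U (cox.neg \<alpha>) \<subseteq> (\<Union>\<alpha> \<in> cox.roots. U \<alpha>)" using cox.neg_in_roots [OF \<alpha>] by blast
    show "U \<alpha> \<subseteq> (\<Union>\<alpha> \<in> cox.roots. U (cox.neg \<alpha>))"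
      using UN_upper [of "cox.neg \<alpha>" cox.roots "\<lambda>\<alpha>. U (cox.neg \<alpha>)"] cox.neg_in_roots [OF \<alpha>] cox.neg_neg [OF \<alpha>] by simp
  qed
  then show "carrier G \<subseteq> generate G (N \<union> (\<Union>\<alpha> \<in> cox.roots. U (cox.neg \<alpha>)))"
    using generated by simp
next
  fix s u assume s: "s \<in> S" and u: "u \<noteq> \<one>"
  then have nn: "cox.neg (cox.neg (cox.simple_root s)) = cox.simple_root s"
    using cox.neg_neg cox.simple_root_in_roots by auto
  show "\<exists>a\<in>U (cox.neg (cox.neg (cox.simple_root s))). \<exists>b\<in>U (cox.neg (cox.neg (cox.simple_root s))). a \<otimes> u \<otimes> b \<in> N \<and> \<psi> (a \<otimes> u \<otimes> b) = s"
    if "u \<in> U (cox.neg (cox.simple_root s))"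
    using mu_neg s u that nn by simp
  show "\<exists>a\<in>U (cox.neg (cox.simple_root s)). \<exists>b\<in>U (cox.neg (cox.simple_root s)). a \<otimes> u \<otimes> b \<in> N \<and> \<psi> (a \<otimes> u \<otimes> b) = s"
    if "u \<in> U (cox.neg (cox.neg (cox.simple_root s)))"
    using mu_pos s u that nn by simp
qed (use N_subgroup \<psi>_closed \<psi>_mult \<psi>_surj T_eq cox.coxeter_system_axioms group_axioms in auto)

lemma opposite_root_gen: "rgd_core.root_gen W S G (\<lambda>\<alpha>. U (cox.neg \<alpha>)) P = root_gen (\<lambda>\<gamma>. P (cox.neg \<gamma>))"
proof -
  have "\<Union> ((\<lambda>\<alpha>. U (cox.neg \<alpha>)) ` {\<gamma> \<in> cox.roots. P \<gamma>}) = \<Union> (U ` {\<gamma> \<in> cox.roots. P (cox.neg \<gamma>)})"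
  proof (intro equalityI UN_least)
    fix \<gamma> assume "\<gamma> \<in> {\<gamma> \<in> cox.roots. P \<gamma>}"
    then have "cox.neg \<gamma> \<in> {\<gamma> \<in> cox.roots. P (cox.neg \<gamma>)}" using cox.neg_in_roots cox.neg_neg by simp
    then show "U (cox.neg \<gamma>) \<subseteq> \<Union> (U ` {\<gamma> \<in> cox.roots. P (cox.neg \<gamma>)})" by blast
  next
    fix \<gamma> assume "\<gamma> \<in> {\<gamma> \<in> cox.roots. P (cox.neg \<gamma>)}"
    then have "cox.neg \<gamma> \<in> {\<gamma> \<in> cox.roots. P \<gamma>}" "cox.neg (cox.neg \<gamma>) = \<gamma>"
      using cox.neg_in_roots cox.neg_neg by auto
    then show "U \<gamma> \<subseteq> \<Union> ((\<lambda>\<alpha>. U (cox.neg \<alpha>)) ` {\<gamma> \<in> cox.roots. P \<gamma>})"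
      using UN_upper [of "cox.neg \<gamma>" "{\<gamma> \<in> cox.roots. P \<gamma>}" "\<lambda>\<alpha>. U (cox.neg \<alpha>)"] by simp
  qed
  then show ?thesis unfolding rgd_core.root_gen_def [OF opposite_rgd_core] root_gen_def by simp
qed

lemma opposite_Upos: "rgd_core.Upos W S G (\<lambda>\<alpha>. U (cox.neg \<alpha>)) = Uneg"
  unfolding rgd_core.Upos_def [OF opposite_rgd_core] opposite_root_gen Uneg_def
  by (simp add: cox.neg_def)

lemma opposite_Uneg: "rgd_core.Uneg W S G (\<lambda>\<alpha>. U (cox.neg \<alpha>)) = Upos"
  unfolding rgd_core.Uneg_def [OF opposite_rgd_core] opposite_root_gen Upos_def
  by (simp add: cox.neg_def)

lemma opposite_rgd_bruhat: "rgd_bruhat W S G (\<lambda>\<alpha>. U (cox.neg \<alpha>)) T N \<psi>"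
proof -
  interpret opp: rgd_core W S G "\<lambda>\<alpha>. U (cox.neg \<alpha>)" T N \<psi> by (rule opposite_rgd_core)
  show ?thesis
  proof (intro rgd_bruhat.intro rgd_bruhat_axioms.intro opposite_rgd_core)
    fix s assume s: "s \<in> S"
    then have r: "cox.simple_root s \<in> cox.roots" using cox.simple_root_in_roots by auto
    show "\<not> U (cox.neg (cox.neg (cox.simple_root s))) \<subseteq> opp.Upos"
    proof
      assume "U (cox.neg (cox.neg (cox.simple_root s))) \<subseteq> opp.Upos"
      then have "U (cox.simple_root s) \<subseteq> Uneg" using r by (simp add: cox.neg_neg opposite_Upos)
      moreover have "U (cox.simple_root s) \<subseteq> B" using U_Upos [OF r] cox.one_in_simple_root s Upos_B by blast
      ultimately have "U (cox.simple_root s) \<subseteq> {\<one>}" using Uneg_inter_B by blast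
      then show False using U_nontrivial [OF r] U_one [OF r] by blast
    qed
  qed
qed

end

section \<open>Birkhoff decomposition and panels\<close>

context rgd_bruhat begin

interpretation opp: rgd_bruhat W S G "\<lambda>\<alpha>. U (cox.neg \<alpha>)" T N \<psi>
  rewrites "rgd_core.Upos W S G (\<lambda>\<alpha>. U (cox.neg \<alpha>)) = Uneg"
    and "rgd_core.Uneg W S G (\<lambda>\<alpha>. U (cox.neg \<alpha>)) = Upos"
  by (rule opposite_rgd_bruhat) (rule opposite_Upos, rule opposite_Uneg)

definition Bneg :: "'g set" where
  "Bneg = {t \<otimes> u | t u. t \<in> T \<and> u \<in> Uneg}"

lemma opposite_B: "opp.B = Bneg"
  unfolding opp.B_def Bneg_def ..

lemma Bneg_subgroup: "subgroup Bneg G"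
  using opp.B_subgroup by (simp add: opposite_B)

lemma Bneg_closed [simp]:
  "\<one> \<in> Bneg" "g \<in> Bneg \<Longrightarrow> h \<in> Bneg \<Longrightarrow> g \<otimes> h \<in> Bneg" "g \<in> Bneg \<Longrightarrow> inv g \<in> Bneg" "g \<in> Bneg \<Longrightarrow> g \<in> carrier G"
  using opp.B_one opp.B_mult opp.B_inv opp.B_carrier by (simp_all add: opposite_B)

lemma Uneg_Bneg: "x \<in> Uneg \<Longrightarrow> x \<in> Bneg"
  using opp.Upos_B by (simp add: opposite_B)

lemma T_Bneg: "t \<in> T \<Longrightarrow> t \<in> Bneg"
  using opp.T_B by (simp add: opposite_B)

lemma Bneg_cases:
  assumes "b \<in> Bneg"
  obtains x t where "x \<in> Uneg" "t \<in> T" "b = x \<otimes> t"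
  using opp.B_cases' [of b] assms by (auto simp: opposite_B)

lemma Upos_inter_Bneg: "u \<in> Upos \<Longrightarrow> u \<in> Bneg \<Longrightarrow> u = \<one>"
  using opp.Uneg_inter_B by (simp add: opposite_B)

lemma bruhat_neg_exists:
  assumes "g \<in> carrier G"
  obtains b n c where "b \<in> Bneg" "n \<in> N" "c \<in> Bneg" "g = b \<otimes> n \<otimes> c"
proof -
  obtain w where "w \<in> carrier W" "g \<in> opp.cell w" using opp.carrier_cells assms by metis
  then show thesis using that by (elim opp.cellE) (simp add: opposite_B)
qed

lemma bruhat_neg_unique:
  assumes "b \<in> Bneg" "n \<in> N" "c \<in> Bneg" "b' \<in> Bneg" "n' \<in> N" "c' \<in> Bneg" "b \<otimes> n \<otimes> c = b' \<otimes> n' \<otimes> c'"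
  shows "\<psi> n = \<psi> n'"
proof -
  have "b \<otimes> n \<otimes> c \<in> opp.cell (\<psi> n)" "b' \<otimes> n' \<otimes> c' \<in> opp.cell (\<psi> n')"
    using assms(1-6) by (auto intro!: opp.cellI simp: opposite_B)
  then show ?thesis using opp.cell_unique [of "\<psi> n" "\<psi> n'"] assms \<psi>_closed by simp
qed

text \<open>The covering describes products with the negative group on the left and \<open>B\<close>
  on the right; passing to inverses gives the order needed here.\<close>

lemma birkhoff_exists:
  assumes "g \<in> carrier G"
  obtains b n c where "b \<in> B" "n \<in> N" "c \<in> Bneg" "g = b \<otimes> n \<otimes> c"
proof -
  obtain x w where "covers x w (inv g)" using covers_exists [of "inv g"] assms by auto
  then obtain n where n: "x \<in> Uneg" "n \<in> N" "inv (x \<otimes> n) \<otimes> inv g \<in> B" by (auto simp: covers_def)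
  define b where "b = inv (x \<otimes> n) \<otimes> inv g"
  have "inv b \<otimes> inv n \<otimes> inv x = g" using n assms by (simp add: b_def group_normalize)
  moreover have "inv x \<in> Bneg" "inv b \<in> B" using n Uneg_Bneg by (auto simp: b_def)
  ultimately show thesis using that [of "inv b" "inv n" "inv x"] n by simp
qed

lemma birkhoff_unique:
  assumes "b \<in> B" "n \<in> N" "c \<in> Bneg" "b' \<in> B" "n' \<in> N" "c' \<in> Bneg" "b \<otimes> n \<otimes> c = b' \<otimes> n' \<otimes> c'"
  shows "\<psi> n = \<psi> n'"
proof -
  have *: "\<exists>x. covers x (inv\<^bsub>W\<^esub> \<psi> n) (inv (b \<otimes> n \<otimes> c))" if bnc: "b \<in> B" "n \<in> N" "c \<in> Bneg" for b n c
  proof -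
    obtain x t where x: "x \<in> Uneg" "t \<in> T" "inv c = x \<otimes> t" using Bneg_cases [of "inv c"] bnc by auto
    have "inv (b \<otimes> n \<otimes> c) = inv c \<otimes> inv n \<otimes> inv b" using bnc by (simp add: group_normalize)
    then have "inv (b \<otimes> n \<otimes> c) = x \<otimes> (t \<otimes> inv n) \<otimes> inv b" using bnc x by (simp add: m_assoc)
    then have "covers x (inv\<^bsub>W\<^esub> \<psi> n) (inv (b \<otimes> n \<otimes> c))"
      using bnc x \<psi>_closed by (intro coversI [of x _ "t \<otimes> inv n" "inv b"]) (auto simp: \<psi>_mult \<psi>_inv T_N T_\<psi>)
    then show ?thesis by blast
  qed
  obtain x where "covers x (inv\<^bsub>W\<^esub> \<psi> n) (inv (b \<otimes> n \<otimes> c))" using * assms by blast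
  moreover obtain x' where "covers x' (inv\<^bsub>W\<^esub> \<psi> n') (inv (b \<otimes> n \<otimes> c))" using * [of b' n' c'] assms by auto
  ultimately have "inv\<^bsub>W\<^esub> \<psi> n = inv\<^bsub>W\<^esub> \<psi> n'" using covers_unique by (auto simp: equ_def)
  then show ?thesis using \<psi>_closed assms by (metis cox.inv_inv)
qed

text \<open>The part of \<open>b\<close> coming from walls between 1 and \<open>\<psi> n\<close>
  becomes negative under conjugation and goes into \<open>c\<close>. What remains is positive on
  both sides of \<open>n\<close>, which later lets it be moved across \<open>n\<close> into
  \<open>B\<close>.\<close>

lemma N_conj_B_decomp:
  assumes "n \<in> N" "b \<in> B"
  obtains a c where "a \<in> Upos" "n \<otimes> a \<otimes> inv n \<in> Upos" "c \<in> Bneg" "inv n \<otimes> b = a \<otimes> c \<otimes> inv n"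
proof -
  obtain u t where ut: "u \<in> Upos" "t \<in> T" "b = u \<otimes> t" using B_cases' assms by metis
  obtain a z where az: "a \<in> Upos" "inv n \<otimes> a \<otimes> n \<in> Upos" "z \<in> Usep \<one>\<^bsub>W\<^esub> (\<psi> n)" "u = a \<otimes> z"
    using Upos_Usep_decomp [of "\<psi> n" n u] \<psi>_closed assms ut by metis
  have "inv n \<otimes> z \<otimes> n \<in> Usep (inv\<^bsub>W\<^esub> \<psi> n) \<one>\<^bsub>W\<^esub>"
    using az assms \<psi>_closed by (intro Usep_conj') auto
  then have "inv n \<otimes> z \<otimes> n \<in> Bneg" using Usep_Uneg Uneg_Bneg by blast
  moreover have "inv n \<otimes> t \<otimes> n \<in> Bneg" using T_conj' T_Bneg assms ut by auto
  ultimately have "(inv n \<otimes> z \<otimes> n) \<otimes> (inv n \<otimes> t \<otimes> n) \<in> Bneg" by simp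
  moreover have "inv n \<otimes> b = (inv n \<otimes> a \<otimes> n) \<otimes> ((inv n \<otimes> z \<otimes> n) \<otimes> (inv n \<otimes> t \<otimes> n)) \<otimes> inv n"
    using assms ut az by (simp add: group_normalize)
  moreover have "n \<otimes> (inv n \<otimes> a \<otimes> n) \<otimes> inv n \<in> Upos" using az assms by (simp add: group_normalize)
  ultimately show thesis using that az by blast
qed

text \<open>This is \<open>para_decomp\<close> for the opposite system, whose lower root group is
  that of the positive simple root. By the length condition \<open>n\<close> carries this root to a
  positive one, so the lower case can be absorbed into \<open>B\<close>.\<close>

lemma panel_neg_cases:
  assumes s: "s \<in> S" "m \<in> N" "\<psi> m = s" and n: "n \<in> N" "cox.len (\<psi> n) < cox.len (\<psi> n \<otimes>\<^bsub>W\<^esub> s)"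
    and a: "a \<in> Upos" "n \<otimes> a \<otimes> inv n \<in> Upos"
    and p: "p \<in> Bneg \<or> (\<exists>c \<in> Bneg. \<exists>m' \<in> N. \<exists>c' \<in> Bneg. \<psi> m' = s \<and> p = c \<otimes> m' \<otimes> c')"
  obtains (upper) c where "c \<in> Bneg" "p = m \<otimes> c"
  | (lower) b c where "b \<in> B" "c \<in> Bneg" "n \<otimes> a \<otimes> p = b \<otimes> n \<otimes> c"
proof -
  have r: "cox.simple_root s \<in> cox.roots" using s cox.simple_root_in_roots by auto
  have "p \<in> opp.para s"
    using p unfolding opp.para_def opp.cell_def opposite_B by blast
  from s(1) this s(2,3) show thesis
  proof (cases rule: opp.para_decomp)
    case (upper c)
    then show thesis using that(1) by (simp add: opposite_B)
  next
    case (lower y c)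
    then have y: "y \<in> U (cox.simple_root s)" and c: "c \<in> Bneg" using r by (simp_all add: cox.neg_neg opposite_B)
    have [simp]: "y \<in> carrier G" "c \<in> carrier G" using y c r U_carrier by auto
    have "n \<otimes> y \<otimes> inv n \<in> Upos"
      using U_Upos U_conj [OF n(1) r y] cox.l_coset_in_roots [of "\<psi> n"] r \<psi>_closed n s cox.one_mem_l_coset_simple_root by blast
    then have "(n \<otimes> a \<otimes> inv n) \<otimes> (n \<otimes> y \<otimes> inv n) \<in> B" using a by simp
    moreover have "n \<otimes> a \<otimes> p = ((n \<otimes> a \<otimes> inv n) \<otimes> (n \<otimes> y \<otimes> inv n)) \<otimes> n \<otimes> c"
      using lower n a by (simp add: group_normalize)
    ultimately show thesis using that(2) c by blast
  qed
qed

end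

lemma mem_double_coset:
  "x \<in> double_coset G H g K \<longleftrightarrow> (\<exists>h \<in> H. \<exists>k \<in> K. x = h \<otimes>\<^bsub>G\<^esub> g \<otimes>\<^bsub>G\<^esub> k)"
  by (auto simp: double_coset_def r_coset_def set_mult_def)

section \<open>From RGD systems to twin buildings\<close>

text \<open>
  Any two isomorphisms as in the definition of \<open>representatives\<close> agree, so one of them may be fixed.
  Its existence supplies the facts \<open>\<mu>\<^sub>s(u) T = \<mu>\<^sub>s(v) T\<close> that (RGD2) does not contain.
\<close>

locale rgd_rep = group G + rgd: rgd_system W S G U T
  for W :: "('w, 'x) monoid_scheme" and S and G :: "('g, 'y) monoid_scheme" (structure) and U T +
  fixes \<mu> :: "'w \<Rightarrow> 'g \<Rightarrow> 'g" and \<phi> :: "'g set \<Rightarrow> 'w"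
  assumes mu_family: "rgd.mu_family \<mu>"
    and \<phi>_iso: "\<phi> \<in> iso (G\<lparr>carrier := rgd.N_group \<mu>\<rparr> Mod T) W"
    and \<phi>_mu: "s \<in> S \<Longrightarrow> u \<in> U (rgd.simple_root s) - {\<one>} \<Longrightarrow> \<phi> (T #> \<mu> s u) = s"
begin

section \<open>Uniqueness and conjugates of the elements in (RGD2)\<close>

definition acts :: "'g \<Rightarrow> 'w \<Rightarrow> bool" where
  "acts g w \<longleftrightarrow> g \<in> carrier G \<and> (\<forall>\<alpha> \<in> rgd.roots. conj_set G g (U \<alpha>) = U (w <#\<^bsub>W\<^esub> \<alpha>))"

lemma U_subset: "\<alpha> \<in> rgd.roots \<Longrightarrow> U \<alpha> \<subseteq> carrier G"
  using rgd.U_subgroup subgroup.subset by blast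

lemma U_carrier: "\<alpha> \<in> rgd.roots \<Longrightarrow> u \<in> U \<alpha> \<Longrightarrow> u \<in> carrier G"
  using U_subset by blast

lemma acts_conj:
  assumes "acts g w" "\<alpha> \<in> rgd.roots" "u \<in> U \<alpha>"
  shows "g \<otimes> u \<otimes> inv g \<in> U (w <#\<^bsub>W\<^esub> \<alpha>)"
proof -
  have "g \<otimes> u \<otimes> inv g \<in> conj_set G g (U \<alpha>)" using assms U_subset by (simp add: conj_set_eq acts_def)
  then show ?thesis using assms by (simp add: acts_def)
qed

lemma acts_mult:
  assumes "acts g w" "acts h v" "w \<in> carrier W" "v \<in> carrier W"
  shows "acts (g \<otimes> h) (w \<otimes>\<^bsub>W\<^esub> v)"
  using assms U_subset rgd.l_coset_in_roots
  by (auto simp: acts_def conj_set_mult rgd.l_coset_comp)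

lemma acts_inv:
  assumes "acts g w" "w \<in> carrier W"
  shows "acts (inv g) (inv\<^bsub>W\<^esub> w)"
proof -
  have "conj_set G (inv g) (U \<alpha>) = U (inv\<^bsub>W\<^esub> w <#\<^bsub>W\<^esub> \<alpha>)" if \<alpha>: "\<alpha> \<in> rgd.roots" for \<alpha>
  proof (rule conj_set_inv_eq)
    have r: "inv\<^bsub>W\<^esub> w <#\<^bsub>W\<^esub> \<alpha> \<in> rgd.roots" using assms \<alpha> rgd.l_coset_in_roots by simp
    then show "U (inv\<^bsub>W\<^esub> w <#\<^bsub>W\<^esub> \<alpha>) \<subseteq> carrier G" by (rule U_subset)
    show "conj_set G g (U (inv\<^bsub>W\<^esub> w <#\<^bsub>W\<^esub> \<alpha>)) = U \<alpha>"
      using assms r \<alpha> by (simp add: acts_def rgd.l_coset_inv_cancel)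
    show "g \<in> carrier G" using assms by (simp add: acts_def)
  qed
  then show ?thesis using assms by (simp add: acts_def)
qed

lemma one_l_coset: "\<alpha> \<in> rgd.roots \<Longrightarrow> \<one>\<^bsub>W\<^esub> <#\<^bsub>W\<^esub> \<alpha> = \<alpha>"
  using rgd.lcos_mult_one rgd.root_subset by auto

lemma acts_T: "t \<in> T \<Longrightarrow> acts t \<one>\<^bsub>W\<^esub>"
  using rgd.RGD5 subgroup.mem_carrier [OF rgd.T_subgroup] by (simp add: acts_def one_l_coset)

lemma acts_simple_root:
  assumes "acts g s" "s \<in> S"
  shows "conj_set G g (U (rgd.simple_root s)) = U (rgd.neg (rgd.simple_root s))"
    and "conj_set G g (U (rgd.neg (rgd.simple_root s))) = U (rgd.simple_root s)"
  using assms rgd.simple_root_in_roots rgd.neg_in_roots by (auto simp: acts_def rgd.S_l_coset_simple_root)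

lemma mu_props:
  assumes "s \<in> S" "u \<in> U (rgd.simple_root s)" "u \<noteq> \<one>"
  shows "acts (\<mu> s u) s"
    and "\<exists>a \<in> U (rgd.neg (rgd.simple_root s)). \<exists>b \<in> U (rgd.neg (rgd.simple_root s)). \<mu> s u = a \<otimes> u \<otimes> b"
proof -
  have "rgd.mu_map s (\<mu> s)" using mu_family assms by (simp add: rgd.mu_family_def)
  then have m: "\<mu> s u \<in> double_coset G (U (rgd.neg (rgd.simple_root s))) u (U (rgd.neg (rgd.simple_root s)))"
    "\<forall>\<alpha>\<in>rgd.roots. conj_set G (\<mu> s u) (U \<alpha>) = U (s <#\<^bsub>W\<^esub> \<alpha>)"
    using assms by (auto simp: rgd.mu_map_def)
  then show *: "\<exists>a \<in> U (rgd.neg (rgd.simple_root s)). \<exists>b \<in> U (rgd.neg (rgd.simple_root s)). \<mu> s u = a \<otimes> u \<otimes> b"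
    by (simp add: mem_double_coset)
  have "u \<in> carrier G" "U (rgd.neg (rgd.simple_root s)) \<subseteq> carrier G"
    using assms U_subset rgd.simple_root_in_roots rgd.neg_in_roots by blast+
  then have "\<mu> s u \<in> carrier G" using * by (auto simp: subset_iff)
  then show "acts (\<mu> s u) s" using m by (simp add: acts_def)
qed

lemma U_simple_ne_neg:
  assumes "s \<in> S"
  shows "U (rgd.neg (rgd.simple_root s)) \<noteq> U (rgd.simple_root s)"
proof
  assume eq: "U (rgd.neg (rgd.simple_root s)) = U (rgd.simple_root s)"
  have "rgd.simple_root s \<in> rgd.pos_roots"
    using assms rgd.simple_root_in_roots rgd.one_in_simple_root by (simp add: rgd.pos_roots_def)
  then have "U (rgd.simple_root s) \<subseteq> rgd.U_plus"
    unfolding rgd.U_plus_def by (auto intro: generate.incl)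
  then show False using rgd.RGD3 [OF assms] eq by blast
qed

text \<open>\<open>\<mu> s u\<close> exchanges the two opposite root groups, so \<open>y\<close> is
  its conjugate of some \<open>v\<close>; conjugating the factorization of \<open>\<mu> s v\<close>
  exchanges the signs. This supplies \<open>mu_neg\<close> of the abstract setting.\<close>

lemma mu_neg_exists:
  assumes s: "s \<in> S" and y: "y \<in> U (rgd.neg (rgd.simple_root s))" "y \<noteq> \<one>"
  obtains u v a b where "u \<in> U (rgd.simple_root s)" "u \<noteq> \<one>" "v \<in> U (rgd.simple_root s)" "v \<noteq> \<one>"
    "a \<in> U (rgd.simple_root s)" "b \<in> U (rgd.simple_root s)"
    "\<mu> s u \<otimes> \<mu> s v \<otimes> inv (\<mu> s u) = a \<otimes> y \<otimes> b"
proof -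
  have r: "rgd.simple_root s \<in> rgd.roots" "rgd.neg (rgd.simple_root s) \<in> rgd.roots"
    using s rgd.simple_root_in_roots rgd.neg_in_roots by auto
  obtain u where u: "u \<in> U (rgd.simple_root s)" "u \<noteq> \<one>"
    using rgd.RGD0 [OF r(1)] subgroup.one_closed [OF rgd.U_subgroup [OF r(1)]] by blast
  have actsu: "acts (\<mu> s u) s" using mu_props s u by auto
  then have mu [simp]: "\<mu> s u \<in> carrier G" by (simp add: acts_def)
  have "y \<in> conj_set G (\<mu> s u) (U (rgd.simple_root s))" using acts_simple_root [OF actsu s] y by simp
  then obtain v where v: "v \<in> U (rgd.simple_root s)" "y = \<mu> s u \<otimes> v \<otimes> inv (\<mu> s u)"
    using U_subset r by (auto simp: conj_set_eq)
  then have "v \<noteq> \<one>" using y by auto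
  then obtain a b where ab: "a \<in> U (rgd.neg (rgd.simple_root s))" "b \<in> U (rgd.neg (rgd.simple_root s))" "\<mu> s v = a \<otimes> v \<otimes> b"
    using mu_props(2) s v by blast
  have [simp]: "a \<in> carrier G" "b \<in> carrier G" "v \<in> carrier G" using ab v r U_carrier by auto
  have conj: "\<mu> s u \<otimes> x \<otimes> inv (\<mu> s u) \<in> U (rgd.simple_root s)" if "x \<in> U (rgd.neg (rgd.simple_root s))" for x
    using acts_conj [OF actsu r(2) that] s by (simp add: rgd.S_l_coset_simple_root)
  have "\<mu> s u \<otimes> \<mu> s v \<otimes> inv (\<mu> s u) = (\<mu> s u \<otimes> a \<otimes> inv (\<mu> s u)) \<otimes> y \<otimes> (\<mu> s u \<otimes> b \<otimes> inv (\<mu> s u))"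
    by (simp add: v ab group_normalize)
  then show thesis using that [of u v] u v \<open>v \<noteq> \<one>\<close> conj ab by blast
qed

text \<open>A nontrivial such \<open>y\<close> would yield an element
  \<open>a \<otimes> y \<otimes> b\<close> that interchanges the two opposite root groups although
  each factor normalizes the positive one.\<close>

lemma neg_normalizer_trivial:
  assumes s: "s \<in> S" and y: "y \<in> U (rgd.neg (rgd.simple_root s))"
    and norm: "conj_set G y (U (rgd.simple_root s)) = U (rgd.simple_root s)"
  shows "y = \<one>"
proof (rule ccontr)
  assume "y \<noteq> \<one>"
  then obtain u v a b where uv: "u \<in> U (rgd.simple_root s)" "u \<noteq> \<one>" "v \<in> U (rgd.simple_root s)" "v \<noteq> \<one>"
    "a \<in> U (rgd.simple_root s)" "b \<in> U (rgd.simple_root s)" "\<mu> s u \<otimes> \<mu> s v \<otimes> inv (\<mu> s u) = a \<otimes> y \<otimes> b"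
    using mu_neg_exists s y by metis
  have r: "rgd.simple_root s \<in> rgd.roots" "rgd.neg (rgd.simple_root s) \<in> rgd.roots" and sW: "s \<in> carrier W"
    using s rgd.simple_root_in_roots rgd.neg_in_roots rgd.S_carrier by auto
  have "acts (\<mu> s u \<otimes> \<mu> s v \<otimes> inv (\<mu> s u)) (s \<otimes>\<^bsub>W\<^esub> s \<otimes>\<^bsub>W\<^esub> inv\<^bsub>W\<^esub> s)"
    using mu_props(1) s uv sW by (intro acts_mult acts_inv) auto
  then have "acts (a \<otimes> y \<otimes> b) s" using uv sW s by (simp add: rgd.S_inv)
  then have "conj_set G (a \<otimes> y \<otimes> b) (U (rgd.simple_root s)) = U (rgd.neg (rgd.simple_root s))"
    using acts_simple_root s by auto
  moreover have "conj_set G (a \<otimes> y \<otimes> b) (U (rgd.simple_root s)) = U (rgd.simple_root s)"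
    using uv y r norm U_carrier U_subset conj_set_self [OF rgd.U_subgroup [OF r(1)]]
    by (simp add: conj_set_mult)
  ultimately show False using U_simple_ne_neg [OF s] by metis
qed

lemma pos_normalizer_trivial:
  assumes s: "s \<in> S" and u: "u \<in> U (rgd.simple_root s)"
    and norm: "conj_set G u (U (rgd.neg (rgd.simple_root s))) = U (rgd.neg (rgd.simple_root s))"
  shows "u = \<one>"
proof (rule ccontr)
  assume "u \<noteq> \<one>"
  then obtain a b where ab: "a \<in> U (rgd.neg (rgd.simple_root s))" "b \<in> U (rgd.neg (rgd.simple_root s))" "\<mu> s u = a \<otimes> u \<otimes> b"
    using mu_props s u by blast
  have r: "rgd.simple_root s \<in> rgd.roots" "rgd.neg (rgd.simple_root s) \<in> rgd.roots"
    using s rgd.simple_root_in_roots rgd.neg_in_roots by auto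
  have "conj_set G (\<mu> s u) (U (rgd.neg (rgd.simple_root s))) = U (rgd.simple_root s)"
    using acts_simple_root mu_props s u \<open>u \<noteq> \<one>\<close> by auto
  moreover have "conj_set G (\<mu> s u) (U (rgd.neg (rgd.simple_root s))) = U (rgd.neg (rgd.simple_root s))"
    using ab u r norm U_carrier U_subset conj_set_self [OF rgd.U_subgroup [OF r(2)]]
    by (simp add: conj_set_mult)
  ultimately show False using U_simple_ne_neg s by simp
qed

text \<open>The quotient \<open>k\<close> of the two candidates normalizes every root group and
  equals \<open>c \<otimes> d\<close>, with factors from opposite root groups. Hence
  \<open>c\<close> normalizes the positive and \<open>d\<close> the negative simple root group, and
  both are trivial.\<close>

lemma mu_unique:
  assumes s: "s \<in> S" and u: "u \<in> U (rgd.simple_root s)"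
    and m: "acts m s" "a \<in> U (rgd.neg (rgd.simple_root s))" "b \<in> U (rgd.neg (rgd.simple_root s))" "m = a \<otimes> u \<otimes> b"
    and m': "acts m' s" "a' \<in> U (rgd.neg (rgd.simple_root s))" "b' \<in> U (rgd.neg (rgd.simple_root s))" "m' = a' \<otimes> u \<otimes> b'"
  shows "m = m'"
proof -
  have r: "rgd.simple_root s \<in> rgd.roots" "rgd.neg (rgd.simple_root s) \<in> rgd.roots" and sW: "s \<in> carrier W"
    using s rgd.simple_root_in_roots rgd.neg_in_roots rgd.S_carrier by auto
  note subs = rgd.U_subgroup [OF r(1)] rgd.U_subgroup [OF r(2)]
  have [simp]: "a \<in> carrier G" "b \<in> carrier G" "a' \<in> carrier G" "b' \<in> carrier G" "u \<in> carrier G" "m \<in> carrier G" "m' \<in> carrier G"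
    using m m' u r U_carrier by auto
  define c where "c = a' \<otimes> inv a"
  define d where "d = m \<otimes> (inv b \<otimes> b') \<otimes> inv m"
  define k where "k = m' \<otimes> inv m"
  have c: "c \<in> U (rgd.neg (rgd.simple_root s))" using m m' subs by (auto simp: c_def subgroup.m_closed subgroup.m_inv_closed)
  have "inv b \<otimes> b' \<in> U (rgd.neg (rgd.simple_root s))" using m m' subs by (auto simp: subgroup.m_closed subgroup.m_inv_closed)
  then have d: "d \<in> U (rgd.simple_root s)"
    using acts_conj [OF m(1) r(2)] s by (simp add: d_def rgd.S_l_coset_simple_root)
  have [simp]: "c \<in> carrier G" "d \<in> carrier G" "k \<in> carrier G" by (simp_all add: c_def d_def k_def)
  have k: "k = c \<otimes> d" by (simp add: k_def c_def d_def m m' group_normalize)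
  have "acts k (s \<otimes>\<^bsub>W\<^esub> inv\<^bsub>W\<^esub> s)" unfolding k_def using m m' sW by (intro acts_mult acts_inv) auto
  then have k1: "conj_set G k (U \<alpha>) = U \<alpha>" if "\<alpha> \<in> rgd.roots" for \<alpha>
    using that sW by (simp add: acts_def one_l_coset)
  have "c = k \<otimes> inv d" "d = inv c \<otimes> k" by (simp_all add: k group_normalize)
  have "conj_set G c (U (rgd.simple_root s)) = U (rgd.simple_root s)"
    using d subs k1 r U_subset by (subst \<open>c = k \<otimes> inv d\<close>) (simp add: conj_set_mult conj_set_self subgroup.m_inv_closed)
  then have "c = \<one>" using neg_normalizer_trivial s c by auto
  have "conj_set G d (U (rgd.neg (rgd.simple_root s))) = U (rgd.neg (rgd.simple_root s))"
    using c subs k1 r U_subset by (subst \<open>d = inv c \<otimes> k\<close>) (simp add: conj_set_mult conj_set_self subgroup.m_inv_closed)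
  then have "d = \<one>" using pos_normalizer_trivial s d by auto
  then have "k = \<one>" using k \<open>c = \<one>\<close> by simp
  then have "k \<otimes> m = m" by simp
  then show ?thesis by (simp add: k_def group_normalize)
qed

text \<open>The inverse has the defining properties of the value at \<open>inv u\<close>. The set of
  all values is thus closed under inverses.\<close>

lemma mu_inv:
  assumes s: "s \<in> S" and u: "u \<in> U (rgd.simple_root s)" "u \<noteq> \<one>"
  shows "inv (\<mu> s u) = \<mu> s (inv u)"
proof -
  have r: "rgd.simple_root s \<in> rgd.roots" "rgd.neg (rgd.simple_root s) \<in> rgd.roots" and sW: "s \<in> carrier W"
    using s rgd.simple_root_in_roots rgd.neg_in_roots rgd.S_carrier by auto
  note subs = rgd.U_subgroup [OF r(1)] rgd.U_subgroup [OF r(2)]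
  obtain a b where ab: "a \<in> U (rgd.neg (rgd.simple_root s))" "b \<in> U (rgd.neg (rgd.simple_root s))" "\<mu> s u = a \<otimes> u \<otimes> b"
    using mu_props s u by blast
  have uc: "u \<in> carrier G" using u r U_carrier by auto
  have u': "inv u \<in> U (rgd.simple_root s)" "inv u \<noteq> \<one>" using u subs uc by (auto simp: subgroup.m_inv_closed)
  obtain a' b' where ab': "a' \<in> U (rgd.neg (rgd.simple_root s))" "b' \<in> U (rgd.neg (rgd.simple_root s))" "\<mu> s (inv u) = a' \<otimes> inv u \<otimes> b'"
    using mu_props s u' by blast
  have [simp]: "a \<in> carrier G" "b \<in> carrier G" using ab r U_carrier by auto
  show ?thesis
  proof (rule mu_unique [OF s u'(1) _ _ _ _ mu_props(1) [OF s u'] ab'])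
    show "acts (inv (\<mu> s u)) s" using acts_inv [OF mu_props(1) [OF s u] sW] s by (simp add: rgd.S_inv)
    show "inv (\<mu> s u) = inv b \<otimes> inv u \<otimes> inv a" using uc by (simp add: ab group_normalize)
  qed (use ab subs in \<open>auto simp: subgroup.m_inv_closed\<close>)
qed

text \<open>Conjugation by \<open>t\<close> preserves every root group, hence the defining
  properties. That conjugates of values under \<open>T\<close> are again values is the source of
  normality of \<open>T\<close> in N.\<close>

lemma mu_T_conj:
  assumes s: "s \<in> S" and u: "u \<in> U (rgd.simple_root s)" "u \<noteq> \<one>" and t: "t \<in> T"
  shows "t \<otimes> u \<otimes> inv t \<in> U (rgd.simple_root s)" "t \<otimes> u \<otimes> inv t \<noteq> \<one>"
    and "t \<otimes> \<mu> s u \<otimes> inv t = \<mu> s (t \<otimes> u \<otimes> inv t)"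
proof -
  have r: "rgd.simple_root s \<in> rgd.roots" "rgd.neg (rgd.simple_root s) \<in> rgd.roots" and sW: "s \<in> carrier W"
    using s rgd.simple_root_in_roots rgd.neg_in_roots rgd.S_carrier by auto
  have tc [simp]: "t \<in> carrier G" and uc [simp]: "u \<in> carrier G"
    using t u r U_carrier subgroup.mem_carrier [OF rgd.T_subgroup] by auto
  show u': "t \<otimes> u \<otimes> inv t \<in> U (rgd.simple_root s)"
    using acts_conj [OF acts_T [OF t] r(1) u(1)] r by (simp add: one_l_coset)
  show u'': "t \<otimes> u \<otimes> inv t \<noteq> \<one>"
  proof
    assume "t \<otimes> u \<otimes> inv t = \<one>"
    then have "inv t \<otimes> (t \<otimes> u \<otimes> inv t) \<otimes> t = \<one>" by simp
    then show False using u by (simp add: group_normalize)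
  qed
  obtain a b where ab: "a \<in> U (rgd.neg (rgd.simple_root s))" "b \<in> U (rgd.neg (rgd.simple_root s))" "\<mu> s u = a \<otimes> u \<otimes> b"
    using mu_props s u by blast
  obtain a' b' where ab': "a' \<in> U (rgd.neg (rgd.simple_root s))" "b' \<in> U (rgd.neg (rgd.simple_root s))"
      "\<mu> s (t \<otimes> u \<otimes> inv t) = a' \<otimes> (t \<otimes> u \<otimes> inv t) \<otimes> b'"
    using mu_props s u' u'' by blast
  have [simp]: "a \<in> carrier G" "b \<in> carrier G" using ab r U_carrier by auto
  show "t \<otimes> \<mu> s u \<otimes> inv t = \<mu> s (t \<otimes> u \<otimes> inv t)"
  proof (rule mu_unique [OF s u' _ _ _ _ mu_props(1) [OF s u' u''] ab'])
    have "acts (t \<otimes> \<mu> s u \<otimes> inv t) (\<one>\<^bsub>W\<^esub> \<otimes>\<^bsub>W\<^esub> s \<otimes>\<^bsub>W\<^esub> inv\<^bsub>W\<^esub> \<one>\<^bsub>W\<^esub>)"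
      using acts_T [OF t] mu_props(1) [OF s u] sW by (intro acts_mult acts_inv) auto
    then show "acts (t \<otimes> \<mu> s u \<otimes> inv t) s" using sW by simp
    show "t \<otimes> a \<otimes> inv t \<in> U (rgd.neg (rgd.simple_root s))" "t \<otimes> b \<otimes> inv t \<in> U (rgd.neg (rgd.simple_root s))"
      using acts_conj [OF acts_T [OF t] r(2)] ab r by (simp_all add: one_l_coset)
    show "t \<otimes> \<mu> s u \<otimes> inv t = (t \<otimes> a \<otimes> inv t) \<otimes> (t \<otimes> u \<otimes> inv t) \<otimes> (t \<otimes> b \<otimes> inv t)"
      by (simp add: ab group_normalize)
  qed
qed

section \<open>The group N and its homomorphism onto W\<close>

abbreviation N :: "'g set" where
  "N \<equiv> rgd.N_group \<mu>"

definition \<psi> :: "'g \<Rightarrow> 'w" where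
  "\<psi> n = \<phi> (T #> n)"

definition mu_values :: "'g set" where
  "mu_values = {\<mu> s u | s u. s \<in> S \<and> u \<in> U (rgd.simple_root s) - {\<one>}}"

lemma mu_values_carrier: "mu_values \<subseteq> carrier G"
  using mu_props(1) by (auto simp: mu_values_def acts_def)

lemma mu_values_inv:
  assumes "m \<in> mu_values"
  shows "inv m \<in> mu_values"
proof -
  obtain s u where m: "s \<in> S" "u \<in> U (rgd.simple_root s)" "u \<noteq> \<one>" "m = \<mu> s u"
    using assms by (auto simp: mu_values_def)
  have r: "rgd.simple_root s \<in> rgd.roots" using m rgd.simple_root_in_roots by auto
  have "inv u \<in> U (rgd.simple_root s)" using m subgroup.m_inv_closed [OF rgd.U_subgroup [OF r]] by auto
  moreover have "inv u \<noteq> \<one>" using m U_carrier r by simp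
  ultimately show ?thesis using m mu_inv [OF m(1-3)] unfolding mu_values_def by blast
qed

lemma T_carrier [simp]: "t \<in> T \<Longrightarrow> t \<in> carrier G"
  using subgroup.mem_carrier [OF rgd.T_subgroup] .

lemma T_closed [simp]:
  "\<one> \<in> T" "t \<in> T \<Longrightarrow> t' \<in> T \<Longrightarrow> t \<otimes> t' \<in> T" "t \<in> T \<Longrightarrow> inv t \<in> T"
  using rgd.T_subgroup by (auto simp: subgroup.one_closed subgroup.m_closed subgroup.m_inv_closed)

lemma N_eq: "N = {t \<otimes> m | t m. t \<in> T \<and> m \<in> generate G mu_values}"
  unfolding rgd.N_group_def mu_values_def set_mult_def by auto

lemma generate_mu_carrier: "m \<in> generate G mu_values \<Longrightarrow> m \<in> carrier G"
  using generate_in_carrier [OF mu_values_carrier] .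

lemma N_carrier [simp]: "n \<in> N \<Longrightarrow> n \<in> carrier G"
  by (auto simp: N_eq generate_mu_carrier)

lemma generate_mu_N: "m \<in> generate G mu_values \<Longrightarrow> m \<in> N"
  unfolding N_eq by (rule CollectI, intro exI [of _ \<one>] exI [of _ m]) (simp add: generate_mu_carrier)

lemma mu_N: "s \<in> S \<Longrightarrow> u \<in> U (rgd.simple_root s) \<Longrightarrow> u \<noteq> \<one> \<Longrightarrow> \<mu> s u \<in> N"
  by (rule generate_mu_N, rule generate.incl) (auto simp: mu_values_def)

lemma T_N: "t \<in> T \<Longrightarrow> t \<in> N"
  unfolding N_eq by (rule CollectI, intro exI [of _ t] exI [of _ \<one>]) (simp add: generate.one)

lemma carrier_N_mod_T: "carrier (G\<lparr>carrier := N\<rparr> Mod T) = (\<lambda>n. T #> n) ` N"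
  by (auto simp: FactGroup_def RCOSETS_def r_coset_def)

text \<open>Injectivity of \<phi> on right cosets is enough here; normality of \<open>T\<close> in N
  is derived from it only afterwards.\<close>

lemma \<psi>_inj: "n \<in> N \<Longrightarrow> n' \<in> N \<Longrightarrow> \<psi> n = \<psi> n' \<Longrightarrow> n \<otimes> inv n' \<in> T"
proof -
  assume n: "n \<in> N" "n' \<in> N" "\<psi> n = \<psi> n'"
  have "inj_on \<phi> (carrier (G\<lparr>carrier := N\<rparr> Mod T))"
    using \<phi>_iso by (auto simp: iso_def bij_betw_def)
  then have "T #> n = T #> n'"
    using n unfolding carrier_N_mod_T \<psi>_def by (auto dest: inj_onD)
  moreover have "n \<in> T #> n" unfolding r_coset_def using n by (auto intro!: bexI [of _ \<one>])
  ultimately have "n \<in> T #> n'" by simp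
  then obtain t where "t \<in> T" "n = t \<otimes> n'" by (auto simp: r_coset_def)
  then show ?thesis using n by (simp add: group_normalize)
qed

lemma \<psi>_mu: "s \<in> S \<Longrightarrow> u \<in> U (rgd.simple_root s) \<Longrightarrow> u \<noteq> \<one> \<Longrightarrow> \<psi> (\<mu> s u) = s"
  using \<phi>_mu by (simp add: \<psi>_def)

text \<open>Conjugating \<open>m\<close> by the inverse of \<open>t\<close> gives another value for
  the same s, which \<phi> cannot distinguish from \<open>m\<close>. Their quotient lies in
  \<open>T\<close>, and multiplied by \<open>t\<close> it is the conjugate in question.\<close>

lemma mu_conj_T:
  assumes "m \<in> mu_values" "t \<in> T"
  shows "m \<otimes> t \<otimes> inv m \<in> T"
proof -
  obtain s u where m: "s \<in> S" "u \<in> U (rgd.simple_root s)" "u \<noteq> \<one>" "m = \<mu> s u"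
    using assms by (auto simp: mu_values_def)
  define v where "v = inv t \<otimes> u \<otimes> inv (inv t)"
  have v: "v \<in> U (rgd.simple_root s)" "v \<noteq> \<one>" "inv t \<otimes> m \<otimes> inv (inv t) = \<mu> s v"
    using mu_T_conj [OF m(1-3), of "inv t"] assms m by (auto simp: v_def)
  have "\<mu> s v \<otimes> inv m \<in> T"
    using \<psi>_inj [of "\<mu> s v" m] mu_N \<psi>_mu m v by simp
  then have "t \<otimes> (\<mu> s v \<otimes> inv m) \<in> T" using assms by simp
  moreover have "m \<in> carrier G" using assms mu_values_carrier by auto
  ultimately show ?thesis using assms by (simp flip: v(3) add: group_normalize)
qed

lemma generate_mu_conj_T:
  assumes "m \<in> generate G mu_values" "t \<in> T"
  shows "m \<otimes> t \<otimes> inv m \<in> T"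
  using assms
proof (induction arbitrary: t rule: generate.induct)
  case one
  then show ?case by simp
next
  case (incl h)
  then show ?case by (rule mu_conj_T)
next
  case (inv h)
  then show ?case using mu_conj_T [OF mu_values_inv] by blast
next
  case (eng h1 h2)
  then have "h1 \<otimes> (h2 \<otimes> t \<otimes> inv h2) \<otimes> inv h1 \<in> T" by blast
  then show ?case using eng generate_mu_carrier by (simp add: group_normalize)
qed

lemma N_conj_T:
  assumes "n \<in> N" "t \<in> T"
  shows "n \<otimes> t \<otimes> inv n \<in> T"
proof -
  obtain t' m where n: "t' \<in> T" "m \<in> generate G mu_values" "n = t' \<otimes> m" using assms by (auto simp: N_eq)
  then have "t' \<otimes> (m \<otimes> t \<otimes> inv m) \<otimes> inv t' \<in> T" using generate_mu_conj_T assms by simp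
  then show ?thesis using n assms generate_mu_carrier by (simp add: group_normalize)
qed

lemma N_subgroup: "subgroup N G"
proof (rule subgroupI)
  show "N \<subseteq> carrier G" by auto
  show "N \<noteq> {}" using T_N [of \<one>] by auto
next
  fix n assume "n \<in> N"
  then obtain t m where n: "t \<in> T" "m \<in> generate G mu_values" "n = t \<otimes> m" by (auto simp: N_eq)
  have m': "inv m \<in> generate G mu_values" using n generate_m_inv_closed mu_values_carrier by auto
  then have "inv m \<otimes> inv t \<otimes> inv (inv m) \<in> T" using n generate_mu_conj_T by simp
  moreover have "inv n = (inv m \<otimes> inv t \<otimes> inv (inv m)) \<otimes> inv m"
    using n generate_mu_carrier by (simp add: group_normalize)
  ultimately show "inv n \<in> N" using m' unfolding N_eq by blast
next
  fix n n' assume "n \<in> N" "n' \<in> N"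
  then obtain t m t' m' where n: "t \<in> T" "m \<in> generate G mu_values" "n = t \<otimes> m"
      "t' \<in> T" "m' \<in> generate G mu_values" "n' = t' \<otimes> m'" by (auto simp: N_eq)
  have "t \<otimes> (m \<otimes> t' \<otimes> inv m) \<in> T" using n generate_mu_conj_T by simp
  moreover have "m \<otimes> m' \<in> generate G mu_values" using generate.eng [OF n(2,5)] .
  moreover have "n \<otimes> n' = (t \<otimes> (m \<otimes> t' \<otimes> inv m)) \<otimes> (m \<otimes> m')"
    using n generate_mu_carrier by (simp add: group_normalize)
  ultimately show "n \<otimes> n' \<in> N" unfolding N_eq by blast
qed

lemma N_closed [simp]:
  "\<one> \<in> N" "n \<in> N \<Longrightarrow> n' \<in> N \<Longrightarrow> n \<otimes> n' \<in> N" "n \<in> N \<Longrightarrow> inv n \<in> N"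
  using N_subgroup by (auto simp: subgroup.one_closed subgroup.m_closed subgroup.m_inv_closed)

lemma T_coset_mult:
  assumes "n \<in> N" "n' \<in> N"
  shows "(T #> n) <#>\<^bsub>G\<lparr>carrier := N\<rparr>\<^esub> (T #> n') = T #> (n \<otimes> n')"
proof (intro equalityI subsetI)
  fix x assume "x \<in> (T #> n) <#>\<^bsub>G\<lparr>carrier := N\<rparr>\<^esub> (T #> n')"
  then obtain t t' where t: "t \<in> T" "t' \<in> T" "x = (t \<otimes> n) \<otimes> (t' \<otimes> n')"
    by (auto simp: r_coset_def set_mult_def)
  then have "x = (t \<otimes> (n \<otimes> t' \<otimes> inv n)) \<otimes> (n \<otimes> n')" using assms by (simp add: group_normalize)
  moreover have "t \<otimes> (n \<otimes> t' \<otimes> inv n) \<in> T" using N_conj_T assms t by simp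
  ultimately show "x \<in> T #> (n \<otimes> n')" unfolding r_coset_def by blast
next
  fix x assume "x \<in> T #> (n \<otimes> n')"
  then obtain t where t: "t \<in> T" "x = t \<otimes> (n \<otimes> n')" by (auto simp: r_coset_def)
  then have "x = (t \<otimes> n) \<otimes> (\<one> \<otimes> n')" using assms by (simp add: group_normalize)
  then show "x \<in> (T #> n) <#>\<^bsub>G\<lparr>carrier := N\<rparr>\<^esub> (T #> n')"
    using t(1) T_closed(1) unfolding r_coset_def set_mult_def by fastforce
qed

lemma \<psi>_mult:
  assumes "n \<in> N" "n' \<in> N"
  shows "\<psi> (n \<otimes> n') = \<psi> n \<otimes>\<^bsub>W\<^esub> \<psi> n'"
proof -
  have "\<phi> \<in> hom (G\<lparr>carrier := N\<rparr> Mod T) W" using \<phi>_iso by (simp add: iso_def)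
  then have "\<phi> ((T #> n) \<otimes>\<^bsub>G\<lparr>carrier := N\<rparr> Mod T\<^esub> (T #> n')) = \<phi> (T #> n) \<otimes>\<^bsub>W\<^esub> \<phi> (T #> n')"
    using assms by (intro hom_mult) (auto simp: carrier_N_mod_T)
  moreover have "(T #> n) \<otimes>\<^bsub>G\<lparr>carrier := N\<rparr> Mod T\<^esub> (T #> n') = T #> (n \<otimes> n')"
    using T_coset_mult [OF assms] by (simp add: FactGroup_def)
  ultimately show ?thesis by (simp add: \<psi>_def)
qed

lemma \<psi>_bij: "\<phi> ` (\<lambda>n. T #> n) ` N = carrier W"
  using \<phi>_iso unfolding iso_def bij_betw_def carrier_N_mod_T [symmetric] by auto

lemma \<psi>_closed: "n \<in> N \<Longrightarrow> \<psi> n \<in> carrier W"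
  using \<psi>_bij by (auto simp: \<psi>_def)

lemma \<psi>_surj: "w \<in> carrier W \<Longrightarrow> \<exists>n \<in> N. \<psi> n = w"
  using \<psi>_bij by (metis (no_types, lifting) \<psi>_def imageE)

lemma \<psi>_one: "\<psi> \<one> = \<one>\<^bsub>W\<^esub>"
proof -
  have "\<psi> \<one> \<otimes>\<^bsub>W\<^esub> \<psi> \<one> = \<psi> \<one>" using \<psi>_mult [of \<one> \<one>] by simp
  then show ?thesis using \<psi>_closed [of \<one>] by simp
qed

lemma \<psi>_T: "t \<in> T \<Longrightarrow> \<psi> t = \<one>\<^bsub>W\<^esub>"
proof -
  assume "t \<in> T"
  then have "T #> t = T #> \<one>"
    using coset_join2 [of t T] coset_join2 [of \<one> T] rgd.T_subgroup by auto
  then show ?thesis using \<psi>_one by (simp add: \<psi>_def)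
qed

lemma T_kernel: "T = {n \<in> N. \<psi> n = \<one>\<^bsub>W\<^esub>}"
  using \<psi>_inj [of _ \<one>] \<psi>_T \<psi>_one T_N by auto

lemma acts_N:
  assumes "n \<in> N"
  shows "acts n (\<psi> n)"
proof -
  have gen: "acts m (\<psi> m)" if "m \<in> mu_values" for m
    using that mu_props(1) \<psi>_mu by (auto simp: mu_values_def)
  have "acts m (\<psi> m)" if "m \<in> generate G mu_values" for m
    using that
  proof (induction rule: generate.induct)
    case one
    then show ?case using acts_T [of \<one>] by (simp add: \<psi>_one)
  next
    case (eng h1 h2)
    then show ?case using acts_mult generate_mu_N \<psi>_closed by (simp add: \<psi>_mult)
  qed (use gen mu_values_inv in auto)
  moreover obtain t m where n: "t \<in> T" "m \<in> generate G mu_values" "n = t \<otimes> m" using assms by (auto simp: N_eq)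
  ultimately have "acts n (\<one>\<^bsub>W\<^esub> \<otimes>\<^bsub>W\<^esub> \<psi> m)"
    using acts_mult [OF acts_T] \<psi>_closed generate_mu_N by simp
  then show ?thesis using n \<psi>_mult T_N generate_mu_N \<psi>_T by simp
qed

lemma \<psi>_independent:
  assumes "rgd_rep W S G U T \<mu> \<phi>'" "n \<in> N"
  shows "\<phi>' (T #> n) = \<psi> n"
proof -
  interpret other: rgd_rep W S G U T \<mu> \<phi>' by fact
  have gen: "other.\<psi> m = \<psi> m" if "m \<in> mu_values" for m
    using that \<psi>_mu other.\<psi>_mu by (auto simp: mu_values_def)
  have "other.\<psi> m = \<psi> m" if "m \<in> generate G mu_values" for m
    using that
  proof (induction rule: generate.induct)
    case one
    then show ?case by (simp add: \<psi>_one other.\<psi>_one)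
  next
    case (eng h1 h2)
    then show ?case using generate_mu_N by (simp add: \<psi>_mult other.\<psi>_mult)
  qed (use gen mu_values_inv in auto)
  moreover obtain t m where "t \<in> T" "m \<in> generate G mu_values" "n = t \<otimes> m" using assms by (auto simp: N_eq)
  ultimately have "other.\<psi> n = \<psi> n"
    by (simp add: \<psi>_mult other.\<psi>_mult T_N generate_mu_N \<psi>_T other.\<psi>_T)
  then show ?thesis by (simp add: other.\<psi>_def)
qed

lemma representatives_eq: "rgd.representatives \<mu> w = {n \<in> N. \<psi> n = w}"
proof (intro equalityI subsetI)
  fix n assume "n \<in> {n \<in> N. \<psi> n = w}"
  then show "n \<in> rgd.representatives \<mu> w"
    using \<phi>_iso \<phi>_mu unfolding rgd.representatives_def \<psi>_def by blast
next
  fix n assume "n \<in> rgd.representatives \<mu> w"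
  then obtain \<phi>' where n: "n \<in> N" "\<phi>' (T #> n) = w"
    and *: "\<phi>' \<in> iso (G\<lparr>carrier := N\<rparr> Mod T) W"
      "\<forall>s \<in> S. \<forall>u \<in> U (rgd.simple_root s) - {\<one>}. \<phi>' (T #> \<mu> s u) = s"
    unfolding rgd.representatives_def by blast
  have "rgd_rep W S G U T \<mu> \<phi>'"
    using * mu_family by (intro rgd_rep.intro rgd_rep_axioms.intro group_axioms rgd.rgd_system_axioms) auto
  then show "n \<in> {n \<in> N. \<psi> n = w}" using n \<psi>_independent by auto
qed

section \<open>The RGD system as an instance of the abstract setting\<close>

lemma rgd_core: "rgd_core W S G U T N \<psi>"
proof (intro rgd_core.intro rgd_core_axioms.intro)
  fix n \<alpha> u assume "n \<in> N" "\<alpha> \<in> rgd.roots" "u \<in> U \<alpha>"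
  then show "n \<otimes> u \<otimes> inv n \<in> U (\<psi> n <#\<^bsub>W\<^esub> \<alpha>)" using acts_conj acts_N by blast
next
  fix \<alpha> \<beta> x y
  assume r: "\<alpha> \<in> rgd.roots" "\<beta> \<in> rgd.roots" "\<alpha> \<noteq> \<beta>" "rgd.prenilpotent \<alpha> \<beta>" "x \<in> U \<alpha>" "y \<in> U \<beta>"
  then have "x \<otimes> y \<otimes> inv x \<otimes> inv y \<in> commutator_subgroup G (U \<alpha>) (U \<beta>)"
    unfolding commutator_subgroup_def by (intro generate.incl) blast
  then show "x \<otimes> y \<otimes> inv x \<otimes> inv y \<in> generate G (\<Union>\<gamma> \<in> rgd.open_interval \<alpha> \<beta>. U \<gamma>)"
    using rgd.RGD1 [OF r(1-4)] by blast
next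
  fix s u assume s: "s \<in> S" and u: "u \<in> U (rgd.simple_root s)" "u \<noteq> \<one>"
  then show "\<exists>a\<in>U (rgd.neg (rgd.simple_root s)). \<exists>b\<in>U (rgd.neg (rgd.simple_root s)). a \<otimes> u \<otimes> b \<in> N \<and> \<psi> (a \<otimes> u \<otimes> b) = s"
    using mu_props(2) [OF s u] mu_N [OF s u] \<psi>_mu [OF s u] by metis
next
  fix s y assume s: "s \<in> S" and y: "y \<in> U (rgd.neg (rgd.simple_root s))" "y \<noteq> \<one>"
  then obtain u v a b where uv: "u \<in> U (rgd.simple_root s)" "u \<noteq> \<one>" "v \<in> U (rgd.simple_root s)" "v \<noteq> \<one>"
    "a \<in> U (rgd.simple_root s)" "b \<in> U (rgd.simple_root s)"
    "\<mu> s u \<otimes> \<mu> s v \<otimes> inv (\<mu> s u) = a \<otimes> y \<otimes> b" by (rule mu_neg_exists)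
  have r: "rgd.simple_root s \<in> rgd.roots" using s rgd.simple_root_in_roots by auto
  have inv_u: "inv u \<in> U (rgd.simple_root s)" "inv u \<noteq> \<one>"
    using uv U_carrier [OF r] subgroup.m_inv_closed [OF rgd.U_subgroup [OF r]] by auto
  have N: "\<mu> s u \<in> N" "\<mu> s v \<in> N" "inv (\<mu> s u) \<in> N" using mu_N s uv by auto
  have "\<psi> (inv (\<mu> s u)) = s" using mu_inv [OF s uv(1,2)] \<psi>_mu [OF s inv_u] by simp
  then have "\<psi> (a \<otimes> y \<otimes> b) = s \<otimes>\<^bsub>W\<^esub> s \<otimes>\<^bsub>W\<^esub> s"
    using uv(1-4) N s \<psi>_mu by (simp add: \<psi>_mult flip: uv(7))
  then have "\<psi> (a \<otimes> y \<otimes> b) = s" using s rgd.S_carrier by simp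
  moreover have "a \<otimes> y \<otimes> b \<in> N" using N by (simp flip: uv(7))
  ultimately show "\<exists>a\<in>U (rgd.simple_root s). \<exists>b\<in>U (rgd.simple_root s). a \<otimes> y \<otimes> b \<in> N \<and> \<psi> (a \<otimes> y \<otimes> b) = s"
    using uv by blast
next
  show "carrier G \<subseteq> generate G (N \<union> (\<Union>\<alpha> \<in> rgd.roots. U \<alpha>))"
  proof
    fix x assume "x \<in> carrier G"
    then obtain t u where "t \<in> T" "u \<in> generate G (\<Union>\<alpha> \<in> rgd.roots. U \<alpha>)" "x = t \<otimes> u"
      using rgd.RGD4 by (auto simp: set_mult_def)
    moreover have "generate G (\<Union>\<alpha> \<in> rgd.roots. U \<alpha>) \<subseteq> generate G (N \<union> (\<Union>\<alpha> \<in> rgd.roots. U \<alpha>))"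
      by (rule mono_generate) auto
    ultimately show "x \<in> generate G (N \<union> (\<Union>\<alpha> \<in> rgd.roots. U \<alpha>))"
      using T_N by (auto intro!: generate.eng intro: generate.incl)
  qed
qed (use rgd.coxeter_system_axioms group_axioms rgd.U_subgroup rgd.RGD0 N_subgroup \<psi>_closed \<psi>_mult \<psi>_surj T_kernel in auto)

lemma Upos_eq: "rgd_core.Upos W S G U = rgd.U_plus"
  unfolding rgd_core.Upos_def [OF rgd_core] rgd_core.root_gen_def [OF rgd_core] rgd.U_plus_def rgd.pos_roots_def ..

lemma Uneg_eq: "rgd_core.Uneg W S G U = rgd.U_minus"
proof -
  have "\<Union> (U ` {\<gamma> \<in> rgd.roots. \<one>\<^bsub>W\<^esub> \<notin> \<gamma>}) = (\<Union>\<alpha> \<in> rgd.pos_roots. U (rgd.neg \<alpha>))"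
  proof (intro equalityI UN_least)
    fix \<gamma> assume "\<gamma> \<in> {\<gamma> \<in> rgd.roots. \<one>\<^bsub>W\<^esub> \<notin> \<gamma>}"
    then have "rgd.neg \<gamma> \<in> rgd.pos_roots" "rgd.neg (rgd.neg \<gamma>) = \<gamma>"
      using rgd.neg_in_roots rgd.neg_neg by (auto simp: rgd.pos_roots_def) (auto simp: rgd.neg_def)
    then show "U \<gamma> \<subseteq> (\<Union>\<alpha> \<in> rgd.pos_roots. U (rgd.neg \<alpha>))"
      using UN_upper [of "rgd.neg \<gamma>" rgd.pos_roots "\<lambda>\<alpha>. U (rgd.neg \<alpha>)"] by simp
  next
    fix \<alpha> assume "\<alpha> \<in> rgd.pos_roots"
    then have "rgd.neg \<alpha> \<in> {\<gamma> \<in> rgd.roots. \<one>\<^bsub>W\<^esub> \<notin> \<gamma>}"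
      using rgd.neg_in_roots by (auto simp: rgd.pos_roots_def) (auto simp: rgd.neg_def)
    then show "U (rgd.neg \<alpha>) \<subseteq> \<Union> (U ` {\<gamma> \<in> rgd.roots. \<one>\<^bsub>W\<^esub> \<notin> \<gamma>})" by blast
  qed
  then show ?thesis
    unfolding rgd_core.Uneg_def [OF rgd_core] rgd_core.root_gen_def [OF rgd_core] rgd.U_minus_def by simp
qed

lemma rgd_bruhat: "rgd_bruhat W S G U T N \<psi>"
  using rgd.RGD3 by (intro rgd_bruhat.intro rgd_bruhat_axioms.intro rgd_core) (simp add: Upos_eq)

lemma B_eq: "rgd_core.B W S G U T = rgd.B_plus"
  unfolding rgd_core.B_def [OF rgd_core] Upos_eq rgd.B_plus_def by (auto simp: set_mult_def)

lemma Bneg_eq: "rgd_bruhat.Bneg W S G U T = rgd.B_minus"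
  unfolding rgd_bruhat.Bneg_def [OF rgd_bruhat] Uneg_eq rgd.B_minus_def by (auto simp: set_mult_def)

section \<open>Distances between cosets and the projection\<close>

lemma mem_l_coset_self: "subgroup H G \<Longrightarrow> g \<in> carrier G \<Longrightarrow> g \<in> g <# H"
  unfolding l_coset_def using subgroup.one_closed by (auto intro!: bexI [of _ \<one>])

lemma double_coset_eq:
  assumes "subgroup H G" "subgroup K G" "g \<in> carrier G" "h \<in> H" "k \<in> K"
  shows "double_coset G H (h \<otimes> g \<otimes> k) K = double_coset G H g K"
proof -
  have c: "h \<in> carrier G" "k \<in> carrier G" "H \<subseteq> carrier G" "K \<subseteq> carrier G"
    using assms subgroup.mem_carrier subgroup.subset by auto
  have "x \<otimes> (h \<otimes> g \<otimes> k) \<otimes> y \<in> double_coset G H g K" if "x \<in> H" "y \<in> K" for x y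
  proof -
    have "x \<otimes> (h \<otimes> g \<otimes> k) \<otimes> y = (x \<otimes> h) \<otimes> g \<otimes> (k \<otimes> y)"
      using that assms c by (simp add: group_normalize subset_iff)
    then show ?thesis using that assms unfolding mem_double_coset by (meson subgroup.m_closed)
  qed
  moreover have "x \<otimes> g \<otimes> y \<in> double_coset G H (h \<otimes> g \<otimes> k) K" if "x \<in> H" "y \<in> K" for x y
  proof -
    have "x \<otimes> g \<otimes> y = (x \<otimes> inv h) \<otimes> (h \<otimes> g \<otimes> k) \<otimes> (inv k \<otimes> y)"
      using that assms c by (simp add: group_normalize subset_iff)
    then show ?thesis using that assms unfolding mem_double_coset by (meson subgroup.m_closed subgroup.m_inv_closed)
  qed
  ultimately show ?thesis
    by (intro equalityI subsetI) (auto simp: mem_double_coset [of _ G H "h \<otimes> g \<otimes> k"] mem_double_coset [of _ G H g])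
qed

text \<open>Other representatives of the two cosets change b and c only. The assumption
  \<open>unique\<close> is the Birkhoff uniqueness for the codistance and the Bruhat uniqueness for
  the distance, so both are treated at once.\<close>

lemma coset_dist_eq:
  assumes sub: "subgroup H G" "subgroup K G"
    and unique: "\<And>b n c b' n' c'. b \<in> H \<Longrightarrow> n \<in> N \<Longrightarrow> c \<in> K \<Longrightarrow> b' \<in> H \<Longrightarrow> n' \<in> N \<Longrightarrow> c' \<in> K \<Longrightarrow>
      b \<otimes> n \<otimes> c = b' \<otimes> n' \<otimes> c' \<Longrightarrow> \<psi> n = \<psi> n'"
    and gh: "g \<in> carrier G" "h \<in> carrier G" "b \<in> H" "n \<in> N" "c \<in> K" "inv g \<otimes> h = b \<otimes> n \<otimes> c"
  shows "rgd.coset_dist \<mu> H K (g <# H) (h <# K) = \<psi> n"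
  unfolding rgd.coset_dist_def
proof (rule the_equality)
  have "double_coset G H (inv g \<otimes> h) K = double_coset G H n K"
    using double_coset_eq [OF sub] gh by simp
  then show "\<psi> n \<in> carrier W \<and> (\<exists>g' \<in> carrier G. \<exists>h' \<in> carrier G. \<exists>n' \<in> rgd.representatives \<mu> (\<psi> n).
      g <# H = g' <# H \<and> h <# K = h' <# K \<and> double_coset G H (inv g' \<otimes> h') K = double_coset G H n' K)"
    using gh \<psi>_closed unfolding representatives_eq by blast
next
  fix w
  assume "w \<in> carrier W \<and> (\<exists>g' \<in> carrier G. \<exists>h' \<in> carrier G. \<exists>n' \<in> rgd.representatives \<mu> w.
      g <# H = g' <# H \<and> h <# K = h' <# K \<and> double_coset G H (inv g' \<otimes> h') K = double_coset G H n' K)"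
  then obtain g' h' n' where *: "g' \<in> carrier G" "h' \<in> carrier G" "n' \<in> N" "\<psi> n' = w"
    "g <# H = g' <# H" "h <# K = h' <# K" "double_coset G H (inv g' \<otimes> h') K = double_coset G H n' K"
    unfolding representatives_eq by blast
  have "g' \<in> g <# H" "h' \<in> h <# K" using mem_l_coset_self sub * by simp_all
  then obtain b0 c0 where bc: "b0 \<in> H" "g' = g \<otimes> b0" "c0 \<in> K" "h' = h \<otimes> c0" by (auto simp: l_coset_def)
  have one: "\<one> \<in> H" "\<one> \<in> K" using sub subgroup.one_closed by auto
  have "inv g' \<otimes> h' \<in> double_coset G H (inv g' \<otimes> h') K"
    unfolding mem_double_coset using one * by (auto intro!: bexI [of _ \<one>])
  then obtain b1 c1 where b1: "b1 \<in> H" "c1 \<in> K" "inv g' \<otimes> h' = b1 \<otimes> n' \<otimes> c1"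
    unfolding *(7) mem_double_coset by blast
  have carr [simp]: "b0 \<in> carrier G" "b1 \<in> carrier G" "c0 \<in> carrier G" "c1 \<in> carrier G"
    using bc b1 sub subgroup.mem_carrier by metis+
  have "inv g \<otimes> h = b0 \<otimes> (inv g' \<otimes> h') \<otimes> inv c0" using gh bc by (simp add: group_normalize)
  also have "\<dots> = (b0 \<otimes> b1) \<otimes> n' \<otimes> (c1 \<otimes> inv c0)" using * unfolding b1(3) by (simp add: group_normalize)
  finally have "b \<otimes> n \<otimes> c = (b0 \<otimes> b1) \<otimes> n' \<otimes> (c1 \<otimes> inv c0)" using gh by simp
  then have "\<psi> n = \<psi> n'"
    using gh * bc b1 sub by (intro unique [of b n c "b0 \<otimes> b1" n' "c1 \<otimes> inv c0"])
      (auto simp: subgroup.m_closed subgroup.m_inv_closed)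
  then show "w = \<psi> n" using * by simp
qed

theorem projection_formula:
  assumes g: "g \<in> carrier G" "h \<in> carrier G"
    and w: "rgd.codist \<mu> (g <# rgd.B_plus) (h <# rgd.B_minus) = w"
    and s: "s \<in> S" "rgd.len w < rgd.len (w \<otimes>\<^bsub>W\<^esub> s)"
    and reps: "n \<in> rgd.representatives \<mu> w" "m \<in> rgd.representatives \<mu> s"
  shows "rgd.proj \<mu> (rgd.panel_minus \<mu> s (h <# rgd.B_minus)) (g <# rgd.B_plus) =
    (h \<otimes> inv (rgd.rho n (inv g \<otimes> h)) \<otimes> m) <# rgd.B_minus"
proof -
  interpret core: rgd_bruhat W S G U T N \<psi>
    rewrites "core.Upos = rgd.U_plus" and "core.Uneg = rgd.U_minus"
      and "core.B = rgd.B_plus" and "core.Bneg = rgd.B_minus"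
    by (rule rgd_bruhat) (rule Upos_eq, rule Uneg_eq, rule B_eq, rule Bneg_eq)
  have n: "n \<in> N" "\<psi> n = w" and m: "m \<in> N" "\<psi> m = s" using reps by (auto simp: representatives_eq)
  have sW: "s \<in> carrier W" and wW: "w \<in> carrier W" using s n \<psi>_closed rgd.S_carrier by auto
  have [simp]: "g \<in> carrier G" "h \<in> carrier G" "n \<in> carrier G" "m \<in> carrier G" using g n m by auto
  have codist: "rgd.codist \<mu> (g <# rgd.B_plus) (h' <# rgd.B_minus) = \<psi> k"
    if "h' \<in> carrier G" "b \<in> rgd.B_plus" "k \<in> N" "c \<in> rgd.B_minus" "inv g \<otimes> h' = b \<otimes> k \<otimes> c" for h' b k c
    unfolding rgd.codist_def
    by (rule coset_dist_eq [OF core.B_subgroup core.Bneg_subgroup _ _ _ that(2-5)])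
      (rule core.birkhoff_unique, assumption+, simp_all add: that(1))
  have dist: "rgd.dist_minus \<mu> (h <# rgd.B_minus) (h' <# rgd.B_minus) = \<psi> k"
    if "h' \<in> carrier G" "b \<in> rgd.B_minus" "k \<in> N" "c \<in> rgd.B_minus" "inv h \<otimes> h' = b \<otimes> k \<otimes> c" for h' b k c
    unfolding rgd.dist_minus_def
    by (rule coset_dist_eq [OF core.Bneg_subgroup core.Bneg_subgroup _ _ _ that(2-5)])
      (rule core.bruhat_neg_unique, assumption+, simp_all add: that(1))
  obtain b k c where bkc: "b \<in> rgd.B_plus" "k \<in> N" "c \<in> rgd.B_minus" "inv g \<otimes> h = b \<otimes> k \<otimes> c"
    using core.birkhoff_exists [of "inv g \<otimes> h"] by auto
  have [simp]: "b \<in> carrier G" "c \<in> carrier G" "k \<in> carrier G" using bkc by auto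
  have "\<psi> k = w" using codist [OF _ bkc] w by simp
  \<comment> \<open>The Birkhoff decomposition may use a representative of \<open>w\<close> other
    than the given \<open>n\<close>; the discrepancy in \<open>T\<close> is moved into
    \<open>B_plus\<close>.\<close>
  then have "k \<otimes> inv n \<in> T" using \<psi>_inj bkc n by simp
  then have "b \<otimes> (k \<otimes> inv n) \<in> rgd.B_plus" using bkc by simp
  then obtain a c1 where ac: "a \<in> rgd.U_plus" "n \<otimes> a \<otimes> inv n \<in> rgd.U_plus" "c1 \<in> rgd.B_minus"
      "inv n \<otimes> (b \<otimes> (k \<otimes> inv n)) = a \<otimes> c1 \<otimes> inv n"
    using core.N_conj_B_decomp [OF n(1)] by metis
  have [simp]: "a \<in> carrier G" "c1 \<in> carrier G" using ac by auto
  define y where "y = c1 \<otimes> c"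
  have y: "y \<in> rgd.B_minus" and [simp]: "y \<in> carrier G" using ac bkc by (auto simp: y_def)
  have "inv n \<otimes> (inv g \<otimes> h) = (inv n \<otimes> (b \<otimes> (k \<otimes> inv n))) \<otimes> n \<otimes> c"
    unfolding bkc(4) by (simp add: group_normalize)
  also have "\<dots> = a \<otimes> y" unfolding ac(4) by (simp add: y_def group_normalize)
  finally have ay: "inv n \<otimes> (inv g \<otimes> h) = a \<otimes> y" .
  \<comment> \<open>\<open>y\<close> is the negative part of the product with \<open>a\<close> in
    \<open>U_plus\<close>; its uniqueness is the triviality of the intersection of
    \<open>U_plus\<close> with \<open>B_minus\<close>.\<close>
  have "rgd.rho n (inv g \<otimes> h) = y"
    unfolding rgd.rho_def rgd.pi_minus_def ay
  proof (rule the_equality)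
    have sub: "subgroup rgd.U_plus G" using core.Upos_subgroup .
    have "rgd.U_plus #> a = rgd.U_plus" using coset_join2 [of a] sub ac by simp
    then show "y \<in> rgd.B_minus \<and> rgd.U_plus #> (a \<otimes> y) = rgd.U_plus #> y"
      using y coset_mult_assoc [of rgd.U_plus a y] subgroup.subset [OF sub] by simp
    fix z assume z: "z \<in> rgd.B_minus \<and> rgd.U_plus #> (a \<otimes> y) = rgd.U_plus #> z"
    then have [simp]: "z \<in> carrier G" by simp
    have "z \<in> rgd.U_plus #> z" using sub subgroup.one_closed unfolding r_coset_def by force
    then have "z \<in> rgd.U_plus #> (a \<otimes> y)" using z by simp
    then obtain x where x: "x \<in> rgd.U_plus" "z = x \<otimes> (a \<otimes> y)" by (auto simp: r_coset_def)
    then have "x \<otimes> a = z \<otimes> inv y" by (simp add: group_normalize)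
    then have "x \<otimes> a \<in> rgd.B_minus" using z y by simp
    then have "x \<otimes> a = \<one>" using core.Upos_inter_Bneg x ac by simp
    moreover have "z = (x \<otimes> a) \<otimes> y" using x by (simp add: group_normalize)
    ultimately show "z = y" by simp
  qed
  then have rho: "(h \<otimes> inv (rgd.rho n (inv g \<otimes> h)) \<otimes> m) <# rgd.B_minus = (h \<otimes> inv y \<otimes> m) <# rgd.B_minus"
    by simp
  have gh: "inv g \<otimes> h = n \<otimes> a \<otimes> y"
  proof -
    have "n \<otimes> (inv n \<otimes> (inv g \<otimes> h)) = n \<otimes> (a \<otimes> y)" using ay by simp
    then show ?thesis by (simp add: group_normalize)
  qed
  define d0 where "d0 = (h \<otimes> inv y \<otimes> m) <# rgd.B_minus"
  let ?P = "rgd.panel_minus \<mu> s (h <# rgd.B_minus)"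
  \<comment> \<open>As \<open>y\<close> lies in \<open>B_minus\<close>, the chamber of
    \<open>h \<otimes> inv y\<close> is that of \<open>h\<close>; right multiplication by
    \<open>m\<close> moves it to an s-neighbour.\<close>
  have "rgd.dist_minus \<mu> (h <# rgd.B_minus) d0 = s"
    unfolding d0_def using dist [of "h \<otimes> inv y \<otimes> m" "inv y" m \<one>] y m by (simp add: group_normalize)
  then have d0P: "d0 \<in> ?P"
    unfolding rgd.panel_minus_def rgd.chambers_minus_def d0_def by auto
  have d0_codist: "rgd.codist \<mu> (g <# rgd.B_plus) d0 = w \<otimes>\<^bsub>W\<^esub> s"
  proof -
    have "inv g \<otimes> (h \<otimes> inv y \<otimes> m) = (inv g \<otimes> h) \<otimes> inv y \<otimes> m" by (simp add: group_normalize)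
    also have "\<dots> = (n \<otimes> a \<otimes> inv n) \<otimes> (n \<otimes> m) \<otimes> \<one>" unfolding gh by (simp add: group_normalize)
    finally show ?thesis
      unfolding d0_def using codist [of _ "n \<otimes> a \<otimes> inv n" "n \<otimes> m" \<one>] ac n m by (simp add: \<psi>_mult)
  qed
  have other: "d = d0 \<or> rgd.codist \<mu> (g <# rgd.B_plus) d = w" if d: "d \<in> ?P" for d
  proof -
    obtain h' where h': "h' \<in> carrier G" "d = h' <# rgd.B_minus" "rgd.dist_minus \<mu> (h <# rgd.B_minus) d \<in> {\<one>\<^bsub>W\<^esub>, s}"
      using d unfolding rgd.panel_minus_def rgd.chambers_minus_def by blast
    obtain b' k' c' where k': "b' \<in> rgd.B_minus" "k' \<in> N" "c' \<in> rgd.B_minus" "inv h \<otimes> h' = b' \<otimes> k' \<otimes> c'"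
      using core.bruhat_neg_exists [of "inv h \<otimes> h'"] h' by auto
    then have \<psi>k': "\<psi> k' \<in> {\<one>\<^bsub>W\<^esub>, s}" using dist [OF h'(1) k'] h' by simp
    have [simp]: "h' \<in> carrier G" "b' \<in> carrier G" "k' \<in> carrier G" "c' \<in> carrier G" using h' k' by auto
    \<comment> \<open>\<open>p\<close> is the position of \<open>h'\<close> relative to
      \<open>h \<otimes> inv y\<close>, an equivalent base point of the panel for which the element
      from \<open>c_plus\<close> is just \<open>n \<otimes> a\<close>.\<close>
    define p where "p = y \<otimes> (inv h \<otimes> h')"
    have p: "p = (y \<otimes> b') \<otimes> k' \<otimes> c'" unfolding p_def k'(4) by (simp add: group_normalize)
    have h'p: "h' = h \<otimes> inv y \<otimes> p" by (simp add: p_def group_normalize)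
    have pp: "p \<in> rgd.B_minus \<or> (\<exists>c \<in> rgd.B_minus. \<exists>m' \<in> N. \<exists>c' \<in> rgd.B_minus. \<psi> m' = s \<and> p = c \<otimes> m' \<otimes> c')"
    proof (cases "\<psi> k' = s")
      case True
      moreover have "y \<otimes> b' \<in> rgd.B_minus" using y k' by simp
      ultimately show ?thesis using p k' by blast
    next
      case False
      then have "k' \<in> T" using \<psi>k' k' T_kernel by auto
      then have "p \<in> rgd.B_minus" using y k' core.T_Bneg unfolding p by simp
      then show ?thesis by blast
    qed
    have len: "rgd.len (\<psi> n) < rgd.len (\<psi> n \<otimes>\<^bsub>W\<^esub> s)" using s n by simp
    show ?thesis
    proof (cases rule: core.panel_neg_cases [OF s(1) m n(1) len ac(1,2) pp, case_names upper lower])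
      case (upper c2)
      then have [simp]: "c2 \<in> carrier G" by simp
      have "h' = (h \<otimes> inv y \<otimes> m) \<otimes> c2" unfolding h'p upper(2) by (simp add: group_normalize)
      then have "h' <# rgd.B_minus = (h \<otimes> inv y \<otimes> m) <# (c2 <# rgd.B_minus)"
        using subgroup.subset [OF core.Bneg_subgroup] by (simp add: lcos_m_assoc)
      also have "c2 <# rgd.B_minus = rgd.B_minus"
        using coset_join3 [OF _ core.Bneg_subgroup upper(1)] by simp
      finally show ?thesis using h' by (simp add: d0_def)
    next
      case (lower b2 c2)
      have "inv g \<otimes> h' = (inv g \<otimes> h) \<otimes> inv y \<otimes> p" unfolding h'p by (simp add: p_def group_normalize)
      also have "\<dots> = n \<otimes> a \<otimes> p" unfolding gh by (simp add: p_def group_normalize)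
      finally have "rgd.codist \<mu> (g <# rgd.B_plus) d = \<psi> n"
        using codist [of h' b2 n c2] lower n h' by simp
      then show ?thesis using n by simp
    qed
  qed
  \<comment> \<open>Only the two codistances \<open>w\<close> and ws occur on the panel, and
    \<open>d0\<close> alone attains the larger one.\<close>
  have less: "rgd.bruhat_less w (w \<otimes>\<^bsub>W\<^esub> s)" using rgd.bruhat_less_mult_S wW s by blast
  have "rgd.proj \<mu> ?P (g <# rgd.B_plus) = d0"
    unfolding rgd.proj_def
  proof (rule the_equality)
    show "d0 \<in> ?P \<and> \<not> (\<exists>e \<in> ?P. rgd.bruhat_less (rgd.codist \<mu> (g <# rgd.B_plus) d0) (rgd.codist \<mu> (g <# rgd.B_plus) e))"
    proof (intro conjI notI d0P)
      assume "\<exists>e \<in> ?P. rgd.bruhat_less (rgd.codist \<mu> (g <# rgd.B_plus) d0) (rgd.codist \<mu> (g <# rgd.B_plus) e)"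
      then obtain e where e: "e \<in> ?P" "rgd.bruhat_less (w \<otimes>\<^bsub>W\<^esub> s) (rgd.codist \<mu> (g <# rgd.B_plus) e)"
        using d0_codist by auto
      then have "rgd.len (w \<otimes>\<^bsub>W\<^esub> s) < rgd.len (rgd.codist \<mu> (g <# rgd.B_plus) e)" using rgd.bruhat_less_len by blast
      then show False using other [OF e(1)] d0_codist s by auto
    qed
    fix d assume d: "d \<in> ?P \<and> \<not> (\<exists>e \<in> ?P. rgd.bruhat_less (rgd.codist \<mu> (g <# rgd.B_plus) d) (rgd.codist \<mu> (g <# rgd.B_plus) e))"
    then show "d = d0" using other [of d] d0P d0_codist less by metis
  qed
  then show ?thesis unfolding rho d0_def .
qed

end

theorem theorem2p22:
  fixes W :: "('w, 'x) monoid_scheme" and S :: "'w set"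
    and G :: "('g, 'y) monoid_scheme" and U :: "'w set \<Rightarrow> 'g set" and T :: "'g set"
    and \<mu> :: "'w \<Rightarrow> 'g \<Rightarrow> 'g"
    and g h :: 'g and c_plus c_minus :: "'g set"
    and w s :: 'w and n_w n_s :: 'g
  assumes "rgd_system W S G U T"
    and "root_group_data.mu_family W S G U \<mu>"
    and "g \<in> carrier G" and "h \<in> carrier G"
    and "c_plus = g <#\<^bsub>G\<^esub> rgd_system.B_plus W S G U T"
    and "c_minus = h <#\<^bsub>G\<^esub> rgd_system.B_minus W S G U T"
    and "w \<in> carrier W" and "rgd_system.codist W S G U T \<mu> c_plus c_minus = w"
    and "s \<in> S"
    and "coxeter_system.len W S (w \<otimes>\<^bsub>W\<^esub> s) > coxeter_system.len W S w"
    and "n_w \<in> rgd_system.representatives W S G U T \<mu> w"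
    and "n_s \<in> rgd_system.representatives W S G U T \<mu> s"
  shows "rgd_system.proj W S G U T \<mu> (rgd_system.panel_minus W S G U T \<mu> s c_minus) c_plus
    = (h \<otimes>\<^bsub>G\<^esub> inv\<^bsub>G\<^esub> (rgd_system.rho W S G U T n_w (inv\<^bsub>G\<^esub> g \<otimes>\<^bsub>G\<^esub> h)) \<otimes>\<^bsub>G\<^esub> n_s)
        <#\<^bsub>G\<^esub> rgd_system.B_minus W S G U T"
proof -
  interpret rgd: rgd_system W S G U T by (rule assms(1))
  \<comment> \<open>The isomorphism is part of what it means for \<open>n_w\<close> to be a
    representative, so its existence comes from that hypothesis.\<close>
  obtain \<phi> where "\<phi> \<in> iso (G\<lparr>carrier := rgd.N_group \<mu>\<rparr> Mod T) W"
    "\<forall>s \<in> S. \<forall>u \<in> U (rgd.simple_root s) - {\<one>\<^bsub>G\<^esub>}. \<phi> (T #>\<^bsub>G\<^esub> \<mu> s u) = s"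
    using assms(11) unfolding rgd.representatives_def by blast
  then interpret rgd_rep W S G U T \<mu> \<phi>
    using assms(1,2) rgd.G.group_axioms by (intro rgd_rep.intro rgd_rep_axioms.intro) auto
  show ?thesis
    using projection_formula [of g h w s n_w n_s] assms by blast
qed

end
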